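(* Let $F:(M_1,g_1,J_1)\to(M_2,g_2,J_2)$ be a holomorphic Riemannian map from a Kähler manifold $(M_1,g_1,J_1)$ to an almost Hermitian manifold $(M_2,g_2,J_2)$. Then $F$ is harmonic if and only if the distribution $F_*((\ker F_* )^\perp)$ is minimal.
   Context: An almost Hermitian manifold $(M,g,J)$ is a Riemannian manifold with a $(1,1)$-tensor field $J$ such that $J^2=-I$ and $g(JX,JY)=g(X,Y)$ for all vector fields $X,Y$. It is called Kähler if $(\nabla_XJ)Y=0$ for all $X,Y$, where $\nabla$ is the Levi-Civita connection. Riemannian map: a smooth map $F:(M_1,g_1)\to(M_2,g_2)$ between Riemannian manifolds is a Riemannian map if at every $p\in M_1$ the restriction of $F_{*p}$ to $(\ker F_{*p})^\perp$ is a linear isometry onto $\operatorname{range}F_{*p}$ (with the induced inner products), i.e. $g_2(F_*X,F_*Y)=g_1(X,Y)$ for $X,Y$ in $(\ker F_* )^\perp$. Isometric immersions ($\ker F_*=\{0\}$) and Riemannian submersions ($(\operatorname{range}F_* )^\perp=\{0\}$) are particular cases. It is known that a Riemannian map is a subimmersion and its rank is constant, so $\ker F_*$ and $(\ker F_* )^\perp$ are subbundles of $TM_1$, and $\operatorname{range}F_*=F_*((\ker F_* )^\perp)$ and its orthogonal complement $(\operatorname{range}F_* )^\perp$ are subbundles of the pullback bundle $F^{-1}TM_2$. Holomorphic Riemannian map: a Riemannian map $F$ between almost Hermitian manifolds $(M_1,g_1,J_1)$ and $(M_2,g_2,J_2)$ with $J_2F_*=F_*J_1$ at every point of $M_1$.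 Second fundamental form of $F$: $(\nabla F_* )(X,Y)=\nabla^F_XF_*(Y)-F_*(\nabla^1_XY)$ for $X,Y\in\Gamma(TM_1)$, where $\nabla^1$ is the Levi-Civita connection of $M_1$ and $\nabla^F$ is the pullback along $F$ of the Levi-Civita connection of $M_2$. $F$ is harmonic if its tension field $\tau(F)=\operatorname{trace}(\nabla F_* )=\sum_i(\nabla F_* )(e_i,e_i)$ ($\{e_i\}$ a local orthonormal frame of $M_1$) vanishes. Minimality: the mean curvature vector field of $\operatorname{range}F_*=F_*((\ker F_* )^\perp)$ is (up to a nonzero constant factor) $H_{(\operatorname{range}F_* )}=\sum_s\sum_a g_2(\nabla^F_{e_a}F_*(e_a),\mu_s)\,\mu_s$, where $\{e_a\}$ is a local orthonormal frame of $(\ker F_* )^\perp$ and $\{\mu_s\}$ a local orthonormal frame of $(\operatorname{range}F_* )^\perp$. The distribution $F_*((\ker F_* )^\perp)$ is minimal if $H_{(\operatorname{range}F_* )}=0$. *)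

theory Defs
  imports "HOL-Analysis.Analysis" "HOL-Library.Function_Algebras"
begin

text \<open>Functions into a real vector space form a real vector space pointwise; tangent vectors are
  encoded as such functions below.\<close>

instantiation "fun" :: (type, real_vector) real_vector
begin

definition scaleR_fun :: "real \<Rightarrow> ('a \<Rightarrow> 'b) \<Rightarrow> 'a \<Rightarrow> 'b" where
  "scaleR_fun r f = (\<lambda>x. r *\<^sub>R f x)"

instance
  by standard (auto simp: scaleR_fun_def fun_eq_iff scaleR_add_right scaleR_add_left)

end


section \<open>Smooth manifolds\<close>

text \<open>\<open>C\<^sup>k\<close> and \<open>C\<^sup>\<infinity>\<close> functions; only used for open \<open>S\<close>.\<close>

fun Ck_on :: "nat \<Rightarrow> 'a::real_normed_vector set \<Rightarrow> ('a \<Rightarrow> 'b::real_normed_vector) \<Rightarrow> bool" where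
  "Ck_on 0 S f \<longleftrightarrow> continuous_on S f"
| "Ck_on (Suc k) S f \<longleftrightarrow> (\<forall>x\<in>S. f differentiable (at x)) \<and>
     (\<forall>v. Ck_on k S (\<lambda>x. frechet_derivative f (at x) v))"

definition smooth_on :: "'a::real_normed_vector set \<Rightarrow> ('a \<Rightarrow> 'b::real_normed_vector) \<Rightarrow> bool" where
  "smooth_on S f \<longleftrightarrow> (\<forall>k. Ck_on k S f)"

text \<open>A chart is its domain together with the coordinate map; values of the coordinate map off the
  domain are irrelevant. The manifold is the whole type \<open>'m\<close>, whose topology is Hausdorff and second
  countable by its type classes; its dimension is \<open>DIM('e)\<close>. It need not be connected, and the atlas
  need not be maximal.\<close>

type_synonym ('m, 'e) chart = "'m set \<times> ('m \<Rightarrow> 'e)"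
type_synonym ('m, 'e) atlas = "('m, 'e) chart set"

abbreviation chart_inv :: "('m, 'e) chart \<Rightarrow> 'e \<Rightarrow> 'm" where
  "chart_inv c \<equiv> inv_into (fst c) (snd c)"

definition smooth_manifold ::
  "('m::{t2_space,second_countable_topology}, 'e::euclidean_space) atlas \<Rightarrow> bool" where
  "smooth_manifold M \<longleftrightarrow>
     (\<Union>c\<in>M. fst c) = UNIV \<and>
     (\<forall>c\<in>M. open (fst c) \<and> open (snd c ` fst c) \<and>
        homeomorphism (fst c) (snd c ` fst c) (snd c) (chart_inv c)) \<and>
     (\<forall>c\<in>M. \<forall>c'\<in>M. smooth_on (snd c ` (fst c \<inter> fst c')) (snd c' \<circ> chart_inv c))"

definition charts_at :: "('m, 'e) atlas \<Rightarrow> 'm \<Rightarrow> ('m, 'e) chart set" where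
  "charts_at M p = {c \<in> M. p \<in> fst c}"

definition smooth_fun_on ::
  "('m::topological_space, 'e::euclidean_space) atlas \<Rightarrow> 'm set \<Rightarrow> ('m \<Rightarrow> real) \<Rightarrow> bool" where
  "smooth_fun_on M U f \<longleftrightarrow> (\<forall>c\<in>M. smooth_on (snd c ` (U \<inter> fst c)) (f \<circ> chart_inv c))"

definition smooth_map ::
  "('m::topological_space, 'a::euclidean_space) atlas \<Rightarrow>
   ('n::topological_space, 'b::euclidean_space) atlas \<Rightarrow> ('m \<Rightarrow> 'n) \<Rightarrow> bool" where
  "smooth_map M N F \<longleftrightarrow> continuous_on UNIV F \<and>
     (\<forall>c\<in>M. \<forall>d\<in>N. smooth_on (snd c ` (fst c \<inter> F -` fst d)) (snd d \<circ> F \<circ> chart_inv c))"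


section \<open>Tangent vectors\<close>

text \<open>A tangent vector at \<open>p\<close> assigns to each chart around \<open>p\<close> its coordinate vector, subject to the
  transformation law; it is \<open>0\<close> on all other arguments, so that equality of tangent vectors is
  equality of functions.\<close>

type_synonym ('m, 'e) tvec = "('m, 'e) chart \<Rightarrow> 'e"

definition tangent_space :: "('m, 'e::euclidean_space) atlas \<Rightarrow> 'm \<Rightarrow> ('m, 'e) tvec set" where
  "tangent_space M p = {v.
     (\<forall>c\<in>charts_at M p. \<forall>c'\<in>charts_at M p.
        v c' = frechet_derivative (snd c' \<circ> chart_inv c) (at (snd c p)) (v c)) \<and>
     (\<forall>c. c \<notin> charts_at M p \<longrightarrow> v c = 0)}"

text \<open>The derivative \<open>v(h)\<close> of a function \<open>h\<close>, smooth near \<open>p\<close>, along a tangent vector \<open>v\<close> at \<open>p\<close>; by the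
  chain rule it does not depend on the chart.\<close>

definition vderiv ::
  "('m, 'e::euclidean_space) atlas \<Rightarrow> 'm \<Rightarrow> ('m, 'e) tvec \<Rightarrow> ('m \<Rightarrow> 'b::real_normed_vector) \<Rightarrow> 'b" where
  "vderiv M p v h =
     (let c = (SOME c. c \<in> charts_at M p) in frechet_derivative (h \<circ> chart_inv c) (at (snd c p)) (v c))"

definition push ::
  "('m, 'a::euclidean_space) atlas \<Rightarrow> ('n, 'b::euclidean_space) atlas \<Rightarrow> ('m \<Rightarrow> 'n) \<Rightarrow>
   'm \<Rightarrow> ('m, 'a) tvec \<Rightarrow> ('n, 'b) tvec" where
  "push M N F p v = (\<lambda>d. if d \<in> charts_at N (F p) then vderiv M p v (snd d \<circ> F) else 0)"

text \<open>Smooth sections over \<open>U\<close> of the pullback bundle \<open>F\<^sup>-\<^sup>1TN\<close>; vector fields are the case \<open>F = id\<close>.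
  Sections are total functions, with arbitrary values off \<open>U\<close>.\<close>

definition section_along ::
  "('m::topological_space, 'a::euclidean_space) atlas \<Rightarrow>
   ('n::topological_space, 'b::euclidean_space) atlas \<Rightarrow> ('m \<Rightarrow> 'n) \<Rightarrow> 'm set \<Rightarrow>
   ('m \<Rightarrow> ('n, 'b) tvec) \<Rightarrow> bool" where
  "section_along M N F U V \<longleftrightarrow>
     (\<forall>p\<in>U. V p \<in> tangent_space N (F p)) \<and>
     (\<forall>c\<in>M. \<forall>d\<in>N. smooth_on (snd c ` (U \<inter> fst c \<inter> F -` fst d)) (\<lambda>x. V (chart_inv c x) d))"

definition vector_field ::
  "('m::topological_space, 'e::euclidean_space) atlas \<Rightarrow> 'm set \<Rightarrow> ('m \<Rightarrow> ('m, 'e) tvec) \<Rightarrow> bool" where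
  "vector_field M U X \<longleftrightarrow> section_along M M id U X"

text \<open>In coordinates \<open>[X, Y]\<^sup>k = X(Y\<^sup>k) - Y(X\<^sup>k)\<close>.\<close>

definition lie_bracket ::
  "('m, 'e::euclidean_space) atlas \<Rightarrow> ('m \<Rightarrow> ('m, 'e) tvec) \<Rightarrow> ('m \<Rightarrow> ('m, 'e) tvec) \<Rightarrow>
   'm \<Rightarrow> ('m, 'e) tvec" where
  "lie_bracket M X Y p = (\<lambda>c. if c \<in> charts_at M p
     then vderiv M p (X p) (\<lambda>q. Y q c) - vderiv M p (Y p) (\<lambda>q. X q c) else 0)"


section \<open>Metrics and almost complex structures\<close>

type_synonym ('m, 'e) metric = "'m \<Rightarrow> ('m, 'e) tvec \<Rightarrow> ('m, 'e) tvec \<Rightarrow> real"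

text \<open>Only the values of a tensor on tangent vectors matter. Smoothness of a tensor means that it
  yields smooth results when evaluated on smooth local vector fields.\<close>

definition riemannian_manifold ::
  "('m::{t2_space,second_countable_topology}, 'e::euclidean_space) atlas \<Rightarrow> ('m, 'e) metric \<Rightarrow> bool" where
  "riemannian_manifold M g \<longleftrightarrow> smooth_manifold M \<and>
     (\<forall>p. \<forall>u\<in>tangent_space M p. \<forall>v\<in>tangent_space M p. \<forall>w\<in>tangent_space M p. \<forall>a b.
        g p (a *\<^sub>R u + b *\<^sub>R v) w = a * g p u w + b * g p v w) \<and>
     (\<forall>p. \<forall>u\<in>tangent_space M p. \<forall>v\<in>tangent_space M p. g p u v = g p v u) \<and>
     (\<forall>p. \<forall>v\<in>tangent_space M p. v \<noteq> 0 \<longrightarrow> g p v v > 0) \<and>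
     (\<forall>U X Y. open U \<and> vector_field M U X \<and> vector_field M U Y \<longrightarrow>
        smooth_fun_on M U (\<lambda>q. g q (X q) (Y q)))"

definition tensor_1_1 ::
  "('m::topological_space, 'e::euclidean_space) atlas \<Rightarrow>
   ('m \<Rightarrow> ('m, 'e) tvec \<Rightarrow> ('m, 'e) tvec) \<Rightarrow> bool" where
  "tensor_1_1 M J \<longleftrightarrow>
     (\<forall>p. \<forall>v\<in>tangent_space M p. J p v \<in> tangent_space M p) \<and>
     (\<forall>p. \<forall>v\<in>tangent_space M p. \<forall>w\<in>tangent_space M p. \<forall>a b.
        J p (a *\<^sub>R v + b *\<^sub>R w) = a *\<^sub>R J p v + b *\<^sub>R J p w) \<and>
     (\<forall>U X. open U \<and> vector_field M U X \<longrightarrow> vector_field M U (\<lambda>q. J q (X q)))"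

definition almost_hermitian_manifold ::
  "('m::{t2_space,second_countable_topology}, 'e::euclidean_space) atlas \<Rightarrow> ('m, 'e) metric \<Rightarrow>
   ('m \<Rightarrow> ('m, 'e) tvec \<Rightarrow> ('m, 'e) tvec) \<Rightarrow> bool" where
  "almost_hermitian_manifold M g J \<longleftrightarrow> riemannian_manifold M g \<and> tensor_1_1 M J \<and>
     (\<forall>p. \<forall>v\<in>tangent_space M p. J p (J p v) = - v) \<and>
     (\<forall>p. \<forall>v\<in>tangent_space M p. \<forall>w\<in>tangent_space M p. g p (J p v) (J p w) = g p v w)"


section \<open>Connections\<close>

text \<open>A linear connection on \<open>F\<^sup>-\<^sup>1TN\<close>: \<open>nabla p v V\<close> is the covariant derivative at \<open>p\<close>, along the tangent
  vector \<open>v\<close>, of a section \<open>V\<close> that is smooth on some open neighbourhood \<open>U\<close> of \<open>p\<close>. Thus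
  \<open>\<nabla>\<^sub>X V\<close> at \<open>p\<close> is \<open>nabla p (X p) V\<close>. Locality is a consequence: apply the Leibniz rule on a smaller
  neighbourhood to its indicator function.\<close>

type_synonym ('m, 'a, 'n, 'b) conn =
  "'m \<Rightarrow> ('m, 'a) tvec \<Rightarrow> ('m \<Rightarrow> ('n, 'b) tvec) \<Rightarrow> ('n, 'b) tvec"

definition connection_along ::
  "('m::topological_space, 'a::euclidean_space) atlas \<Rightarrow>
   ('n::topological_space, 'b::euclidean_space) atlas \<Rightarrow> ('m \<Rightarrow> 'n) \<Rightarrow> ('m, 'a, 'n, 'b) conn \<Rightarrow> bool" where
  "connection_along M N F nabla \<longleftrightarrow> (\<forall>U. open U \<longrightarrow>
     (\<forall>V p v. section_along M N F U V \<and> p \<in> U \<and> v \<in> tangent_space M p \<longrightarrow>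
        nabla p v V \<in> tangent_space N (F p)) \<and>
     (\<forall>X V. vector_field M U X \<and> section_along M N F U V \<longrightarrow>
        section_along M N F U (\<lambda>q. nabla q (X q) V)) \<and>
     (\<forall>V p v w a b. section_along M N F U V \<and> p \<in> U \<and> v \<in> tangent_space M p \<and> w \<in> tangent_space M p \<longrightarrow>
        nabla p (a *\<^sub>R v + b *\<^sub>R w) V = a *\<^sub>R nabla p v V + b *\<^sub>R nabla p w V) \<and>
     (\<forall>V W p v. section_along M N F U V \<and> section_along M N F U W \<and> p \<in> U \<and> v \<in> tangent_space M p \<longrightarrow>
        nabla p v (\<lambda>q. V q + W q) = nabla p v V + nabla p v W) \<and>
     (\<forall>f V p v. smooth_fun_on M U f \<and> section_along M N F U V \<and> p \<in> U \<and> v \<in> tangent_space M p \<longrightarrow>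
        nabla p v (\<lambda>q. f q *\<^sub>R V q) = vderiv M p v f *\<^sub>R V p + f p *\<^sub>R nabla p v V))"

text \<open>The Levi-Civita connection: the torsion-free metric connection on the tangent bundle.\<close>

definition levi_civita ::
  "('m::topological_space, 'e::euclidean_space) atlas \<Rightarrow> ('m, 'e) metric \<Rightarrow> ('m, 'e, 'm, 'e) conn \<Rightarrow> bool" where
  "levi_civita M g nabla \<longleftrightarrow> connection_along M M id nabla \<and>
     (\<forall>U X Y. open U \<and> vector_field M U X \<and> vector_field M U Y \<longrightarrow>
        (\<forall>p\<in>U. nabla p (X p) Y - nabla p (Y p) X = lie_bracket M X Y p) \<and>
        (\<forall>p\<in>U. \<forall>v\<in>tangent_space M p.
           vderiv M p v (\<lambda>q. g q (X q) (Y q)) = g p (nabla p v X) (Y p) + g p (X p) (nabla p v Y)))"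

text \<open>The pullback of \<open>nabla\<close> along \<open>F\<close>: the connection on \<open>F\<^sup>-\<^sup>1TN\<close> such that
  \<open>\<nabla>\<^sup>F\<^sub>v (Y \<circ> F) = \<nabla>\<^bsub>F\<^sub>*v\<^esub> Y\<close> for every local vector field \<open>Y\<close> of \<open>N\<close>.\<close>

definition pullback_connection ::
  "('m::topological_space, 'a::euclidean_space) atlas \<Rightarrow>
   ('n::topological_space, 'b::euclidean_space) atlas \<Rightarrow> ('m \<Rightarrow> 'n) \<Rightarrow>
   ('n, 'b, 'n, 'b) conn \<Rightarrow> ('m, 'a, 'n, 'b) conn \<Rightarrow> bool" where
  "pullback_connection M N F nabla nablaF \<longleftrightarrow> connection_along M N F nablaF \<and>
     (\<forall>U Y p v. open U \<and> vector_field N U Y \<and> F p \<in> U \<and> v \<in> tangent_space M p \<longrightarrow>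
        nablaF p v (Y \<circ> F) = nabla (F p) (push M N F p v) Y)"

text \<open>\<open>nabla\<close> is meant to be the Levi-Civita connection of \<open>g\<close>; the last condition is
  \<open>(\<nabla>\<^sub>v J) Y = \<nabla>\<^sub>v (J Y) - J (\<nabla>\<^sub>v Y) = 0\<close>.\<close>

definition kaehler_manifold ::
  "('m::{t2_space,second_countable_topology}, 'e::euclidean_space) atlas \<Rightarrow> ('m, 'e) metric \<Rightarrow>
   ('m \<Rightarrow> ('m, 'e) tvec \<Rightarrow> ('m, 'e) tvec) \<Rightarrow> ('m, 'e, 'm, 'e) conn \<Rightarrow> bool" where
  "kaehler_manifold M g J nabla \<longleftrightarrow> almost_hermitian_manifold M g J \<and> levi_civita M g nabla \<and>
     (\<forall>U Y. open U \<and> vector_field M U Y \<longrightarrow>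
        (\<forall>p\<in>U. \<forall>v\<in>tangent_space M p. nabla p v (\<lambda>q. J q (Y q)) - J p (nabla p v Y) = 0))"


section \<open>Riemannian maps\<close>

definition ker_push ::
  "('m, 'a::euclidean_space) atlas \<Rightarrow> ('n, 'b::euclidean_space) atlas \<Rightarrow> ('m \<Rightarrow> 'n) \<Rightarrow>
   'm \<Rightarrow> ('m, 'a) tvec set" where
  "ker_push M N F p = {v \<in> tangent_space M p. push M N F p v = 0}"

definition ker_push_perp ::
  "('m, 'a::euclidean_space) atlas \<Rightarrow> ('m, 'a) metric \<Rightarrow> ('n, 'b::euclidean_space) atlas \<Rightarrow>
   ('m \<Rightarrow> 'n) \<Rightarrow> 'm \<Rightarrow> ('m, 'a) tvec set" where
  "ker_push_perp M g N F p = {v \<in> tangent_space M p. \<forall>w\<in>ker_push M N F p. g p v w = 0}"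

definition range_push ::
  "('m, 'a::euclidean_space) atlas \<Rightarrow> ('n, 'b::euclidean_space) atlas \<Rightarrow> ('m \<Rightarrow> 'n) \<Rightarrow>
   'm \<Rightarrow> ('n, 'b) tvec set" where
  "range_push M N F p = push M N F p ` tangent_space M p"

definition range_push_perp ::
  "('m, 'a::euclidean_space) atlas \<Rightarrow> ('n, 'b::euclidean_space) atlas \<Rightarrow> ('n, 'b) metric \<Rightarrow>
   ('m \<Rightarrow> 'n) \<Rightarrow> 'm \<Rightarrow> ('n, 'b) tvec set" where
  "range_push_perp M N h F p =
     {v \<in> tangent_space N (F p). \<forall>w\<in>range_push M N F p. h (F p) v w = 0}"

definition riemannian_map ::
  "('m::topological_space, 'a::euclidean_space) atlas \<Rightarrow> ('m, 'a) metric \<Rightarrow>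
   ('n::topological_space, 'b::euclidean_space) atlas \<Rightarrow> ('n, 'b) metric \<Rightarrow> ('m \<Rightarrow> 'n) \<Rightarrow> bool" where
  "riemannian_map M g N h F \<longleftrightarrow> smooth_map M N F \<and>
     (\<forall>p. push M N F p ` ker_push_perp M g N F p = range_push M N F p \<and>
        (\<forall>v\<in>ker_push_perp M g N F p. \<forall>w\<in>ker_push_perp M g N F p.
           h (F p) (push M N F p v) (push M N F p w) = g p v w))"

definition holomorphic_riemannian_map ::
  "('m::topological_space, 'a::euclidean_space) atlas \<Rightarrow> ('m, 'a) metric \<Rightarrow>
   ('m \<Rightarrow> ('m, 'a) tvec \<Rightarrow> ('m, 'a) tvec) \<Rightarrow>
   ('n::topological_space, 'b::euclidean_space) atlas \<Rightarrow> ('n, 'b) metric \<Rightarrow>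
   ('n \<Rightarrow> ('n, 'b) tvec \<Rightarrow> ('n, 'b) tvec) \<Rightarrow> ('m \<Rightarrow> 'n) \<Rightarrow> bool" where
  "holomorphic_riemannian_map M g J N h J' F \<longleftrightarrow> riemannian_map M g N h F \<and>
     (\<forall>p. \<forall>v\<in>tangent_space M p. J' (F p) (push M N F p v) = push M N F p (J p v))"


section \<open>Harmonicity and minimality\<close>

text \<open>\<open>e 0, \<dots>, e (n - 1)\<close> is a smooth \<open>h\<close>-orthonormal frame over \<open>U\<close> of the subbundle \<open>D\<close> of \<open>F\<^sup>-\<^sup>1TN\<close>.\<close>

definition orthonormal_frame ::
  "('m::topological_space, 'a::euclidean_space) atlas \<Rightarrow>
   ('n::topological_space, 'b::euclidean_space) atlas \<Rightarrow> ('n, 'b) metric \<Rightarrow> ('m \<Rightarrow> 'n) \<Rightarrow>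
   ('m \<Rightarrow> ('n, 'b) tvec set) \<Rightarrow> 'm set \<Rightarrow> nat \<Rightarrow> (nat \<Rightarrow> 'm \<Rightarrow> ('n, 'b) tvec) \<Rightarrow> bool" where
  "orthonormal_frame M N h F D U n e \<longleftrightarrow>
     (\<forall>i<n. section_along M N F U (e i)) \<and>
     (\<forall>q\<in>U. \<forall>i<n. \<forall>j<n. h (F q) (e i q) (e j q) = (if i = j then 1 else 0)) \<and>
     (\<forall>q\<in>U. span ((\<lambda>i. e i q) ` {..<n}) = D q)"

definition second_fundamental_form ::
  "('m, 'a::euclidean_space) atlas \<Rightarrow> ('n, 'b::euclidean_space) atlas \<Rightarrow> ('m \<Rightarrow> 'n) \<Rightarrow>
   ('m, 'a, 'm, 'a) conn \<Rightarrow> ('m, 'a, 'n, 'b) conn \<Rightarrow>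
   ('m \<Rightarrow> ('m, 'a) tvec) \<Rightarrow> ('m \<Rightarrow> ('m, 'a) tvec) \<Rightarrow> 'm \<Rightarrow> ('n, 'b) tvec" where
  "second_fundamental_form M N F nabla nablaF X Y p =
     nablaF p (X p) (\<lambda>q. push M N F q (Y q)) - push M N F p (nabla p (X p) Y)"

text \<open>The tension field, computed in a local orthonormal frame \<open>e\<close> of \<open>TM\<close>.\<close>

definition tension ::
  "('m, 'a::euclidean_space) atlas \<Rightarrow> ('n, 'b::euclidean_space) atlas \<Rightarrow> ('m \<Rightarrow> 'n) \<Rightarrow>
   ('m, 'a, 'm, 'a) conn \<Rightarrow> ('m, 'a, 'n, 'b) conn \<Rightarrow>
   nat \<Rightarrow> (nat \<Rightarrow> 'm \<Rightarrow> ('m, 'a) tvec) \<Rightarrow> 'm \<Rightarrow> ('n, 'b) tvec" where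
  "tension M N F nabla nablaF n e p =
     (\<Sum>i<n. second_fundamental_form M N F nabla nablaF (e i) (e i) p)"

text \<open>The tension field does not depend on the frame, and frames exist near every point; so vanishing
  in every local frame is the same as vanishing in some frame near each point.\<close>

definition harmonic_map ::
  "('m::topological_space, 'a::euclidean_space) atlas \<Rightarrow> ('m, 'a) metric \<Rightarrow>
   ('n, 'b::euclidean_space) atlas \<Rightarrow> ('m \<Rightarrow> 'n) \<Rightarrow>
   ('m, 'a, 'm, 'a) conn \<Rightarrow> ('m, 'a, 'n, 'b) conn \<Rightarrow> bool" where
  "harmonic_map M g N F nabla nablaF \<longleftrightarrow>
     (\<forall>U n e. open U \<and> orthonormal_frame M M g id (tangent_space M) U n e \<longrightarrow>
        (\<forall>p\<in>U. tension M N F nabla nablaF n e p = 0))"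

text \<open>The (unnormalised) mean curvature vector of \<open>F\<^sub>*((ker F\<^sub>*)\<^sup>\<bottom>)\<close>, computed in a local orthonormal
  frame \<open>e\<close> of \<open>(ker F\<^sub>*)\<^sup>\<bottom>\<close> and a local orthonormal frame \<open>mu\<close> of \<open>(range F\<^sub>*)\<^sup>\<bottom>\<close>.\<close>

definition mean_curvature ::
  "('m, 'a::euclidean_space) atlas \<Rightarrow> ('n, 'b::euclidean_space) atlas \<Rightarrow> ('n, 'b) metric \<Rightarrow>
   ('m \<Rightarrow> 'n) \<Rightarrow> ('m, 'a, 'n, 'b) conn \<Rightarrow> nat \<Rightarrow> (nat \<Rightarrow> 'm \<Rightarrow> ('m, 'a) tvec) \<Rightarrow>
   nat \<Rightarrow> (nat \<Rightarrow> 'm \<Rightarrow> ('n, 'b) tvec) \<Rightarrow> 'm \<Rightarrow> ('n, 'b) tvec" where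
  "mean_curvature M N h F nablaF k e m mu p =
     (\<Sum>s<m. (\<Sum>a<k. h (F p) (nablaF p (e a p) (\<lambda>q. push M N F q (e a q))) (mu s p)) *\<^sub>R mu s p)"

text \<open>For a Riemannian map this vector is again independent of the frames, and both frames exist near
  every point because the rank is locally constant.\<close>

definition minimal_range ::
  "('m::topological_space, 'a::euclidean_space) atlas \<Rightarrow> ('m, 'a) metric \<Rightarrow>
   ('n::topological_space, 'b::euclidean_space) atlas \<Rightarrow> ('n, 'b) metric \<Rightarrow> ('m \<Rightarrow> 'n) \<Rightarrow>
   ('m, 'a, 'n, 'b) conn \<Rightarrow> bool" where
  "minimal_range M g N h F nablaF \<longleftrightarrow>
     (\<forall>U k e m mu. open U \<and>
        orthonormal_frame M M g id (ker_push_perp M g N F) U k e \<and>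
        orthonormal_frame M N h F (range_push_perp M N h F) U m mu \<longrightarrow>
        (\<forall>p\<in>U. mean_curvature M N h F nablaF k e m mu p = 0))"

end

theory Submission
  imports Defs
begin

text \<open>Write \<open>\<nabla>F\<^sub>*(X, Y) = \<nabla>\<^sup>F\<^sub>X F\<^sub>*Y - F\<^sub>*(\<nabla>\<^sub>X Y)\<close>. At every point the tension field equals the mean curvature
  vector of \<open>F\<^sub>*((ker F\<^sub>*)\<^sup>\<bottom>)\<close>, so that one vanishes exactly when the other does. The computation rests on
  three facts.

  \<^item> \<open>\<nabla>F\<^sub>*\<close> is symmetric (\<open>pullback_torsion_free\<close>, \<open>sff_symmetric\<close>): in coordinates this is the symmetry of
    second derivatives together with that of the Christoffel symbols of the target. Consequently its
    trace over a subspace of the tangent space can be computed in any orthonormal basis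
    (\<open>sff_trace_unique\<close>), in particular in one adapted to \<open>ker F\<^sub>* \<oplus> (ker F\<^sub>*)\<^sup>\<bottom>\<close>.

  \<^item> The trace over \<open>ker F\<^sub>*\<close> vanishes (\<open>sff_vertical_trace\<close>). For a vertical field \<open>V\<close>,
    \<open>\<nabla>F\<^sub>*(V, V) = - F\<^sub>*(\<nabla>\<^sub>V V)\<close>. The kernel is stable under \<open>J\<^sub>1\<close>, because \<open>F\<^sub>*\<close> intertwines \<open>J\<^sub>1\<close> and \<open>J\<^sub>2\<close>; and
    since \<open>J\<^sub>1\<close> is parallel, \<open>\<nabla>F\<^sub>*(J\<^sub>1V, J\<^sub>1V) = - \<nabla>F\<^sub>*(V, V)\<close>. So the trace computed in the frame \<open>J\<^sub>1v\<^sub>b\<close> is the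
    negative of the trace computed in the frame \<open>v\<^sub>b\<close>, and the two agree.

  \<^item> For a horizontal field \<open>X\<close>, \<open>\<nabla>F\<^sub>*(X, X)\<close> is orthogonal to \<open>range F\<^sub>*\<close> (\<open>sff_horizontal_orthogonal\<close>). On
    horizontal fields \<open>g\<^sub>2(\<nabla>F\<^sub>*(X, Y), F\<^sub>*Z)\<close> is symmetric in \<open>X, Y\<close> and, as \<open>F\<^sub>*\<close> is isometric there and both
    connections are metric, skew in \<open>Y, Z\<close>. Hence the horizontal trace is its own component in
    \<open>(range F\<^sub>*)\<^sup>\<bottom>\<close>, which is the mean curvature vector.

  Harmonicity and minimality quantify over local frames, so each implication also needs the frames of the
  other side near a given point. They come from a local Gram-Schmidt process (\<open>gram_schmidt\<close>), applied to
  the projections of spanning sections. These projections have smooth formulas in which the rank of \<open>F\<close>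
  does not enter: for a frame \<open>E\<^sub>j\<close> of the tangent bundle, the horizontal part of \<open>u\<close> is
  \<open>\<Sum>\<^sub>j g\<^sub>2(F\<^sub>*u, F\<^sub>*E\<^sub>j) E\<^sub>j\<close>. Families obtained in this way for two complementary subbundles have, together, as
  many members at nearby points as at the given one, namely the full dimension; hence both keep spanning
  (\<open>complementary_sections_span\<close>), and local constancy of the rank is a by-product.

  Coordinates enter only through directional derivatives and coordinate sections; most lemmas are stated
  for sections along a smooth map, the tangent bundle being the case of the identity.\<close>

section \<open>Calculus of smooth functions\<close>

lemma Ck_on_SucD:
  assumes "Ck_on (Suc k) S f"
  shows "x \<in> S \<Longrightarrow> (f has_derivative frechet_derivative f (at x)) (at x)"
    and "Ck_on k S (\<lambda>x. frechet_derivative f (at x) v)"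
  using assms unfolding Ck_on.simps frechet_derivative_works by blast+

lemma Ck_on_cong:
  assumes "open S" "\<And>x. x \<in> S \<Longrightarrow> f x = g x" "Ck_on k S f"
  shows "Ck_on k S g"
  using assms(2,3)
proof (induction k arbitrary: f g)
  case 0
  then show ?case using continuous_on_cong[of S S f g] by simp
next
  case (Suc k)
  have D: "(g has_derivative frechet_derivative f (at x)) (at x)" if "x \<in> S" for x
    using Suc.prems that assms(1)
    by (auto simp: frechet_derivative_works intro: has_derivative_transform_within_open)
  have E: "frechet_derivative f (at x) = frechet_derivative g (at x)" if "x \<in> S" for x
    using D[OF that] by (rule frechet_derivative_at)
  have "Ck_on k S (\<lambda>x. frechet_derivative g (at x) v)" for v
    by (rule Suc.IH[OF _ Ck_on_SucD(2)[OF Suc.prems(2)], of v]) (simp add: E)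
  moreover have "\<forall>x\<in>S. g differentiable (at x)" using D differentiableI by blast
  ultimately show ?case unfolding Ck_on.simps by blast
qed

text \<open>\<open>Ck_on\<close> refers to the choice operator \<open>frechet_derivative\<close>; this rule allows any explicit derivative.\<close>

lemma Ck_on_SucI:
  assumes "open S" "\<And>x. x \<in> S \<Longrightarrow> (f has_derivative f' x) (at x)"
    "\<And>v. Ck_on k S (\<lambda>x. f' x v)"
  shows "Ck_on (Suc k) S f"
proof -
  have E: "f' x = frechet_derivative f (at x)" if "x \<in> S" for x
    using assms(2)[OF that] by (rule frechet_derivative_at)
  have "Ck_on k S (\<lambda>x. frechet_derivative f (at x) v)" for v
    using Ck_on_cong[OF assms(1) _ assms(3)[of v], of "\<lambda>x. frechet_derivative f (at x) v"] E by auto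
  moreover have "\<forall>x\<in>S. f differentiable (at x)" using assms(2) differentiableI by blast
  ultimately show ?thesis unfolding Ck_on.simps by blast
qed

lemma Ck_on_Suc_imp:
  assumes "Ck_on (Suc k) S f" shows "Ck_on k S f"
  using assms
proof (induction k arbitrary: f)
  case 0
  have "isCont f x" if "x \<in> S" for x
    using Ck_on_SucD(1)[OF 0 that] by (rule has_derivative_continuous)
  then show ?case by (simp add: continuous_at_imp_continuous_on)
next
  case (Suc k)
  have "Ck_on k S (\<lambda>x. frechet_derivative f (at x) v)" for v
    by (rule Suc.IH[OF Ck_on_SucD(2)[OF Suc.prems]])
  then show ?case using Suc.prems unfolding Ck_on.simps(2) by blast
qed

lemma Ck_on_subset: "Ck_on k S f \<Longrightarrow> T \<subseteq> S \<Longrightarrow> Ck_on k T f"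
  by (induction k arbitrary: f) (auto intro: continuous_on_subset)

lemma Ck_on_const: "Ck_on k S (\<lambda>x. c)"
  by (induction k arbitrary: c) auto

lemma Ck_on_add:
  assumes "open S" "Ck_on k S f" "Ck_on k S g" shows "Ck_on k S (\<lambda>x. f x + g x)"
  using assms(2,3)
proof (induction k arbitrary: f g)
  case 0
  then show ?case by (auto intro: continuous_intros)
next
  case (Suc k)
  note f = Ck_on_SucD[OF Suc.prems(1)] and g = Ck_on_SucD[OF Suc.prems(2)]
  show ?case
    by (rule Ck_on_SucI[OF assms(1) has_derivative_add[OF f(1) g(1)] Suc.IH[OF f(2) g(2)]])
qed

lemma Ck_on_linear:
  assumes "open S" "bounded_linear L" "Ck_on k S f" shows "Ck_on k S (\<lambda>x. L (f x))"
  using assms(3)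
proof (induction k arbitrary: f)
  case 0
  then show ?case using assms(2) by (auto intro: bounded_linear.continuous_on)
next
  case (Suc k)
  note f = Ck_on_SucD[OF Suc.prems]
  show ?case
    by (rule Ck_on_SucI[OF assms(1) bounded_linear.has_derivative[OF assms(2) f(1)] Suc.IH[OF f(2)]])
qed

lemma Ck_on_bilinear:
  assumes "open S" "bounded_bilinear b" "Ck_on k S f" "Ck_on k S g"
  shows "Ck_on k S (\<lambda>x. b (f x) (g x))"
  using assms(3,4)
proof (induction k arbitrary: f g)
  case 0
  then show ?case using assms(2) by (auto intro: bounded_bilinear.continuous_on)
next
  case (Suc k)
  note f = Ck_on_SucD[OF Suc.prems(1)] Ck_on_Suc_imp[OF Suc.prems(1)]
    and g = Ck_on_SucD[OF Suc.prems(2)] Ck_on_Suc_imp[OF Suc.prems(2)]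
  show ?case
    by (rule Ck_on_SucI[OF assms(1) bounded_bilinear.FDERIV[OF assms(2) f(1) g(1)]
          Ck_on_add[OF assms(1) Suc.IH[OF f(3) g(2)] Suc.IH[OF f(2) g(3)]]])
qed

lemma Ck_on_sum:
  assumes "open S" "\<And>i. i \<in> I \<Longrightarrow> Ck_on k S (f i)" shows "Ck_on k S (\<lambda>x. \<Sum>i\<in>I. f i x)"
  using assms(2)
  by (induction I rule: infinite_finite_induct) (auto intro: Ck_on_add assms(1) Ck_on_const)

lemma linear_Basis_expansion:
  assumes "linear L" shows "L v = (\<Sum>b\<in>Basis. (v \<bullet> b) *\<^sub>R L b)"
proof -
  have "L v = L (\<Sum>b\<in>Basis. (v \<bullet> b) *\<^sub>R b)" by (simp add: euclidean_representation)
  also have "\<dots> = (\<Sum>b\<in>Basis. (v \<bullet> b) *\<^sub>R L b)"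
    by (simp add: linear_sum[OF assms] linear_cmul[OF assms])
  finally show ?thesis .
qed

text \<open>The chain rule expresses a directional derivative of the composite through the directional
  derivatives of the outer function along the basis vectors, which are composites of lower order.\<close>

lemma Ck_on_compose:
  fixes f :: "'a::real_normed_vector \<Rightarrow> 'b::euclidean_space"
  assumes "open S" "open T" "f ` S \<subseteq> T" "Ck_on k S f" "Ck_on k T g"
  shows "Ck_on k S (\<lambda>x. g (f x))"
  using assms(4,5)
proof (induction k arbitrary: g)
  case 0
  then show ?case using assms(3) by (auto intro: continuous_on_compose2)
next
  case (Suc k)
  have D: "((\<lambda>x. g (f x)) has_derivative
      (\<lambda>v. \<Sum>b\<in>Basis. (frechet_derivative f (at x) v \<bullet> b) *\<^sub>R frechet_derivative g (at (f x)) b)) (at x)"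
    if "x \<in> S" for x
  proof -
    have g: "(g has_derivative frechet_derivative g (at (f x))) (at (f x))"
      using assms(3) that by (intro Ck_on_SucD(1)[OF Suc.prems(2)]) auto
    have chain: "((\<lambda>x. g (f x)) has_derivative
        (\<lambda>v. frechet_derivative g (at (f x)) (frechet_derivative f (at x) v))) (at x)"
      using diff_chain_at[OF Ck_on_SucD(1)[OF Suc.prems(1) that] g] by (simp add: o_def)
    have "frechet_derivative g (at (f x)) w =
        (\<Sum>b\<in>Basis. (w \<bullet> b) *\<^sub>R frechet_derivative g (at (f x)) b)" for w
      by (rule linear_Basis_expansion) (rule has_derivative_linear[OF g])
    then show ?thesis by (intro has_derivative_eq_rhs[OF chain] ext)
  qed
  show ?case
  proof (rule Ck_on_SucI[OF assms(1) D Ck_on_sum[OF assms(1)]], assumption)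
    fix v and b :: 'b
    have 1: "Ck_on k S (\<lambda>x. frechet_derivative f (at x) v \<bullet> b)"
      by (rule Ck_on_linear[OF assms(1) bounded_linear_inner_left]) (rule Ck_on_SucD[OF Suc.prems(1)])
    have 2: "Ck_on k S (\<lambda>x. frechet_derivative g (at (f x)) b)"
      by (rule Suc.IH[OF Ck_on_Suc_imp[OF Suc.prems(1)] Ck_on_SucD(2)[OF Suc.prems(2)]])
    show "Ck_on k S (\<lambda>x. (frechet_derivative f (at x) v \<bullet> b) *\<^sub>R frechet_derivative g (at (f x)) b)"
      by (rule Ck_on_bilinear[OF assms(1) bounded_bilinear_scaleR 1 2])
  qed
qed

text \<open>Proved for all exponents at once, as differentiation lowers the exponent by one.\<close>

lemma Ck_on_powr: "Ck_on k {0::real<..} (\<lambda>t. t powr r)"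
proof (induction k arbitrary: r)
  case 0
  show ?case by (auto intro!: continuous_intros)
next
  case (Suc k)
  have D: "((\<lambda>t. t powr r) has_derivative (\<lambda>v. (r * x powr (r - 1)) * v)) (at x)" if "x \<in> {0<..}" for x
    using has_real_derivative_powr[of x r] that
    by (simp add: has_field_derivative_def)
  show ?case
    by (rule Ck_on_SucI[OF _ D Ck_on_linear[OF _ bounded_linear_mult_left
            Ck_on_linear[OF _ bounded_linear_mult_right Suc]]]) auto
qed

lemma smooth_on_cong:
  "open S \<Longrightarrow> smooth_on S f \<Longrightarrow> (\<And>x. x \<in> S \<Longrightarrow> f x = g x) \<Longrightarrow> smooth_on S g"
  using Ck_on_cong unfolding smooth_on_def by blast

lemma smooth_on_subset: "smooth_on S f \<Longrightarrow> T \<subseteq> S \<Longrightarrow> smooth_on T f"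
  using Ck_on_subset unfolding smooth_on_def by blast

lemma smooth_on_const: "smooth_on S (\<lambda>x. c)"
  by (simp add: smooth_on_def Ck_on_const)

lemma smooth_on_add: "open S \<Longrightarrow> smooth_on S f \<Longrightarrow> smooth_on S g \<Longrightarrow> smooth_on S (\<lambda>x. f x + g x)"
  by (simp add: smooth_on_def Ck_on_add)

lemma smooth_on_linear: "open S \<Longrightarrow> bounded_linear L \<Longrightarrow> smooth_on S f \<Longrightarrow> smooth_on S (\<lambda>x. L (f x))"
  by (simp add: smooth_on_def Ck_on_linear)

lemma smooth_on_scaleR:
  "open S \<Longrightarrow> smooth_on S f \<Longrightarrow> smooth_on S g \<Longrightarrow> smooth_on S (\<lambda>x. f x *\<^sub>R g x)"
  by (simp add: smooth_on_def Ck_on_bilinear[OF _ bounded_bilinear_scaleR])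

lemma smooth_on_sum:
  "open S \<Longrightarrow> (\<And>i. i \<in> I \<Longrightarrow> smooth_on S (f i)) \<Longrightarrow> smooth_on S (\<lambda>x. \<Sum>i\<in>I. f i x)"
  by (simp add: smooth_on_def Ck_on_sum)

lemma smooth_on_compose:
  fixes f :: "'a::real_normed_vector \<Rightarrow> 'b::euclidean_space"
  shows "open S \<Longrightarrow> open T \<Longrightarrow> f ` S \<subseteq> T \<Longrightarrow> smooth_on S f \<Longrightarrow> smooth_on T g \<Longrightarrow> smooth_on S (\<lambda>x. g (f x))"
  unfolding smooth_on_def using Ck_on_compose by blast

lemma smooth_on_has_derivative:
  "smooth_on S f \<Longrightarrow> x \<in> S \<Longrightarrow> (f has_derivative frechet_derivative f (at x)) (at x)"
  using Ck_on_SucD(1)[of 0] unfolding smooth_on_def by blast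

lemma smooth_on_frechet_derivative:
  "smooth_on S f \<Longrightarrow> smooth_on S (\<lambda>x. frechet_derivative f (at x) v)"
  unfolding smooth_on_def using Ck_on_SucD(2) by blast

lemma smooth_on_imp_continuous_on: "smooth_on S f \<Longrightarrow> continuous_on S f"
  unfolding smooth_on_def by (metis Ck_on.simps(1))

text \<open>The direction may vary with the point: expanding it in the basis reduces the claim to constant
  directions.\<close>

lemma smooth_on_derivative_along:
  fixes f :: "'a::euclidean_space \<Rightarrow> 'b::real_normed_vector"
  assumes "open S" "smooth_on S f" "smooth_on S V"
  shows "smooth_on S (\<lambda>x. frechet_derivative f (at x) (V x))"
proof -
  have "smooth_on S (\<lambda>x. \<Sum>b\<in>Basis. (V x \<bullet> b) *\<^sub>R frechet_derivative f (at x) b)"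
    by (intro smooth_on_sum smooth_on_scaleR smooth_on_linear[OF _ bounded_linear_inner_left]
        smooth_on_frechet_derivative assms)
  then show ?thesis
    by (rule smooth_on_cong[OF assms(1)])
      (metis linear_Basis_expansion has_derivative_linear smooth_on_has_derivative[OF assms(2)])
qed

lemma smooth_on_inverse_sqrt:
  assumes "open S" "smooth_on S f" "\<And>x. x \<in> S \<Longrightarrow> f x > (0::real)"
  shows "smooth_on S (\<lambda>x. inverse (sqrt (f x)))"
proof -
  have "smooth_on S (\<lambda>x. f x powr (- 1 / 2))"
    by (rule smooth_on_compose[OF assms(1) open_greaterThan[of 0] _ assms(2)])
      (use assms(3) in \<open>auto simp: smooth_on_def intro: Ck_on_powr[where r = "- 1 / 2", simplified]\<close>)
  then show ?thesis
    by (rule smooth_on_cong[OF assms(1)])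
      (use assms(3) in \<open>auto simp: powr_minus powr_half_sqrt less_imp_le\<close>)
qed


subsection \<open>Symmetry of second derivatives\<close>

lemma mean_value_along_line:
  fixes f :: "'a::real_normed_vector \<Rightarrow> real"
  assumes "0 < s" "\<And>t. 0 \<le> t \<Longrightarrow> t \<le> s \<Longrightarrow> (f has_derivative f' (x + t *\<^sub>R u)) (at (x + t *\<^sub>R u))"
  shows "\<exists>t. 0 < t \<and> t < s \<and> f (x + s *\<^sub>R u) - f x = s * f' (x + t *\<^sub>R u) u"
proof -
  have "((\<lambda>t. f (x + t *\<^sub>R u)) has_derivative (\<lambda>h. f' (x + t *\<^sub>R u) (h *\<^sub>R u))) (at t within {0..s})"
    if "0 \<le> t" "t \<le> s" for t
  proof (rule has_derivative_compose[where g = f and g' = "f' (x + t *\<^sub>R u)"])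
    show "((\<lambda>t. x + t *\<^sub>R u) has_derivative (\<lambda>h. h *\<^sub>R u)) (at t within {0..s})"
      by (auto intro!: derivative_eq_intros)
    show "(f has_derivative f' (x + t *\<^sub>R u)) (at (x + t *\<^sub>R u))" by (rule assms(2)[OF that])
  qed
  then obtain t where t: "t \<in> {0<..<s}"
    "f (x + s *\<^sub>R u) - f (x + 0 *\<^sub>R u) = f' (x + t *\<^sub>R u) ((s - 0) *\<^sub>R u)"
    using mvt_simple[OF assms(1), of "\<lambda>t. f (x + t *\<^sub>R u)" "\<lambda>t h. f' (x + t *\<^sub>R u) (h *\<^sub>R u)"] by blast
  then have "f' (x + t *\<^sub>R u) (s *\<^sub>R u) = s * f' (x + t *\<^sub>R u) u"
    using assms(2)[of t] by (simp add: linear_cmul[OF has_derivative_linear])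
  with t show ?thesis by auto
qed

text \<open>The second difference of \<open>f\<close> over the parallelogram spanned by \<open>s u\<close> and \<open>s v\<close> equals \<open>s\<^sup>2\<close> times
  the derivative along \<open>u\<close>, then \<open>v\<close>, at an intermediate point; it is symmetric in \<open>u\<close> and \<open>v\<close>.\<close>

lemma second_difference_mean_value:
  fixes f :: "'a::real_normed_vector \<Rightarrow> real"
  assumes "0 < s"
    and D: "\<And>y. y \<in> S \<Longrightarrow> (f has_derivative frechet_derivative f (at y)) (at y)"
    and D2: "\<And>y. y \<in> S \<Longrightarrow> ((\<lambda>y. frechet_derivative f (at y) u) has_derivative f2 y) (at y)"
    and S: "\<And>a b. 0 \<le> a \<Longrightarrow> a \<le> s \<Longrightarrow> 0 \<le> b \<Longrightarrow> b \<le> s \<Longrightarrow> x + a *\<^sub>R u + b *\<^sub>R v \<in> S"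
  shows "\<exists>a b. 0 \<le> a \<and> a \<le> s \<and> 0 \<le> b \<and> b \<le> s \<and>
    f (x + s *\<^sub>R u + s *\<^sub>R v) - f (x + s *\<^sub>R u) - f (x + s *\<^sub>R v) + f x = s * s * f2 (x + a *\<^sub>R u + b *\<^sub>R v) v"
proof -
  define h where "h = (\<lambda>y. f (y + s *\<^sub>R v) - f y)"
  have "(h has_derivative (\<lambda>w. frechet_derivative f (at (y + s *\<^sub>R v)) w - frechet_derivative f (at y) w)) (at y)"
    if y: "y = x + t *\<^sub>R u" "0 \<le> t" "t \<le> s" for t y
    unfolding h_def
  proof (rule has_derivative_diff)
    have "(f has_derivative frechet_derivative f (at (y + s *\<^sub>R v))) (at (y + s *\<^sub>R v))"
      using S[of t s] y assms(1) by (intro D) auto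
    moreover have "((\<lambda>y. y + s *\<^sub>R v) has_derivative (\<lambda>h. h)) (at y)"
      by (auto intro!: derivative_eq_intros)
    ultimately show "((\<lambda>y. f (y + s *\<^sub>R v)) has_derivative frechet_derivative f (at (y + s *\<^sub>R v))) (at y)"
      using has_derivative_compose[where f = "\<lambda>y. y + s *\<^sub>R v" and g = f] by blast
    show "(f has_derivative frechet_derivative f (at y)) (at y)"
      using S[of t 0] y assms(1) by (intro D) auto
  qed
  from mean_value_along_line[OF assms(1) this[OF refl]]
  obtain a where a: "0 < a" "a < s"
    "h (x + s *\<^sub>R u) - h x = s * (frechet_derivative f (at (x + a *\<^sub>R u + s *\<^sub>R v)) u - frechet_derivative f (at (x + a *\<^sub>R u)) u)"
    by blast
  have "((\<lambda>y. frechet_derivative f (at y) u) has_derivative f2 (x + a *\<^sub>R u + t *\<^sub>R v)) (at (x + a *\<^sub>R u + t *\<^sub>R v))"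
    if "0 \<le> t" "t \<le> s" for t
    using S[of a t] a that by (intro D2) auto
  from mean_value_along_line[OF assms(1) this]
  obtain b where b: "0 < b" "b < s"
    "frechet_derivative f (at (x + a *\<^sub>R u + s *\<^sub>R v)) u - frechet_derivative f (at (x + a *\<^sub>R u)) u = s * f2 (x + a *\<^sub>R u + b *\<^sub>R v) v"
    by blast
  have "f (x + s *\<^sub>R u + s *\<^sub>R v) - f (x + s *\<^sub>R u) - f (x + s *\<^sub>R v) + f x = h (x + s *\<^sub>R u) - h x"
    by (simp add: h_def)
  also have "\<dots> = s * s * f2 (x + a *\<^sub>R u + b *\<^sub>R v) v" using a(3) b(3) by simp
  finally show ?thesis using a b less_imp_le by blast
qed

text \<open>Both iterated derivatives are limits of the same symmetric second difference quotient.\<close>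

lemma second_derivative_symmetric_real:
  fixes f :: "'a::real_normed_vector \<Rightarrow> real"
  assumes "open S" "smooth_on S f" "x \<in> S"
  shows "frechet_derivative (\<lambda>y. frechet_derivative f (at y) u) (at x) v =
    frechet_derivative (\<lambda>y. frechet_derivative f (at y) v) (at x) u"
proof -
  define D where "D = (\<lambda>u v y. frechet_derivative (\<lambda>y. frechet_derivative f (at y) u) (at y) v)"
  have cont: "isCont (D u v) x" for u v
    unfolding D_def using assms
    by (intro continuous_on_interior[of S] smooth_on_imp_continuous_on smooth_on_frechet_derivative)
      (auto simp: interior_open)
  have near_bound: "\<bar>D u v x - D v u x\<bar> \<le> 2 * e" if "e > 0" for e
  proof -
    have "\<forall>\<^sub>F y in nhds x. y \<in> S \<and> dist (D u v y) (D u v x) < e \<and> dist (D v u y) (D v u x) < e"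
      using cont[of u v] cont[of v u] assms \<open>e > 0\<close>
      by (intro eventually_conj eventually_nhds_in_open)
        (auto simp: isCont_def tendsto_at_iff_tendsto_nhds dest: tendstoD)
    then obtain r where r: "r > 0"
      "\<And>y. dist y x < r \<Longrightarrow> y \<in> S \<and> dist (D u v y) (D u v x) < e \<and> dist (D v u y) (D v u x) < e"
      unfolding eventually_nhds_metric by blast
    \<comment> \<open>a side length for which the whole parallelogram lies in the ball of radius \<open>r\<close>\<close>
    define s where "s = r / (2 * (norm u + norm v + 1))"
    have s: "s > 0" using r by (auto simp: s_def intro!: divide_pos_pos add_nonneg_pos)
    have near: "dist (x + a *\<^sub>R u + b *\<^sub>R v) x < r" if "0 \<le> a" "a \<le> s" "0 \<le> b" "b \<le> s" for a b
    proof -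
      have "dist (x + a *\<^sub>R u + b *\<^sub>R v) x = norm (a *\<^sub>R u + b *\<^sub>R v)" by (simp add: dist_norm add.assoc)
      also have "\<dots> \<le> a * norm u + b * norm v" using norm_triangle_ineq[of "a *\<^sub>R u" "b *\<^sub>R v"] that by simp
      also have "\<dots> \<le> s * norm u + s * norm v" using that by (intro add_mono mult_right_mono) auto
      also have "\<dots> < s * (2 * (norm u + norm v + 1))"
        using s add_nonneg_nonneg[OF norm_ge_zero[of u] norm_ge_zero[of v]] by (simp add: algebra_simps add_nonneg_pos)
      also have "\<dots> = r"
        using add_nonneg_pos[OF add_nonneg_nonneg[OF norm_ge_zero[of u] norm_ge_zero[of v]] zero_less_one]
        unfolding s_def by (intro nonzero_eq_divide_eq[THEN iffD1]) auto
      finally show ?thesis .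
    qed
    have near': "dist (x + a *\<^sub>R v + b *\<^sub>R u) x < r" if "0 \<le> a" "a \<le> s" "0 \<le> b" "b \<le> s" for a b
      using near[of b a] that by (simp add: add_ac)
    have fD: "(f has_derivative frechet_derivative f (at y)) (at y)" if "y \<in> S" for y
      using smooth_on_has_derivative assms(2) that .
    have fD2: "((\<lambda>y. frechet_derivative f (at y) w) has_derivative (\<lambda>z. D w z y)) (at y)" if "y \<in> S" for y w
      unfolding D_def using smooth_on_has_derivative smooth_on_frechet_derivative assms(2) that by blast
    have near_S: "dist y x < r \<Longrightarrow> y \<in> S" for y using r by blast
    obtain a b where ab: "0 \<le> a" "a \<le> s" "0 \<le> b" "b \<le> s"
      "f (x + s *\<^sub>R u + s *\<^sub>R v) - f (x + s *\<^sub>R u) - f (x + s *\<^sub>R v) + f x = s * s * D u v (x + a *\<^sub>R u + b *\<^sub>R v)"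
      using second_difference_mean_value[OF s fD fD2 near_S[OF near]] by blast
    obtain a' b' where ab': "0 \<le> a'" "a' \<le> s" "0 \<le> b'" "b' \<le> s"
      "f (x + s *\<^sub>R v + s *\<^sub>R u) - f (x + s *\<^sub>R v) - f (x + s *\<^sub>R u) + f x = s * s * D v u (x + a' *\<^sub>R v + b' *\<^sub>R u)"
      using second_difference_mean_value[OF s fD fD2 near_S[OF near']] by blast
    have "s * s * D u v (x + a *\<^sub>R u + b *\<^sub>R v) = s * s * D v u (x + a' *\<^sub>R v + b' *\<^sub>R u)"
      unfolding ab(5)[symmetric] ab'(5)[symmetric] by (simp add: add_ac)
    with s have "D u v (x + a *\<^sub>R u + b *\<^sub>R v) = D v u (x + a' *\<^sub>R v + b' *\<^sub>R u)" by simp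
    moreover have "dist (D u v (x + a *\<^sub>R u + b *\<^sub>R v)) (D u v x) < e" using r near ab by blast
    moreover have "dist (D v u (x + a' *\<^sub>R v + b' *\<^sub>R u)) (D v u x) < e" using r near' ab' by blast
    ultimately show ?thesis unfolding dist_real_def by linarith
  qed
  have "\<bar>D u v x - D v u x\<bar> \<le> 0 + e" if "e > 0" for e using near_bound[of "e / 2"] that by simp
  then have "\<bar>D u v x - D v u x\<bar> \<le> 0" by (rule field_le_epsilon)
  then show ?thesis by (simp add: D_def)
qed

lemma frechet_derivative_linear_compose:
  assumes "bounded_linear L" "f differentiable (at x)"
  shows "frechet_derivative (\<lambda>y. L (f y)) (at x) v = L (frechet_derivative f (at x) v)"
  using frechet_derivative_at[OF bounded_linear.has_derivative[OF assms(1)]] assms(2)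
  by (metis frechet_derivative_works)

lemma second_derivative_symmetric:
  fixes f :: "'a::real_normed_vector \<Rightarrow> 'b::euclidean_space"
  assumes "open S" "smooth_on S f" "x \<in> S"
  shows "frechet_derivative (\<lambda>y. frechet_derivative f (at y) u) (at x) v =
    frechet_derivative (\<lambda>y. frechet_derivative f (at y) v) (at x) u"
proof (rule euclidean_eqI)
  fix b :: 'b
  have E: "frechet_derivative (\<lambda>y. frechet_derivative (\<lambda>y. f y \<bullet> b) (at y) u) (at x) v =
      frechet_derivative (\<lambda>y. frechet_derivative f (at y) u) (at x) v \<bullet> b" for u v
  proof -
    have "frechet_derivative (\<lambda>y. frechet_derivative f (at y) u \<bullet> b) (at x) =
        frechet_derivative (\<lambda>y. frechet_derivative (\<lambda>y. f y \<bullet> b) (at y) u) (at x)"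
    proof (rule frechet_derivative_transform_within_open[OF _ assms(1,3)])
      show "(\<lambda>y. frechet_derivative f (at y) u \<bullet> b) differentiable at x"
        using smooth_on_has_derivative[OF smooth_on_linear[OF assms(1) bounded_linear_inner_left
          smooth_on_frechet_derivative[OF assms(2)]] assms(3)] unfolding differentiable_def by blast
      show "frechet_derivative f (at y) u \<bullet> b = frechet_derivative (\<lambda>y. f y \<bullet> b) (at y) u" if "y \<in> S" for y
        using frechet_derivative_linear_compose[OF bounded_linear_inner_left, of f y b u]
          smooth_on_has_derivative[OF assms(2) that] unfolding differentiable_def by fastforce
    qed
    then show ?thesis
      using frechet_derivative_linear_compose[OF bounded_linear_inner_left,
          of "\<lambda>y. frechet_derivative f (at y) u" x b v]
        smooth_on_has_derivative[OF smooth_on_frechet_derivative[OF assms(2)] assms(3), of u]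
      unfolding differentiable_def by fastforce
  qed
  show "frechet_derivative (\<lambda>y. frechet_derivative f (at y) u) (at x) v \<bullet> b =
    frechet_derivative (\<lambda>y. frechet_derivative f (at y) v) (at x) u \<bullet> b"
    unfolding E[symmetric]
    by (rule second_derivative_symmetric_real[OF assms(1) _ assms(3)])
      (rule smooth_on_linear[OF assms(1) bounded_linear_inner_left assms(2)])
qed

section \<open>Orthonormal families in a subspace with an inner product\<close>

lemma sum_in_span: "(\<Sum>i\<in>I. a i *\<^sub>R e i) \<in> span (e ` I)"
  by (intro span_sum span_scale span_base imageI)

lemma span_image_coefficients:
  assumes "u \<in> span (e ` I)" "finite I"
  obtains a where "u = (\<Sum>i\<in>I. a i *\<^sub>R e i)"
proof -
  have "\<exists>a. u = (\<Sum>i\<in>I. a i *\<^sub>R e i)"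
    using assms(2,1)
  proof (induction arbitrary: u rule: finite_induct)
    case (insert i I)
    then obtain c where "u - c *\<^sub>R e i \<in> span (e ` I)" by (auto simp: span_insert)
    with insert.IH obtain a where a: "u - c *\<^sub>R e i = (\<Sum>i\<in>I. a i *\<^sub>R e i)" by blast
    have "(\<Sum>j\<in>I. (a(i := c)) j *\<^sub>R e j) = (\<Sum>j\<in>I. a j *\<^sub>R e j)"
      using insert.hyps by (intro sum.cong) auto
    then have "u = (\<Sum>j\<in>insert i I. (a(i := c)) j *\<^sub>R e j)"
      using a insert.hyps by (simp add: algebra_simps)
    then show ?case by blast
  qed simp
  then show thesis using that by blast
qed

text \<open>A metric is an inner product on a tangent space, which is a subspace of a much larger space of
  functions; hence the carrier \<open>T\<close>.\<close>

locale inner_subspace =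
  fixes T :: "'v::real_vector set" and g :: "'v \<Rightarrow> 'v \<Rightarrow> real"
  assumes subspace_T: "subspace T"
    and g_linear: "\<And>u v w a b. u \<in> T \<Longrightarrow> v \<in> T \<Longrightarrow> w \<in> T \<Longrightarrow>
      g (a *\<^sub>R u + b *\<^sub>R v) w = a * g u w + b * g v w"
    and g_sym: "\<And>u v. u \<in> T \<Longrightarrow> v \<in> T \<Longrightarrow> g u v = g v u"
    and g_pos: "\<And>u. u \<in> T \<Longrightarrow> u \<noteq> 0 \<Longrightarrow> g u u > 0"
begin

lemma zero_T: "0 \<in> T" and add_T: "u \<in> T \<Longrightarrow> v \<in> T \<Longrightarrow> u + v \<in> T"
  and scale_T: "u \<in> T \<Longrightarrow> a *\<^sub>R u \<in> T" and diff_T: "u \<in> T \<Longrightarrow> v \<in> T \<Longrightarrow> u - v \<in> T"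
  using subspace_T by (auto simp: subspace_0 subspace_add subspace_scale subspace_diff)

lemma sum_T: "(\<And>i. i \<in> I \<Longrightarrow> f i \<in> T) \<Longrightarrow> sum f I \<in> T"
  using subspace_T by (rule subspace_sum)

lemma g_add: "u \<in> T \<Longrightarrow> v \<in> T \<Longrightarrow> w \<in> T \<Longrightarrow> g (u + v) w = g u w + g v w"
  using g_linear[of u v w 1 1] by simp

lemma g_scale: "u \<in> T \<Longrightarrow> w \<in> T \<Longrightarrow> g (a *\<^sub>R u) w = a * g u w"
  using g_linear[of u u w a 0] by simp

lemma g_zero: "w \<in> T \<Longrightarrow> g 0 w = 0"
  using g_scale[of w w 0] by simp

lemma g_diff: "u \<in> T \<Longrightarrow> v \<in> T \<Longrightarrow> w \<in> T \<Longrightarrow> g (u - v) w = g u w - g v w"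
  using g_linear[of u v w 1 "-1"] by simp

lemma g_sum: "(\<And>i. i \<in> I \<Longrightarrow> f i \<in> T) \<Longrightarrow> w \<in> T \<Longrightarrow> g (\<Sum>i\<in>I. f i) w = (\<Sum>i\<in>I. g (f i) w)"
  by (induction I rule: infinite_finite_induct) (auto simp: g_zero g_add sum_T)

lemma g_sum_scale:
  "(\<And>i. i \<in> I \<Longrightarrow> f i \<in> T) \<Longrightarrow> w \<in> T \<Longrightarrow> g (\<Sum>i\<in>I. a i *\<^sub>R f i) w = (\<Sum>i\<in>I. a i * g (f i) w)"
  by (subst g_sum) (auto simp: g_scale scale_T)

lemma g_sum_scale_right:
  "(\<And>i. i \<in> I \<Longrightarrow> f i \<in> T) \<Longrightarrow> w \<in> T \<Longrightarrow> g w (\<Sum>i\<in>I. a i *\<^sub>R f i) = (\<Sum>i\<in>I. a i * g w (f i))"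
  by (subst g_sym) (auto simp: g_sum_scale g_sym[of w] sum_T scale_T)

lemma g_eq_0_imp: "u \<in> T \<Longrightarrow> g u u = 0 \<Longrightarrow> u = 0"
  using g_pos by force

definition orthonormal :: "'i set \<Rightarrow> ('i \<Rightarrow> 'v) \<Rightarrow> bool" where
  "orthonormal I e \<longleftrightarrow> finite I \<and> (\<forall>i\<in>I. e i \<in> T) \<and>
     (\<forall>i\<in>I. \<forall>j\<in>I. g (e i) (e j) = (if i = j then 1 else 0))"

lemma orthonormal_coeff:
  assumes "orthonormal I e" "j \<in> I"
  shows "g (\<Sum>i\<in>I. a i *\<^sub>R e i) (e j) = a j"
proof -
  have "g (\<Sum>i\<in>I. a i *\<^sub>R e i) (e j) = (\<Sum>i\<in>I. a i * g (e i) (e j))"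
    using assms by (intro g_sum_scale) (auto simp: orthonormal_def)
  also have "\<dots> = (\<Sum>i\<in>I. if i = j then a j else 0)"
    using assms by (intro sum.cong) (auto simp: orthonormal_def)
  finally show ?thesis using assms by (simp add: orthonormal_def)
qed

lemma orthonormal_expansion:
  assumes "orthonormal I e" "u \<in> span (e ` I)"
  shows "u = (\<Sum>i\<in>I. g u (e i) *\<^sub>R e i)"
proof -
  have "finite I" using assms(1) by (simp add: orthonormal_def)
  with assms(2) obtain a where "u = (\<Sum>i\<in>I. a i *\<^sub>R e i)" by (rule span_image_coefficients)
  then show ?thesis using orthonormal_coeff[OF assms(1)] by simp
qed

lemma orthonormal_span_subset: "orthonormal I e \<Longrightarrow> span (e ` I) \<subseteq> T"
  using subspace_T by (intro span_minimal) (auto simp: orthonormal_def)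

lemma orthonormal_residual:
  assumes "orthonormal I e" "u \<in> T" "j \<in> I"
  shows "g (u - (\<Sum>i\<in>I. g u (e i) *\<^sub>R e i)) (e j) = 0"
proof -
  have "\<And>i. i \<in> I \<Longrightarrow> e i \<in> T" using assms by (auto simp: orthonormal_def)
  then have "g (u - (\<Sum>i\<in>I. g u (e i) *\<^sub>R e i)) (e j) = g u (e j) - g (\<Sum>i\<in>I. g u (e i) *\<^sub>R e i) (e j)"
    using assms by (intro g_diff sum_T scale_T) auto
  with orthonormal_coeff[OF assms(1,3)] show ?thesis by simp
qed

lemma orthonormal_inj: "orthonormal I e \<Longrightarrow> inj_on e I"
  by (rule inj_onI) (metis (no_types, lifting) orthonormal_def zero_neq_one)

lemma orthonormal_independent:
  assumes "orthonormal I e" shows "independent (e ` I)"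
proof (rule independent_if_scalars_zero)
  show "finite (e ` I)" using assms by (simp add: orthonormal_def)
  fix f x assume f: "(\<Sum>x\<in>e ` I. f x *\<^sub>R x) = 0" and x: "x \<in> e ` I"
  then obtain j where j: "j \<in> I" "x = e j" by blast
  have "(\<Sum>i\<in>I. f (e i) *\<^sub>R e i) = 0"
    using f by (simp add: sum.reindex[OF orthonormal_inj[OF assms]])
  then have "f (e j) = g 0 (e j)" using orthonormal_coeff[OF assms j(1), of "\<lambda>i. f (e i)"] by simp
  then show "f x = 0" using assms j by (simp add: g_zero orthonormal_def)
qed

text \<open>The ambient vector space may be infinite-dimensional (tangent vectors are functions on charts), so the
  dimension of \<open>T\<close> is given by a basis \<open>B\<close>.\<close>

lemma orthonormal_card_iff:
  assumes "orthonormal I e" "finite B" "independent B" "span B = T"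
  shows "span (e ` I) = T \<longleftrightarrow> card I = card B"
proof -
  have ind: "independent (e ` I)" and fin: "finite (e ` I)"
    using orthonormal_independent assms(1) by (auto simp: orthonormal_def)
  have card: "card (e ` I) = card I" using orthonormal_inj[OF assms(1)] by (rule card_image)
  have sub: "e ` I \<subseteq> span B" using assms(1,4) by (auto simp: orthonormal_def)
  have le: "card I \<le> card B"
    using independent_span_bound[OF assms(2) ind sub] card by simp
  show ?thesis
  proof
    assume "span (e ` I) = T"
    then have "B \<subseteq> span (e ` I)" using assms(4) span_superset by blast
    then show "card I = card B"
      using independent_span_bound[OF fin assms(3)] card le by simp
  next
    assume eq: "card I = card B"
    show "span (e ` I) = T"
    proof (rule ccontr)
      assume "span (e ` I) \<noteq> T"
      then obtain u where u: "u \<in> T" "u \<notin> span (e ` I)"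
        using orthonormal_span_subset[OF assms(1)] by blast
      then have "independent (insert u (e ` I))" using ind by (simp add: independent_insert)
      moreover have "insert u (e ` I) \<subseteq> span B" using sub u assms(4) by blast
      ultimately have "card (insert u (e ` I)) \<le> card B"
        using independent_span_bound[OF assms(2)] by blast
      moreover have "u \<notin> e ` I" using u(2) span_base[of u "e ` I"] by argo
      ultimately show False using fin card eq by simp
    qed
  qed
qed

lemma orthonormal_Plus:
  assumes "orthonormal I e" "orthonormal J f" "\<And>i j. i \<in> I \<Longrightarrow> j \<in> J \<Longrightarrow> g (e i) (f j) = 0"
  shows "orthonormal (I <+> J) (case_sum e f)"
  using assms(1,2) assms(3) g_sym unfolding orthonormal_def by (auto simp: Plus_def split: sum.splits)

lemma span_Plus_image: "span (case_sum e f ` (I <+> J)) = span (e ` I \<union> f ` J)"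
  by (simp add: Plus_def image_Un image_image)

definition orthogonal_decomposition :: "'v set \<Rightarrow> 'v set \<Rightarrow> bool" where
  "orthogonal_decomposition D D' \<longleftrightarrow> subspace D \<and> subspace D' \<and> D \<subseteq> T \<and> D' \<subseteq> T \<and>
     (\<forall>u\<in>D. \<forall>v\<in>D'. g u v = 0) \<and> (\<forall>u\<in>T. \<exists>x\<in>D. \<exists>y\<in>D'. u = x + y)"

lemma orthogonal_decomposition_swap:
  assumes "orthogonal_decomposition D D'" shows "orthogonal_decomposition D' D"
proof -
  have "g v u = 0" if "u \<in> D" "v \<in> D'" for u v
    using assms that g_sym unfolding orthogonal_decomposition_def by (metis subsetD)
  moreover have "\<exists>x\<in>D'. \<exists>y\<in>D. u = x + y" if "u \<in> T" for u
    using assms that unfolding orthogonal_decomposition_def by (metis add.commute)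
  ultimately show ?thesis using assms unfolding orthogonal_decomposition_def by simp
qed

lemma orthonormal_decomposition_Plus:
  assumes "orthogonal_decomposition D D'" "orthonormal I e" "orthonormal J f" "e ` I \<subseteq> D" "f ` J \<subseteq> D'"
  shows "orthonormal (I <+> J) (case_sum e f)"
proof (rule orthonormal_Plus[OF assms(2,3)])
  fix i j assume "i \<in> I" "j \<in> J"
  then have "e i \<in> D" "f j \<in> D'" using assms(4,5) by blast+
  then show "g (e i) (f j) = 0" using assms(1) unfolding orthogonal_decomposition_def by blast
qed

lemma orthonormal_decomposition_spans:
  assumes dec: "orthogonal_decomposition D D'" and e: "orthonormal I e" and f: "orthonormal J f"
    and D: "span (e ` I) = D" "span (f ` J) = D'"
  shows "span (case_sum e f ` (I <+> J)) = T"
proof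
  have "e ` I \<subseteq> D" "f ` J \<subseteq> D'" using span_superset[of "e ` I"] span_superset[of "f ` J"] unfolding D by simp_all
  from orthonormal_span_subset[OF orthonormal_decomposition_Plus[OF dec e f this]]
  show "span (case_sum e f ` (I <+> J)) \<subseteq> T" .
  show "T \<subseteq> span (case_sum e f ` (I <+> J))"
  proof
    fix u assume "u \<in> T"
    then obtain x y where xy: "x \<in> D" "y \<in> D'" "u = x + y"
      using dec unfolding orthogonal_decomposition_def by blast
    have "D \<subseteq> span (e ` I \<union> f ` J)" "D' \<subseteq> span (e ` I \<union> f ` J)"
      unfolding D[symmetric] by (simp_all add: span_mono)
    then show "u \<in> span (case_sum e f ` (I <+> J))"
      unfolding span_Plus_image xy(3) using xy(1,2) by (blast intro: span_add)
  qed
qed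

text \<open>The two families together form an orthonormal basis of \<open>T\<close>, and the expansion of a vector of \<open>D\<close> has no
  components along the second family.\<close>

lemma orthonormal_decomposition_card:
  assumes dec: "orthogonal_decomposition D D'" and e: "orthonormal I e" and f: "orthonormal J f"
    and D: "e ` I \<subseteq> D" "f ` J \<subseteq> D'"
    and B: "finite B" "independent B" "span B = T" "card I + card J = card B"
  shows "span (e ` I) = D"
proof
  show "span (e ` I) \<subseteq> D"
    using D dec by (intro span_minimal) (auto simp: orthogonal_decomposition_def)
  show "D \<subseteq> span (e ` I)"
  proof
    fix u assume u: "u \<in> D"
    have fin: "finite I" "finite J" using e f by (auto simp: orthonormal_def)
    have on: "orthonormal (I <+> J) (case_sum e f)"
      by (rule orthonormal_decomposition_Plus[OF dec e f D])
    moreover have "span (case_sum e f ` (I <+> J)) = T"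
      using orthonormal_card_iff[OF on B(1-3)] fin B(4) by (simp add: card_Plus)
    ultimately have "u = (\<Sum>i\<in>I <+> J. g u (case_sum e f i) *\<^sub>R case_sum e f i)"
      using u dec by (intro orthonormal_expansion) (auto simp: orthogonal_decomposition_def)
    also have "\<dots> = (\<Sum>i\<in>I. g u (e i) *\<^sub>R e i) + (\<Sum>j\<in>J. g u (f j) *\<^sub>R f j)"
      using fin by (simp add: sum.Plus o_def)
    also have "(\<Sum>j\<in>J. g u (f j) *\<^sub>R f j) = 0"
      using D(2) u dec by (intro sum.neutral) (auto simp: orthogonal_decomposition_def)
    finally have eq: "u = (\<Sum>i\<in>I. g u (e i) *\<^sub>R e i)" unfolding add_0_right .
    show "u \<in> span (e ` I)" by (subst eq) (rule sum_in_span)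
  qed
qed

text \<open>If a vector of \<open>D\<close> is a combination of the \<open>x i\<close>, its difference from the same combination of the \<open>y i\<close>
  lies in \<open>D\<close> and in \<open>D'\<close>.\<close>

lemma orthogonal_decomposition_components_span:
  assumes dec: "orthogonal_decomposition D D'"
    and D: "\<And>i. i \<in> I \<Longrightarrow> y i \<in> D" "\<And>i. i \<in> I \<Longrightarrow> z i \<in> D'" "\<And>i. i \<in> I \<Longrightarrow> x i = y i + z i"
    and x: "finite I" "T \<subseteq> span (x ` I)"
  shows "span (y ` I) = D"
proof
  have sub: "subspace D" "subspace D'" "D \<subseteq> T" "D' \<subseteq> T"
    using dec by (auto simp: orthogonal_decomposition_def)
  show "span (y ` I) \<subseteq> D" using D sub by (intro span_minimal) auto
  show "D \<subseteq> span (y ` I)"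
  proof
    fix u assume u: "u \<in> D"
    then have "u \<in> span (x ` I)" using x sub by blast
    then obtain a where "u = (\<Sum>i\<in>I. a i *\<^sub>R x i)" using x(1) by (rule span_image_coefficients)
    also have "\<dots> = (\<Sum>i\<in>I. a i *\<^sub>R y i) + (\<Sum>i\<in>I. a i *\<^sub>R z i)"
      using D(3) by (simp add: scaleR_add_right sum.distrib)
    finally have z: "u - (\<Sum>i\<in>I. a i *\<^sub>R y i) = (\<Sum>i\<in>I. a i *\<^sub>R z i)" by simp
    define r where "r = u - (\<Sum>i\<in>I. a i *\<^sub>R y i)"
    have "r \<in> D" unfolding r_def using u D sub by (intro subspace_diff subspace_sum subspace_scale)
    moreover have "r \<in> D'" unfolding r_def z using D sub by (intro subspace_sum subspace_scale)
    ultimately have "r = 0" using dec sub by (intro g_eq_0_imp) (auto simp: orthogonal_decomposition_def)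
    then have "u = (\<Sum>i\<in>I. a i *\<^sub>R y i)" by (simp add: r_def)
    then show "u \<in> span (y ` I)" by (simp add: sum_in_span)
  qed
qed

lemma orthogonal_decomposition_complement:
  assumes "orthonormal I f" "span (f ` I) = D"
  shows "orthogonal_decomposition D {u \<in> T. \<forall>v\<in>D. g u v = 0}"
  unfolding orthogonal_decomposition_def
proof (intro conjI ballI)
  show "subspace D" "D \<subseteq> T" using orthonormal_span_subset[OF assms(1)] assms(2) by auto
  then have DT: "v \<in> D \<Longrightarrow> v \<in> T" for v by blast
  show "subspace {u \<in> T. \<forall>v\<in>D. g u v = 0}"
    by (rule subspaceI) (auto simp: zero_T add_T scale_T g_zero g_add g_scale DT)
  show "{u \<in> T. \<forall>v\<in>D. g u v = 0} \<subseteq> T" by blast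
  show "g u v = 0" if "u \<in> D" "v \<in> {u \<in> T. \<forall>v\<in>D. g u v = 0}" for u v
    using that g_sym[of u v] DT by auto
  fix u assume u: "u \<in> T"
  define y where "y = u - (\<Sum>i\<in>I. g u (f i) *\<^sub>R f i)"
  have fT: "f i \<in> T" if "i \<in> I" for i using assms(1) that by (simp add: orthonormal_def)
  have yT: "y \<in> T" unfolding y_def using u fT by (intro diff_T sum_T scale_T) auto
  have "g y v = 0" if "v \<in> D" for v
  proof -
    have v: "v = (\<Sum>i\<in>I. g v (f i) *\<^sub>R f i)"
      using that assms(2) by (intro orthonormal_expansion[OF assms(1)]) simp
    have "g y (\<Sum>i\<in>I. g v (f i) *\<^sub>R f i) = (\<Sum>i\<in>I. g v (f i) * g y (f i))"
      by (rule g_sum_scale_right[OF fT yT])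
    also have "\<dots> = 0" unfolding y_def using orthonormal_residual[OF assms(1) u] by (intro sum.neutral) simp
    finally show ?thesis by (subst v)
  qed
  moreover have "(\<Sum>i\<in>I. g u (f i) *\<^sub>R f i) \<in> D" unfolding assms(2)[symmetric] by (rule sum_in_span)
  ultimately show "\<exists>x\<in>D. \<exists>y\<in>{u \<in> T. \<forall>v\<in>D. g u v = 0}. u = x + y"
    using yT by (intro bexI[of _ "\<Sum>i\<in>I. g u (f i) *\<^sub>R f i"] bexI[of _ y]) (auto simp: y_def)
qed

end

section \<open>Functions and vector fields on a manifold\<close>

text \<open>Smoothness in all charts for functions with values in any normed space. Components of sections and
  coordinate expressions of maps are of this kind, so one set of closure rules serves all of them.\<close>

definition smooth_fn ::
  "('m, 'e::euclidean_space) atlas \<Rightarrow> 'm set \<Rightarrow> ('m \<Rightarrow> 'b::real_normed_vector) \<Rightarrow> bool" where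
  "smooth_fn M U h \<longleftrightarrow> (\<forall>c\<in>M. smooth_on (snd c ` (U \<inter> fst c)) (\<lambda>x. h (chart_inv c x)))"

lemma smooth_fun_on_iff: "smooth_fun_on M U f \<longleftrightarrow> smooth_fn M U f"
  by (simp add: smooth_fun_on_def smooth_fn_def o_def)

lemma smooth_map_iff:
  "smooth_map M N F \<longleftrightarrow> continuous_on UNIV F \<and> (\<forall>d\<in>N. smooth_fn M (F -` fst d) (\<lambda>q. snd d (F q)))"
  unfolding smooth_map_def smooth_fn_def by (auto simp: o_def Int_commute)

lemma section_along_iff:
  "section_along M N F U V \<longleftrightarrow> (\<forall>p\<in>U. V p \<in> tangent_space N (F p)) \<and>
     (\<forall>d\<in>N. smooth_fn M (U \<inter> F -` fst d) (\<lambda>q. V q d))"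
  unfolding section_along_def smooth_fn_def by (auto simp: Int_ac)

locale manifold =
  fixes M :: "('m::{t2_space,second_countable_topology}, 'a::euclidean_space) atlas"
  assumes smooth_manifold: "smooth_manifold M"
begin

lemma chart_at_exists: "\<exists>c. c \<in> charts_at M p"
  using smooth_manifold UNIV_I[of p] unfolding smooth_manifold_def charts_at_def by blast

lemma chart_open: "c \<in> M \<Longrightarrow> open (fst c)"
  using smooth_manifold by (simp add: smooth_manifold_def)

lemma chart_homeomorphism: "c \<in> M \<Longrightarrow> homeomorphism (fst c) (snd c ` fst c) (snd c) (chart_inv c)"
  using smooth_manifold by (simp add: smooth_manifold_def)

lemma chart_inv_chart: "c \<in> M \<Longrightarrow> q \<in> fst c \<Longrightarrow> chart_inv c (snd c q) = q"
  using chart_homeomorphism homeomorphism_apply1 by blast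

lemma chart_chart_inv: "c \<in> M \<Longrightarrow> x \<in> snd c ` fst c \<Longrightarrow> snd c (chart_inv c x) = x"
  using chart_homeomorphism homeomorphism_apply2 by blast

lemma chart_image_open:
  assumes "c \<in> M" "open U" shows "open (snd c ` (U \<inter> fst c))"
proof -
  have "openin (top_of_set (snd c ` fst c)) (snd c ` (U \<inter> fst c))"
    using assms by (intro homeomorphism_imp_open_map[OF chart_homeomorphism]) (auto simp: openin_open)
  moreover have "open (snd c ` fst c)" using smooth_manifold assms by (simp add: smooth_manifold_def)
  ultimately show ?thesis using openin_open_eq by blast
qed

lemma transition_smooth:
  "c \<in> M \<Longrightarrow> c' \<in> M \<Longrightarrow> smooth_on (snd c ` (fst c \<inter> fst c')) (snd c' \<circ> chart_inv c)"
  using smooth_manifold by (simp add: smooth_manifold_def)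

lemma charts_atD: "c \<in> charts_at M p \<Longrightarrow> c \<in> M" "c \<in> charts_at M p \<Longrightarrow> p \<in> fst c"
  by (auto simp: charts_at_def)

lemma charts_atI: "c \<in> M \<Longrightarrow> p \<in> fst c \<Longrightarrow> c \<in> charts_at M p"
  by (simp add: charts_at_def)

lemma transition_has_derivative:
  assumes "c \<in> charts_at M p" "c' \<in> charts_at M p"
  shows "((snd c' \<circ> chart_inv c) has_derivative frechet_derivative (snd c' \<circ> chart_inv c) (at (snd c p))) (at (snd c p))"
  using assms by (intro smooth_on_has_derivative[OF transition_smooth]) (auto simp: charts_at_def)

text \<open>Near \<open>p\<close>, a function read in the chart \<open>c'\<close> is the function read in \<open>c\<close> after the transition map.\<close>

lemma change_chart:
  assumes c: "c \<in> charts_at M p" and c': "c' \<in> charts_at M p"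
    and D: "((\<lambda>x. h (chart_inv c x)) has_derivative D) (at (snd c p))"
  shows "((\<lambda>x. h (chart_inv c' x)) has_derivative
    (\<lambda>v. D (frechet_derivative (snd c \<circ> chart_inv c') (at (snd c' p)) v))) (at (snd c' p))"
proof -
  note M = charts_atD[OF c] charts_atD[OF c']
  have "((\<lambda>x. h (chart_inv c x)) has_derivative D) (at ((snd c \<circ> chart_inv c') (snd c' p)))"
    using D M by (simp add: chart_inv_chart)
  from diff_chain_at[OF transition_has_derivative[OF c' c] this]
  have "((\<lambda>x. h (chart_inv c (snd c (chart_inv c' x)))) has_derivative
      (\<lambda>v. D (frechet_derivative (snd c \<circ> chart_inv c') (at (snd c' p)) v))) (at (snd c' p))"
    by (simp add: o_def)
  then show ?thesis
  proof (rule has_derivative_transform_within_open)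
    show "open (snd c' ` (fst c \<inter> fst c'))" using M chart_open by (intro chart_image_open) auto
    show "snd c' p \<in> snd c' ` (fst c \<inter> fst c')" using M by blast
    show "h (chart_inv c (snd c (chart_inv c' x))) = h (chart_inv c' x)"
      if "x \<in> snd c' ` (fst c \<inter> fst c')" for x
      using that M by (auto simp: chart_inv_chart)
  qed
qed

subsection \<open>Tangent spaces\<close>

lemma transition_derivative_compose:
  assumes "c \<in> charts_at M p" "c' \<in> charts_at M p" "c'' \<in> charts_at M p"
  shows "frechet_derivative (snd c'' \<circ> chart_inv c') (at (snd c' p))
      (frechet_derivative (snd c' \<circ> chart_inv c) (at (snd c p)) x) =
    frechet_derivative (snd c'' \<circ> chart_inv c) (at (snd c p)) x"
proof -
  have "((\<lambda>x. snd c'' (chart_inv c' x)) has_derivative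
      frechet_derivative (snd c'' \<circ> chart_inv c') (at (snd c' p))) (at (snd c' p))"
    using transition_has_derivative[OF assms(2,3)] by (simp add: o_def)
  from change_chart[OF assms(2,1) this]
  have "((snd c'' \<circ> chart_inv c) has_derivative (\<lambda>v. frechet_derivative (snd c'' \<circ> chart_inv c') (at (snd c' p))
      (frechet_derivative (snd c' \<circ> chart_inv c) (at (snd c p)) v))) (at (snd c p))"
    by (simp add: o_def)
  then show ?thesis using frechet_derivative_at by metis
qed

lemma transition_derivative_self:
  assumes "c \<in> charts_at M p"
  shows "frechet_derivative (snd c \<circ> chart_inv c) (at (snd c p)) x = x"
proof -
  note M = charts_atD[OF assms]
  have "((snd c \<circ> chart_inv c) has_derivative (\<lambda>x. x)) (at (snd c p))"
  proof (rule has_derivative_transform_within_open[OF has_derivative_ident])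
    show "open (snd c ` (UNIV \<inter> fst c))" using M by (intro chart_image_open) auto
    show "snd c p \<in> snd c ` (UNIV \<inter> fst c)" using M by blast
  qed (use M in \<open>auto simp: chart_chart_inv\<close>)
  then show ?thesis using frechet_derivative_at by metis
qed

lemma tangent_spaceD:
  assumes "v \<in> tangent_space M p"
  shows "c \<in> charts_at M p \<Longrightarrow> c' \<in> charts_at M p \<Longrightarrow>
      v c' = frechet_derivative (snd c' \<circ> chart_inv c) (at (snd c p)) (v c)"
    and "c \<notin> charts_at M p \<Longrightarrow> v c = 0"
  using assms unfolding tangent_space_def by blast+

lemma subspace_tangent_space: "subspace (tangent_space M p)"
proof (rule subspaceI)
  have lin: "linear (frechet_derivative (snd c' \<circ> chart_inv c) (at (snd c p)))"
    if "c \<in> charts_at M p" "c' \<in> charts_at M p" for c c'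
    using transition_has_derivative[OF that] by (rule has_derivative_linear)
  show "0 \<in> tangent_space M p"
    unfolding tangent_space_def by (auto simp: linear_0[OF lin])
  show "u + v \<in> tangent_space M p" if "u \<in> tangent_space M p" "v \<in> tangent_space M p" for u v
    unfolding tangent_space_def mem_Collect_eq plus_fun_apply
    using tangent_spaceD[OF that(1)] tangent_spaceD[OF that(2)] by (metis linear_add[OF lin] add_0_right)
  show "a *\<^sub>R u \<in> tangent_space M p" if "u \<in> tangent_space M p" for a u
    unfolding tangent_space_def mem_Collect_eq scaleR_fun_def
    using tangent_spaceD[OF that] by (metis linear_cmul[OF lin] scaleR_zero_right)
qed

lemma tangent_vector_eqI:
  assumes "u \<in> tangent_space M p" "v \<in> tangent_space M p" "c \<in> charts_at M p" "u c = v c"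
  shows "u = v"
proof
  fix c'
  show "u c' = v c'"
    using tangent_spaceD[OF assms(1)] tangent_spaceD[OF assms(2)] assms(3,4) by metis
qed

text \<open>The vector field with constant coordinates \<open>x\<close> in the chart \<open>c\<close>.\<close>

definition coord_field :: "('m, 'a) chart \<Rightarrow> 'a \<Rightarrow> 'm \<Rightarrow> ('m, 'a) tvec" where
  "coord_field c x q = (\<lambda>c'. if c' \<in> charts_at M q
     then frechet_derivative (snd c' \<circ> chart_inv c) (at (snd c q)) x else 0)"

lemma coord_field_tangent: "c \<in> charts_at M q \<Longrightarrow> coord_field c x q \<in> tangent_space M q"
  unfolding tangent_space_def coord_field_def by (auto simp: transition_derivative_compose)

lemma coord_field_self: "c \<in> charts_at M q \<Longrightarrow> coord_field c x q c = x"
  by (simp add: coord_field_def transition_derivative_self)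

lemma sum_fun_apply: "(\<Sum>i\<in>I. f i) c = (\<Sum>i\<in>I. f i c)"
  by (induction I rule: infinite_finite_induct) auto

lemma tangent_vector_expansion:
  assumes "c \<in> charts_at M q" "v \<in> tangent_space M q"
  shows "v = (\<Sum>b\<in>Basis. (v c \<bullet> b) *\<^sub>R coord_field c b q)"
proof (rule tangent_vector_eqI[OF assms(2) _ assms(1)])
  show "(\<Sum>b\<in>Basis. (v c \<bullet> b) *\<^sub>R coord_field c b q) \<in> tangent_space M q"
    using coord_field_tangent[OF assms(1)] subspace_tangent_space
    by (intro subspace_sum subspace_scale) auto
  show "v c = (\<Sum>b\<in>Basis. (v c \<bullet> b) *\<^sub>R coord_field c b q) c"
    using assms(1) by (simp add: sum_fun_apply scaleR_fun_def coord_field_self euclidean_representation)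
qed

lemma coord_basis:
  assumes "c \<in> charts_at M q"
  shows "independent ((\<lambda>b. coord_field c b q) ` Basis)" "span ((\<lambda>b. coord_field c b q) ` Basis) = tangent_space M q"
    "card ((\<lambda>b. coord_field c b q) ` Basis) = DIM('a)"
proof -
  have inj: "inj_on (\<lambda>b. coord_field c b q) Basis"
    by (rule inj_onI) (metis coord_field_self[OF assms])
  then show "card ((\<lambda>b. coord_field c b q) ` Basis) = DIM('a)" by (rule card_image)
  show "independent ((\<lambda>b. coord_field c b q) ` Basis)"
  proof (rule independent_if_scalars_zero)
    fix f v assume f: "(\<Sum>v\<in>(\<lambda>b. coord_field c b q) ` Basis. f v *\<^sub>R v) = 0"
      and v: "v \<in> (\<lambda>b. coord_field c b q) ` Basis"
    then obtain b where b: "b \<in> Basis" "v = coord_field c b q" by blast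
    have "(\<Sum>b\<in>Basis. f (coord_field c b q) *\<^sub>R coord_field c b q) = 0"
      using f by (simp add: sum.reindex[OF inj])
    then have "(\<Sum>b\<in>Basis. f (coord_field c b q) *\<^sub>R coord_field c b q) c = 0" by simp
    then have "(\<Sum>b\<in>Basis. f (coord_field c b q) *\<^sub>R b) = 0"
      using assms by (simp add: sum_fun_apply scaleR_fun_def coord_field_self)
    then have "(\<Sum>b\<in>Basis. f (coord_field c b q) *\<^sub>R b) \<bullet> b = 0" by simp
    then show "f v = 0" using b by (simp add: inner_sum_left_Basis)
  qed simp
  show "span ((\<lambda>b. coord_field c b q) ` Basis) = tangent_space M q"
  proof
    show "span ((\<lambda>b. coord_field c b q) ` Basis) \<subseteq> tangent_space M q"
      using coord_field_tangent[OF assms] subspace_tangent_space by (intro span_minimal) auto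
    show "tangent_space M q \<subseteq> span ((\<lambda>b. coord_field c b q) ` Basis)"
    proof
      fix v assume "v \<in> tangent_space M q"
      from tangent_vector_expansion[OF assms this]
      show "v \<in> span ((\<lambda>b. coord_field c b q) ` Basis)"
        by (rule ssubst) (rule sum_in_span)
    qed
  qed
qed

subsection \<open>Differentiable functions and directional derivatives\<close>

text \<open>Differentiability at one point; by \<open>change_chart\<close> a single chart decides.\<close>

definition mdiff :: "'m \<Rightarrow> ('m \<Rightarrow> 'b::real_normed_vector) \<Rightarrow> bool" where
  "mdiff p h \<longleftrightarrow> (\<forall>c\<in>charts_at M p. (\<lambda>x. h (chart_inv c x)) differentiable (at (snd c p)))"

lemma mdiffD:
  "mdiff p h \<Longrightarrow> c \<in> charts_at M p \<Longrightarrow> ((\<lambda>x. h (chart_inv c x)) has_derivative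
     frechet_derivative (\<lambda>x. h (chart_inv c x)) (at (snd c p))) (at (snd c p))"
  unfolding mdiff_def frechet_derivative_works by blast

lemma mdiffI:
  assumes "c \<in> charts_at M p" "((\<lambda>x. h (chart_inv c x)) has_derivative D) (at (snd c p))"
  shows "mdiff p h"
  unfolding mdiff_def using change_chart[OF assms(1) _ assms(2)] differentiableI by blast

text \<open>The transformation law of tangent vectors compensates the change of chart in \<open>change_chart\<close>.\<close>

lemma vderiv_eq:
  assumes c: "c \<in> charts_at M p" and v: "v \<in> tangent_space M p"
    and D: "((\<lambda>x. h (chart_inv c x)) has_derivative D) (at (snd c p))"
  shows "vderiv M p v h = D (v c)"
proof -
  define c' where "c' = (SOME c. c \<in> charts_at M p)"
  have c': "c' \<in> charts_at M p" unfolding c'_def by (rule someI_ex[OF chart_at_exists])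
  have "vderiv M p v h = frechet_derivative (\<lambda>x. h (chart_inv c' x)) (at (snd c' p)) (v c')"
    by (simp add: vderiv_def Let_def o_def c'_def)
  also have "\<dots> = D (frechet_derivative (snd c \<circ> chart_inv c') (at (snd c' p)) (v c'))"
    using fun_cong[OF frechet_derivative_at[OF change_chart[OF c c' D]]] by simp
  also have "frechet_derivative (snd c \<circ> chart_inv c') (at (snd c' p)) (v c') = v c"
    using tangent_spaceD(1)[OF v c' c] by simp
  finally show ?thesis .
qed

lemma vderiv_chart:
  assumes "mdiff p h" "c \<in> charts_at M p" "v \<in> tangent_space M p"
  shows "vderiv M p v h = frechet_derivative (\<lambda>x. h (chart_inv c x)) (at (snd c p)) (v c)"
  using vderiv_eq[OF assms(2,3) mdiffD[OF assms(1,2)]] .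

lemma vderiv_linear:
  assumes "mdiff p h" "v \<in> tangent_space M p" "w \<in> tangent_space M p"
  shows "vderiv M p (a *\<^sub>R v + b *\<^sub>R w) h = a *\<^sub>R vderiv M p v h + b *\<^sub>R vderiv M p w h"
proof -
  obtain c where c: "c \<in> charts_at M p" using chart_at_exists by blast
  have lin: "linear (frechet_derivative (\<lambda>x. h (chart_inv c x)) (at (snd c p)))"
    using mdiffD[OF assms(1) c] by (rule has_derivative_linear)
  have "a *\<^sub>R v + b *\<^sub>R w \<in> tangent_space M p"
    using assms subspace_tangent_space by (intro subspace_add subspace_scale)
  then show ?thesis
    using assms by (simp add: vderiv_chart[OF _ c] linear_add[OF lin] linear_cmul[OF lin] scaleR_fun_def)
qed

lemma mdiff_const: "mdiff p (\<lambda>q. k)"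
  by (simp add: mdiff_def)

lemma mdiff_add: "mdiff p h \<Longrightarrow> mdiff p h' \<Longrightarrow> mdiff p (\<lambda>q. h q + h' q)"
  by (simp add: mdiff_def differentiable_add)

lemma mdiff_sum: "(\<And>i. i \<in> I \<Longrightarrow> mdiff p (h i)) \<Longrightarrow> mdiff p (\<lambda>q. \<Sum>i\<in>I. h i q)"
  by (induction I rule: infinite_finite_induct) (auto simp: mdiff_const mdiff_add)

lemma vderiv_add:
  assumes "mdiff p h" "mdiff p h'" "v \<in> tangent_space M p"
  shows "vderiv M p v (\<lambda>q. h q + h' q) = vderiv M p v h + vderiv M p v h'"
proof -
  obtain c where c: "c \<in> charts_at M p" using chart_at_exists by blast
  show ?thesis
    using vderiv_eq[OF c assms(3) has_derivative_add[OF mdiffD[OF assms(1) c] mdiffD[OF assms(2) c]]]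
      assms by (simp add: vderiv_chart[OF _ c])
qed

lemma vderiv_const: "v \<in> tangent_space M p \<Longrightarrow> vderiv M p v (\<lambda>q. k) = 0"
  using chart_at_exists[of p] vderiv_eq[of _ p v "\<lambda>q. k"] has_derivative_const by blast

lemma vderiv_sum:
  "(\<And>i. i \<in> I \<Longrightarrow> mdiff p (h i)) \<Longrightarrow> v \<in> tangent_space M p \<Longrightarrow>
    vderiv M p v (\<lambda>q. \<Sum>i\<in>I. h i q) = (\<Sum>i\<in>I. vderiv M p v (h i))"
  by (induction I rule: infinite_finite_induct) (auto simp: vderiv_const vderiv_add mdiff_sum)

lemma vderiv_mult:
  fixes h h' :: "'m \<Rightarrow> real"
  assumes "mdiff p h" "mdiff p h'" "v \<in> tangent_space M p"
  shows "vderiv M p v (\<lambda>q. h q * h' q) = vderiv M p v h * h' p + h p * vderiv M p v h'"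
proof -
  obtain c where c: "c \<in> charts_at M p" using chart_at_exists by blast
  show ?thesis
    using vderiv_eq[OF c assms(3) has_derivative_mult[OF mdiffD[OF assms(1) c] mdiffD[OF assms(2) c]]]
      assms charts_atD[OF c] by (simp add: vderiv_chart[OF _ c] chart_inv_chart)
qed

lemma vderiv_chain:
  assumes "mdiff p h" "(k has_derivative k') (at (h p))" "v \<in> tangent_space M p"
  shows "mdiff p (\<lambda>q. k (h q))" "vderiv M p v (\<lambda>q. k (h q)) = k' (vderiv M p v h)"
proof -
  obtain c where c: "c \<in> charts_at M p" using chart_at_exists by blast
  have "(k has_derivative k') (at (h (chart_inv c (snd c p))))"
    using assms(2) charts_atD[OF c] by (simp add: chart_inv_chart)
  note D = has_derivative_compose[OF mdiffD[OF assms(1) c] this]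
  show "mdiff p (\<lambda>q. k (h q))" by (rule mdiffI[OF c D])
  show "vderiv M p v (\<lambda>q. k (h q)) = k' (vderiv M p v h)"
    using vderiv_eq[OF c assms(3) D] vderiv_chart[OF assms(1) c assms(3)] by simp
qed

lemma vderiv_inner:
  fixes h :: "'m \<Rightarrow> 'b::euclidean_space"
  assumes "mdiff p h" "v \<in> tangent_space M p"
  shows "mdiff p (\<lambda>q. h q \<bullet> b)" "vderiv M p v (\<lambda>q. h q \<bullet> b) = vderiv M p v h \<bullet> b"
  using vderiv_chain[OF assms(1) _ assms(2), of "\<lambda>x. x \<bullet> b" "\<lambda>x. x \<bullet> b"]
    bounded_linear_imp_has_derivative[OF bounded_linear_inner_left] by auto

lemma vderiv_local:
  assumes "open U" "p \<in> U" "\<And>q. q \<in> U \<Longrightarrow> h q = h' q" "mdiff p h"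
  shows "mdiff p h'" "v \<in> tangent_space M p \<Longrightarrow> vderiv M p v h = vderiv M p v h'"
proof -
  obtain c where c: "c \<in> charts_at M p" using chart_at_exists by blast
  note M = charts_atD[OF c]
  have D: "((\<lambda>x. h' (chart_inv c x)) has_derivative
     frechet_derivative (\<lambda>x. h (chart_inv c x)) (at (snd c p))) (at (snd c p))"
  proof (rule has_derivative_transform_within_open[OF mdiffD[OF assms(4) c]])
    show "open (snd c ` (U \<inter> fst c))" using M assms(1) by (intro chart_image_open)
    show "snd c p \<in> snd c ` (U \<inter> fst c)" using M assms(2) by blast
  qed (use M assms(3) in \<open>auto simp: chart_inv_chart\<close>)
  show "mdiff p h'" by (rule mdiffI[OF c D])
  show "vderiv M p v h = vderiv M p v h'" if "v \<in> tangent_space M p"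
    using vderiv_chart[OF assms(4) c that] vderiv_eq[OF c that D] by simp
qed

subsection \<open>Smooth functions\<close>

lemma smooth_fn_mdiff:
  assumes "smooth_fn M U h" "p \<in> U" shows "mdiff p h"
proof -
  obtain c where c: "c \<in> charts_at M p" using chart_at_exists by blast
  have "smooth_on (snd c ` (U \<inter> fst c)) (\<lambda>x. h (chart_inv c x))"
    using assms(1) charts_atD[OF c] unfolding smooth_fn_def by blast
  from smooth_on_has_derivative[OF this] show ?thesis
    using charts_atD[OF c] assms(2) by (intro mdiffI[OF c]) auto
qed

lemma smooth_fn_subset: "smooth_fn M U h \<Longrightarrow> U' \<subseteq> U \<Longrightarrow> smooth_fn M U' h"
  unfolding smooth_fn_def by (meson Int_mono image_mono order_refl smooth_on_subset)

lemma smooth_fn_cong: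
  assumes "open U" "smooth_fn M U h" "\<And>q. q \<in> U \<Longrightarrow> h q = h' q" shows "smooth_fn M U h'"
  unfolding smooth_fn_def
proof
  fix c assume c: "c \<in> M"
  have "smooth_on (snd c ` (U \<inter> fst c)) (\<lambda>x. h (chart_inv c x))"
    using assms(2) c unfolding smooth_fn_def by blast
  then show "smooth_on (snd c ` (U \<inter> fst c)) (\<lambda>x. h' (chart_inv c x))"
    by (rule smooth_on_cong[OF chart_image_open[OF c assms(1)]])
      (use assms(3) c in \<open>auto simp: chart_inv_chart\<close>)
qed

lemma smooth_fn_const: "smooth_fn M U (\<lambda>q. k)"
  by (simp add: smooth_fn_def smooth_on_const)

lemma smooth_fn_add: "open U \<Longrightarrow> smooth_fn M U h \<Longrightarrow> smooth_fn M U h' \<Longrightarrow> smooth_fn M U (\<lambda>q. h q + h' q)"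
  unfolding smooth_fn_def using smooth_on_add chart_image_open by blast

lemma smooth_fn_scaleR:
  "open U \<Longrightarrow> smooth_fn M U h \<Longrightarrow> smooth_fn M U h' \<Longrightarrow> smooth_fn M U (\<lambda>q. h q *\<^sub>R h' q)"
  unfolding smooth_fn_def using smooth_on_scaleR chart_image_open by blast

lemma smooth_fn_mult:
  fixes h h' :: "'m \<Rightarrow> real"
  shows "open U \<Longrightarrow> smooth_fn M U h \<Longrightarrow> smooth_fn M U h' \<Longrightarrow> smooth_fn M U (\<lambda>q. h q * h' q)"
  using smooth_fn_scaleR[of U h h'] by simp

lemma smooth_fn_linear: "open U \<Longrightarrow> bounded_linear L \<Longrightarrow> smooth_fn M U h \<Longrightarrow> smooth_fn M U (\<lambda>q. L (h q))"
  unfolding smooth_fn_def using smooth_on_linear chart_image_open by blast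

lemma smooth_fn_sum:
  "open U \<Longrightarrow> (\<And>i. i \<in> I \<Longrightarrow> smooth_fn M U (h i)) \<Longrightarrow> smooth_fn M U (\<lambda>q. \<Sum>i\<in>I. h i q)"
  by (induction I rule: infinite_finite_induct) (auto simp: smooth_fn_const smooth_fn_add)

lemma smooth_fn_inverse_sqrt:
  assumes "open U" "smooth_fn M U h" "\<And>q. q \<in> U \<Longrightarrow> h q > (0::real)"
  shows "smooth_fn M U (\<lambda>q. inverse (sqrt (h q)))"
  unfolding smooth_fn_def
proof
  fix c assume c: "c \<in> M"
  show "smooth_on (snd c ` (U \<inter> fst c)) (\<lambda>x. inverse (sqrt (h (chart_inv c x))))"
    by (rule smooth_on_inverse_sqrt[OF chart_image_open[OF c assms(1)]])
      (use assms(2,3) c in \<open>auto simp: smooth_fn_def chart_inv_chart\<close>)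
qed

lemma smooth_fn_compose:
  fixes h :: "'m \<Rightarrow> 'b::euclidean_space"
  assumes "open U" "smooth_fn M U h" "open W" "h ` U \<subseteq> W" "smooth_on W k"
  shows "smooth_fn M U (\<lambda>q. k (h q))"
  unfolding smooth_fn_def
proof
  fix c assume c: "c \<in> M"
  show "smooth_on (snd c ` (U \<inter> fst c)) (\<lambda>x. k (h (chart_inv c x)))"
    by (rule smooth_on_compose[OF chart_image_open[OF c assms(1)] assms(3) _ _ assms(5)])
      (use assms(2,4) c in \<open>auto simp: smooth_fn_def chart_inv_chart\<close>)
qed

lemma smooth_fn_continuous:
  assumes "open U" "smooth_fn M U h" shows "continuous_on U h"
proof (rule continuous_at_imp_continuous_on, rule ballI)
  fix p assume p: "p \<in> U"
  obtain c where c: "c \<in> charts_at M p" using chart_at_exists by blast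
  note M = charts_atD[OF c]
  have "continuous_on (fst c) (snd c)" using chart_homeomorphism[OF M(1)] by (simp add: homeomorphism_def)
  then have "continuous_on (U \<inter> fst c) (snd c)" by (rule continuous_on_subset) blast
  moreover have "continuous_on (snd c ` (U \<inter> fst c)) (\<lambda>x. h (chart_inv c x))"
    using assms(2) M(1) unfolding smooth_fn_def by (blast intro: smooth_on_imp_continuous_on)
  ultimately have "continuous_on (U \<inter> fst c) (\<lambda>q. h (chart_inv c (snd c q)))"
    using continuous_on_compose2[of "snd c ` (U \<inter> fst c)" "\<lambda>x. h (chart_inv c x)" "U \<inter> fst c" "snd c"] by blast
  then have "continuous_on (U \<inter> fst c) h"
    by (rule continuous_on_eq) (use M in \<open>auto simp: chart_inv_chart\<close>)
  then show "isCont h p"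
    using continuous_on_eq_continuous_at[of "U \<inter> fst c" h] p M assms(1) chart_open[OF M(1)] by (simp add: open_Int)
qed

text \<open>Read in another chart, the coordinate map is a transition map.\<close>

lemma smooth_fn_chart: "c \<in> M \<Longrightarrow> smooth_fn M (fst c) (snd c)"
  unfolding smooth_fn_def
proof
  fix c' assume c: "c \<in> M" and c': "c' \<in> M"
  from transition_smooth[OF c' c] show "smooth_on (snd c' ` (fst c \<inter> fst c')) (\<lambda>x. snd c (chart_inv c' x))"
    by (simp add: o_def Int_commute)
qed

text \<open>In a chart this is the derivative of a smooth function along a smooth direction.\<close>

lemma smooth_fn_vderiv:
  assumes "open U" "smooth_fn M U h" "vector_field M U X"
  shows "smooth_fn M U (\<lambda>q. vderiv M q (X q) h)"
  unfolding smooth_fn_def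
proof
  fix c assume c: "c \<in> M"
  let ?S = "snd c ` (U \<inter> fst c)"
  have h: "smooth_on ?S (\<lambda>x. h (chart_inv c x))" using assms(2) c unfolding smooth_fn_def by blast
  have "smooth_fn M (U \<inter> fst c) (\<lambda>q. X q c)" and X: "\<And>q. q \<in> U \<Longrightarrow> X q \<in> tangent_space M q"
    using assms(3) c unfolding vector_field_def section_along_iff by auto
  then have "smooth_on ?S (\<lambda>x. X (chart_inv c x) c)" using c unfolding smooth_fn_def by fastforce
  from smooth_on_derivative_along[OF chart_image_open[OF c assms(1)] h this]
  show "smooth_on ?S (\<lambda>x. vderiv M (chart_inv c x) (X (chart_inv c x)) h)"
  proof (rule smooth_on_cong[OF chart_image_open[OF c assms(1)]])
    fix x assume "x \<in> ?S"
    then obtain q where q: "q \<in> U" "q \<in> fst c" "x = snd c q" by blast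
    then show "frechet_derivative (\<lambda>x. h (chart_inv c x)) (at x) (X (chart_inv c x) c) =
        vderiv M (chart_inv c x) (X (chart_inv c x)) h"
      using vderiv_chart[OF smooth_fn_mdiff[OF assms(2) q(1)] charts_atI[OF c q(2)] X[OF q(1)]] c
      by (simp add: chart_inv_chart)
  qed
qed

text \<open>In a chart this is the symmetry of second derivatives.\<close>

lemma vderiv_commutator:
  fixes h :: "'m \<Rightarrow> 'b::euclidean_space"
  assumes "open U" "smooth_fn M U h" "vector_field M U X" "vector_field M U Y" "p \<in> U"
    and "lie_bracket M X Y p \<in> tangent_space M p"
  shows "vderiv M p (X p) (\<lambda>q. vderiv M q (Y q) h) - vderiv M p (Y p) (\<lambda>q. vderiv M q (X q) h) =
    vderiv M p (lie_bracket M X Y p) h"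
proof -
  obtain c where c: "c \<in> charts_at M p" using chart_at_exists by blast
  note M = charts_atD[OF c]
  let ?S = "snd c ` (U \<inter> fst c)"
  define k where "k = (\<lambda>x. h (chart_inv c x))"
  define D2 where "D2 = (\<lambda>b. frechet_derivative (\<lambda>x. frechet_derivative k (at x) b) (at (snd c p)))"
  have S: "open ?S" "snd c p \<in> ?S" using chart_image_open[OF M(1) assms(1)] M assms(5) by auto
  have k: "smooth_on ?S k" using assms(2) M unfolding smooth_fn_def k_def by blast
  have D2: "((\<lambda>x. frechet_derivative k (at x) b) has_derivative D2 b) (at (snd c p))" for b
    unfolding D2_def by (rule smooth_on_has_derivative[OF smooth_on_frechet_derivative[OF k] S(2)])
  have klin: "linear (frechet_derivative k (at x))" if "x \<in> ?S" for x
    using smooth_on_has_derivative[OF k that] by (rule has_derivative_linear)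
  have hp: "mdiff p h" using smooth_fn_mdiff assms by blast
  have main: "vderiv M p (X p) (\<lambda>q. vderiv M q (Y q) h) =
      (\<Sum>b\<in>Basis. \<Sum>a\<in>Basis. (Y p c \<bullet> b) *\<^sub>R (X p c \<bullet> a) *\<^sub>R D2 b a) +
      frechet_derivative k (at (snd c p)) (vderiv M p (X p) (\<lambda>q. Y q c))"
    if X: "vector_field M U X" and Y: "vector_field M U Y" for X Y
  proof -
    have XT: "X p \<in> tangent_space M p" and YT: "\<And>q. q \<in> U \<Longrightarrow> Y q \<in> tangent_space M q"
      using X Y assms(5) unfolding vector_field_def section_along_iff by auto
    have "smooth_fn M (U \<inter> fst c) (\<lambda>q. Y q c)"
      using Y M(1) unfolding vector_field_def section_along_iff by auto
    then have Yd: "mdiff p (\<lambda>q. Y q c)" using smooth_fn_mdiff assms(5) M(2) by blast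
    define DY where "DY = frechet_derivative (\<lambda>x. Y (chart_inv c x) c) (at (snd c p))"
    have DY: "((\<lambda>x. Y (chart_inv c x) c) has_derivative DY) (at (snd c p))"
      unfolding DY_def by (rule mdiffD[OF Yd c])
    have "((\<lambda>x. \<Sum>b\<in>Basis. (Y (chart_inv c x) c \<bullet> b) *\<^sub>R frechet_derivative k (at x) b) has_derivative
        (\<lambda>v. \<Sum>b\<in>Basis. (Y (chart_inv c (snd c p)) c \<bullet> b) *\<^sub>R D2 b v + (DY v \<bullet> b) *\<^sub>R frechet_derivative k (at (snd c p)) b)) (at (snd c p))"
      by (intro has_derivative_sum has_derivative_scaleR D2 bounded_linear.has_derivative[OF bounded_linear_inner_left] DY)
    then have "((\<lambda>x. vderiv M (chart_inv c x) (Y (chart_inv c x)) h) has_derivative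
        (\<lambda>v. \<Sum>b\<in>Basis. (Y (chart_inv c (snd c p)) c \<bullet> b) *\<^sub>R D2 b v + (DY v \<bullet> b) *\<^sub>R frechet_derivative k (at (snd c p)) b)) (at (snd c p))"
    proof (rule has_derivative_transform_within_open[OF _ S])
      fix x assume x: "x \<in> ?S"
      then obtain q where q: "q \<in> U" "q \<in> fst c" "x = snd c q" by blast
      have "(\<Sum>b\<in>Basis. (Y (chart_inv c x) c \<bullet> b) *\<^sub>R frechet_derivative k (at x) b) =
          frechet_derivative k (at x) (Y (chart_inv c x) c)"
        by (rule linear_Basis_expansion[symmetric]) (rule klin[OF x])
      also have "\<dots> = vderiv M (chart_inv c x) (Y (chart_inv c x)) h"
        using vderiv_chart[OF smooth_fn_mdiff[OF assms(2) q(1)] charts_atI[OF M(1) q(2)] YT[OF q(1)]] M q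
        by (simp add: chart_inv_chart k_def)
      finally show "(\<Sum>b\<in>Basis. (Y (chart_inv c x) c \<bullet> b) *\<^sub>R frechet_derivative k (at x) b) =
          vderiv M (chart_inv c x) (Y (chart_inv c x)) h" .
    qed
    from vderiv_eq[OF c XT this]
    have "vderiv M p (X p) (\<lambda>q. vderiv M q (Y q) h) =
        (\<Sum>b\<in>Basis. (Y p c \<bullet> b) *\<^sub>R D2 b (X p c)) + (\<Sum>b\<in>Basis. (DY (X p c) \<bullet> b) *\<^sub>R frechet_derivative k (at (snd c p)) b)"
      using M by (simp add: chart_inv_chart sum.distrib)
    also have "(\<Sum>b\<in>Basis. (DY (X p c) \<bullet> b) *\<^sub>R frechet_derivative k (at (snd c p)) b) =
        frechet_derivative k (at (snd c p)) (DY (X p c))"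
      by (rule linear_Basis_expansion[symmetric]) (rule klin[OF S(2)])
    also have "DY (X p c) = vderiv M p (X p) (\<lambda>q. Y q c)"
      using vderiv_eq[OF c XT DY] by simp
    also have "(\<Sum>b\<in>Basis. (Y p c \<bullet> b) *\<^sub>R D2 b (X p c)) =
        (\<Sum>b\<in>Basis. \<Sum>a\<in>Basis. (Y p c \<bullet> b) *\<^sub>R (X p c \<bullet> a) *\<^sub>R D2 b a)"
      by (intro sum.cong refl) (subst linear_Basis_expansion[OF has_derivative_linear[OF D2]], simp add: scaleR_sum_right)
    finally show ?thesis .
  qed
  have "(\<Sum>b\<in>Basis. \<Sum>a\<in>Basis. (Y p c \<bullet> b) *\<^sub>R (X p c \<bullet> a) *\<^sub>R D2 b a) =
      (\<Sum>a\<in>Basis. \<Sum>b\<in>Basis. (Y p c \<bullet> b) *\<^sub>R (X p c \<bullet> a) *\<^sub>R D2 b a)"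
    by (rule sum.swap)
  also have "\<dots> = (\<Sum>a\<in>Basis. \<Sum>b\<in>Basis. (X p c \<bullet> a) *\<^sub>R (Y p c \<bullet> b) *\<^sub>R D2 a b)"
    unfolding D2_def using second_derivative_symmetric[OF S(1) k S(2)]
    by (intro sum.cong refl) (simp add: mult.commute)
  finally have "vderiv M p (X p) (\<lambda>q. vderiv M q (Y q) h) - vderiv M p (Y p) (\<lambda>q. vderiv M q (X q) h) =
      frechet_derivative k (at (snd c p)) (vderiv M p (X p) (\<lambda>q. Y q c) - vderiv M p (Y p) (\<lambda>q. X q c))"
    using main[OF assms(3,4)] main[OF assms(4,3)] by (simp add: linear_diff[OF klin[OF S(2)]])
  also have "\<dots> = frechet_derivative k (at (snd c p)) (lie_bracket M X Y p c)"
    using c by (simp add: lie_bracket_def)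
  also have "\<dots> = vderiv M p (lie_bracket M X Y p) h"
    unfolding k_def using vderiv_chart[OF hp c assms(6)] by simp
  finally show ?thesis .
qed

lemma vector_field_iff:
  "vector_field M U X \<longleftrightarrow> (\<forall>p\<in>U. X p \<in> tangent_space M p) \<and> (\<forall>c\<in>M. smooth_fn M (U \<inter> fst c) (\<lambda>q. X q c))"
  by (simp add: vector_field_def section_along_iff)

text \<open>In another chart the components are partial derivatives of the transition map.\<close>

lemma vector_field_coord:
  assumes d: "d \<in> M" shows "vector_field M (fst d) (coord_field d x)"
  unfolding vector_field_iff
proof (intro conjI ballI)
  show "coord_field d x p \<in> tangent_space M p" if "p \<in> fst d" for p
    using coord_field_tangent charts_atI[OF d that] .
  fix c assume c: "c \<in> M"
  have o: "open (fst d \<inter> fst c)" using chart_open c d by blast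
  have "smooth_fn M (fst d \<inter> fst c) (\<lambda>q. frechet_derivative (snd c \<circ> chart_inv d) (at (snd d q)) x)"
  proof (rule smooth_fn_compose[where k = "\<lambda>y. frechet_derivative (snd c \<circ> chart_inv d) (at y) x"])
    show "open (fst d \<inter> fst c)" by (rule o)
    show "smooth_fn M (fst d \<inter> fst c) (snd d)" by (rule smooth_fn_subset[OF smooth_fn_chart[OF d]]) blast
    show "smooth_on (snd d ` (fst d \<inter> fst c)) (\<lambda>y. frechet_derivative (snd c \<circ> chart_inv d) (at y) x)"
      by (rule smooth_on_frechet_derivative[OF transition_smooth[OF d c]])
    show "open (snd d ` (fst d \<inter> fst c))"
      using chart_image_open[OF d chart_open[OF c]] by (simp add: Int_commute)
  qed simp
  then show "smooth_fn M (fst d \<inter> fst c) (\<lambda>q. coord_field d x q c)"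
    by (rule smooth_fn_cong[OF o]) (use c in \<open>auto simp: coord_field_def charts_at_def\<close>)
qed

lemma smooth_map_id: "smooth_map M M id"
  unfolding smooth_map_iff using smooth_fn_chart by (auto simp: continuous_on_id vimage_def)

end

section \<open>Sections along a smooth map\<close>

locale smooth_mapping = dom: manifold M + cod: manifold N
  for M :: "('m::{t2_space,second_countable_topology}, 'a::euclidean_space) atlas"
    and N :: "('n::{t2_space,second_countable_topology}, 'b::euclidean_space) atlas" +
  fixes F :: "'m \<Rightarrow> 'n"
  assumes smooth_map: "smooth_map M N F"
begin

lemma preimage_open: "open W \<Longrightarrow> open (F -` W)"
  using smooth_map continuous_on_open_vimage[of UNIV F] by (auto simp: smooth_map_iff)

lemma smooth_fn_chart_map: "d \<in> N \<Longrightarrow> smooth_fn M (F -` fst d) (\<lambda>q. snd d (F q))"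
  using smooth_map by (auto simp: smooth_map_iff)

lemma mdiff_chart_map: "d \<in> charts_at N (F p) \<Longrightarrow> dom.mdiff p (\<lambda>q. snd d (F q))"
  using cod.charts_atD by (intro dom.smooth_fn_mdiff[OF smooth_fn_chart_map]) auto

lemma smooth_fn_pullback:
  assumes d: "d \<in> N" and W: "open W" "W \<subseteq> fst d" and h: "smooth_fn N W h"
  shows "smooth_fn M (F -` W) (\<lambda>q. h (F q))"
proof -
  have "smooth_fn M (F -` W) (\<lambda>q. h (chart_inv d (snd d (F q))))"
  proof (rule dom.smooth_fn_compose[where k = "\<lambda>x. h (chart_inv d x)"])
    show "open (F -` W)" by (rule preimage_open[OF W(1)])
    show "smooth_fn M (F -` W) (\<lambda>q. snd d (F q))"
      by (rule dom.smooth_fn_subset[OF smooth_fn_chart_map[OF d]]) (use W in blast)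
    show "open (snd d ` (W \<inter> fst d))" by (rule cod.chart_image_open[OF d W(1)])
    show "smooth_on (snd d ` (W \<inter> fst d)) (\<lambda>x. h (chart_inv d x))" using h d by (simp add: smooth_fn_def)
    show "(\<lambda>q. snd d (F q)) ` (F -` W) \<subseteq> snd d ` (W \<inter> fst d)" using W by blast
  qed
  then show ?thesis
    by (rule dom.smooth_fn_cong[OF preimage_open[OF W(1)]]) (use W cod.chart_inv_chart[OF d] in auto)
qed

lemma push_apply: "d \<in> charts_at N (F p) \<Longrightarrow> push M N F p v d = vderiv M p v (\<lambda>q. snd d (F q))"
  by (simp add: push_def o_def)

text \<open>Near \<open>p\<close>, \<open>h \<circ> F\<close> is \<open>h\<close> read in a chart \<open>d\<close> composed with the coordinate expression of \<open>F\<close>.\<close>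

lemma pullback_chain:
  assumes d: "d \<in> charts_at N (F p)" and D: "((\<lambda>x. h (chart_inv d x)) has_derivative D) (at (snd d (F p)))"
    and v: "v \<in> tangent_space M p"
  shows "dom.mdiff p (\<lambda>q. h (F q))" "vderiv M p v (\<lambda>q. h (F q)) = D (push M N F p v d)"
proof -
  note N = cod.charts_atD[OF d]
  note chain = dom.vderiv_chain[OF mdiff_chart_map[OF d] D v]
  have U: "open (F -` fst d)" "p \<in> F -` fst d" using preimage_open cod.chart_open N by auto
  have eq: "h (chart_inv d (snd d (F q))) = h (F q)" if "q \<in> F -` fst d" for q
    using that N by (simp add: cod.chart_inv_chart)
  show "dom.mdiff p (\<lambda>q. h (F q))" by (rule dom.vderiv_local(1)[OF U eq chain(1)])
  show "vderiv M p v (\<lambda>q. h (F q)) = D (push M N F p v d)"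
    using dom.vderiv_local(2)[OF U eq chain(1) v] chain(2) push_apply[OF d] by simp
qed

lemma push_tangent:
  assumes "v \<in> tangent_space M p" shows "push M N F p v \<in> tangent_space N (F p)"
  unfolding tangent_space_def
proof (intro CollectI conjI ballI allI impI)
  fix d d' assume d: "d \<in> charts_at N (F p)" and d': "d' \<in> charts_at N (F p)"
  show "push M N F p v d' = frechet_derivative (snd d' \<circ> chart_inv d) (at (snd d (F p))) (push M N F p v d)"
    using pullback_chain(2)[OF d _ assms, of "snd d'"] cod.transition_has_derivative[OF d d'] push_apply[OF d']
    by (simp add: o_def)
qed (simp add: push_def)

lemma push_linear:
  assumes "v \<in> tangent_space M p" "w \<in> tangent_space M p"
  shows "push M N F p (a *\<^sub>R v + b *\<^sub>R w) = a *\<^sub>R push M N F p v + b *\<^sub>R push M N F p w"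
proof -
  have "push M N F p (a *\<^sub>R v + b *\<^sub>R w) d = a *\<^sub>R push M N F p v d + b *\<^sub>R push M N F p w d" for d
    using dom.vderiv_linear[OF mdiff_chart_map assms] push_apply by (cases "d \<in> charts_at N (F p)") (auto simp: push_def)
  then show ?thesis by (auto simp: fun_eq_iff scaleR_fun_def)
qed

lemma push_add: "v \<in> tangent_space M p \<Longrightarrow> w \<in> tangent_space M p \<Longrightarrow> push M N F p (v + w) = push M N F p v + push M N F p w"
  using push_linear[of v p w 1 1] by (simp only: scaleR_one)

lemma push_diff: "v \<in> tangent_space M p \<Longrightarrow> w \<in> tangent_space M p \<Longrightarrow> push M N F p (v - w) = push M N F p v - push M N F p w"
  using push_linear[of v p w 1 "-1"] by (simp only: scaleR_one scaleR_minus1_left add_uminus_conv_diff)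

lemma push_scale: "v \<in> tangent_space M p \<Longrightarrow> push M N F p (a *\<^sub>R v) = a *\<^sub>R push M N F p v"
  using push_linear[of v p v a 0] by (simp only: scaleR_zero_left add_0_right)

lemma push_zero: "push M N F p 0 = 0"
  using push_scale[OF subspace_0[OF dom.subspace_tangent_space], of p 0] by (simp only: scaleR_zero_left)

lemma push_sum:
  assumes "\<And>i. i \<in> I \<Longrightarrow> v i \<in> tangent_space M p"
  shows "push M N F p (\<Sum>i\<in>I. a i *\<^sub>R v i) = (\<Sum>i\<in>I. a i *\<^sub>R push M N F p (v i))"
  using assms
proof (induction I rule: infinite_finite_induct)
  case (insert i I)
  then have "push M N F p (a i *\<^sub>R v i + (\<Sum>i\<in>I. a i *\<^sub>R v i)) =
      a i *\<^sub>R push M N F p (v i) + push M N F p (\<Sum>i\<in>I. a i *\<^sub>R v i)"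
    by (subst push_add) (auto intro!: subspace_scale subspace_sum dom.subspace_tangent_space push_scale)
  moreover have "push M N F p (\<Sum>i\<in>I. a i *\<^sub>R v i) = (\<Sum>i\<in>I. a i *\<^sub>R push M N F p (v i))"
    using insert by auto
  ultimately show ?case by (simp only: sum.insert[OF insert.hyps])
next
  case empty
  show ?case by (simp only: sum.empty push_zero)
next
  case (infinite I)
  show ?case by (simp only: sum.infinite[OF infinite.hyps] push_zero)
qed

lemma subspace_ker_push: "subspace (ker_push M N F p)"
  using dom.subspace_tangent_space[of p] unfolding ker_push_def
  by (intro subspaceI) (auto simp: subspace_0 subspace_add subspace_scale push_zero push_add push_scale)

lemma vderiv_pullback:
  assumes "cod.mdiff (F p) h" "v \<in> tangent_space M p"
  shows "dom.mdiff p (\<lambda>q. h (F q))" "vderiv M p v (\<lambda>q. h (F q)) = vderiv N (F p) (push M N F p v) h"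
proof -
  obtain d where d: "d \<in> charts_at N (F p)" using cod.chart_at_exists by blast
  note chain = pullback_chain[OF d cod.mdiffD[OF assms(1) d] assms(2)]
  show "dom.mdiff p (\<lambda>q. h (F q))" by (rule chain(1))
  show "vderiv M p v (\<lambda>q. h (F q)) = vderiv N (F p) (push M N F p v) h"
    using chain(2) cod.vderiv_chart[OF assms(1) d push_tangent[OF assms(2)]] by simp
qed

lemma section_tangent: "section_along M N F U V \<Longrightarrow> q \<in> U \<Longrightarrow> V q \<in> tangent_space N (F q)"
  unfolding section_along_iff by blast

lemma section_component: "section_along M N F U V \<Longrightarrow> d \<in> N \<Longrightarrow> smooth_fn M (U \<inter> F -` fst d) (\<lambda>q. V q d)"
  unfolding section_along_iff by blast

lemma section_component_inner:
  assumes "open U" "section_along M N F U V" "d \<in> N" "U \<subseteq> F -` fst d"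
  shows "smooth_fn M U (\<lambda>q. V q d \<bullet> b)"
proof -
  have "U \<inter> F -` fst d = U" using assms(4) by blast
  with section_component[OF assms(2,3)] have "smooth_fn M U (\<lambda>q. V q d)" by simp
  then show ?thesis by (rule dom.smooth_fn_linear[OF assms(1) bounded_linear_inner_left])
qed

lemma section_subset: "section_along M N F U V \<Longrightarrow> U' \<subseteq> U \<Longrightarrow> section_along M N F U' V"
  unfolding section_along_iff
  by (meson Int_mono dom.smooth_fn_subset order_refl subsetD)

lemma section_cong:
  assumes "open U" "section_along M N F U V" "\<And>q. q \<in> U \<Longrightarrow> V q = W q"
  shows "section_along M N F U W"
  unfolding section_along_iff
proof (intro conjI ballI)
  show "W p \<in> tangent_space N (F p)" if "p \<in> U" for p
    using section_tangent[OF assms(2) that] assms(3)[OF that] by simp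
  show "smooth_fn M (U \<inter> F -` fst d) (\<lambda>q. W q d)" if "d \<in> N" for d
    by (rule dom.smooth_fn_cong[OF _ section_component[OF assms(2) that]])
      (use assms(1,3) preimage_open[OF cod.chart_open[OF that]] in auto)
qed

lemma section_combination:
  assumes "open U" "\<And>i. i \<in> I \<Longrightarrow> smooth_fn M U (f i)" "\<And>i. i \<in> I \<Longrightarrow> section_along M N F U (V i)"
  shows "section_along M N F U (\<lambda>q. \<Sum>i\<in>I. f i q *\<^sub>R V i q)"
  unfolding section_along_iff
proof (intro conjI ballI)
  show "(\<Sum>i\<in>I. f i p *\<^sub>R V i p) \<in> tangent_space N (F p)" if "p \<in> U" for p
    using section_tangent[OF assms(3) that] cod.subspace_tangent_space by (intro subspace_sum subspace_scale)
  fix d assume d: "d \<in> N"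
  have o: "open (U \<inter> F -` fst d)" using assms(1) preimage_open cod.chart_open d by blast
  have "smooth_fn M (U \<inter> F -` fst d) (\<lambda>q. \<Sum>i\<in>I. f i q *\<^sub>R V i q d)"
    by (intro dom.smooth_fn_sum dom.smooth_fn_scaleR o section_component[OF assms(3) d]
        dom.smooth_fn_subset[OF assms(2)]) auto
  then show "smooth_fn M (U \<inter> F -` fst d) (\<lambda>q. (\<Sum>i\<in>I. f i q *\<^sub>R V i q) d)"
    by (simp add: dom.sum_fun_apply scaleR_fun_def)
qed

lemma section_scaleR:
  "open U \<Longrightarrow> smooth_fn M U f \<Longrightarrow> section_along M N F U V \<Longrightarrow> section_along M N F U (\<lambda>q. f q *\<^sub>R V q)"
  using section_combination[of U "{()}" "\<lambda>_. f" "\<lambda>_. V"] by simp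

lemma section_if:
  "section_along M N F U V \<Longrightarrow> section_along M N F U W \<Longrightarrow> section_along M N F U (\<lambda>q. if i then V q else W q)"
  by (cases i) auto

lemma section_diff:
  assumes "open U" "section_along M N F U V" "section_along M N F U W"
  shows "section_along M N F U (\<lambda>q. V q - W q)"
proof -
  \<comment> \<open>the difference as a linear combination indexed by the two truth values\<close>
  have "section_along M N F U (\<lambda>q. \<Sum>i\<in>UNIV. (if i then 1 else -1) *\<^sub>R (if i then V q else W q))"
    by (rule section_combination[OF assms(1), of UNIV "\<lambda>i q. if i then 1 else -1" "\<lambda>i q. if i then V q else W q"])
      (use assms(2,3) in \<open>auto simp: dom.smooth_fn_const section_if\<close>)
  then show ?thesis by (simp add: UNIV_bool)
qed

lemma section_zero: "section_along M N F U (\<lambda>q. 0)"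
  using subspace_0[OF cod.subspace_tangent_space] unfolding section_along_iff by (auto simp: dom.smooth_fn_const)

lemma section_along_compose:
  assumes d: "d \<in> N" and W: "open W" "W \<subseteq> fst d" and Y: "vector_field N W Y"
  shows "section_along M N F (F -` W) (\<lambda>q. Y (F q))"
  unfolding section_along_iff
proof (intro conjI ballI)
  show "Y (F p) \<in> tangent_space N (F p)" if "p \<in> F -` W" for p
    using Y that unfolding cod.vector_field_iff by blast
  fix d' assume d': "d' \<in> N"
  have "smooth_fn N (W \<inter> fst d') (\<lambda>q. Y q d')" using Y d' unfolding cod.vector_field_iff by blast
  from smooth_fn_pullback[OF d _ _ this]
  have "smooth_fn M (F -` (W \<inter> fst d')) (\<lambda>q. Y (F q) d')" using W d' cod.chart_open by blast
  then show "smooth_fn M (F -` W \<inter> F -` fst d') (\<lambda>q. Y (F q) d')" by simp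
qed

lemma section_coord:
  assumes "d \<in> N" shows "section_along M N F (F -` fst d) (\<lambda>q. cod.coord_field d b (F q))"
  by (rule section_along_compose[OF assms cod.chart_open[OF assms] order_refl cod.vector_field_coord[OF assms]])

text \<open>The components of \<open>F\<^sub>*X\<close> are the derivatives of the components of \<open>F\<close> along \<open>X\<close>.\<close>

lemma push_section:
  assumes U: "open U" and X: "vector_field M U X"
  shows "section_along M N F U (\<lambda>q. push M N F q (X q))"
  unfolding section_along_iff
proof (intro conjI ballI)
  show "push M N F p (X p) \<in> tangent_space N (F p)" if "p \<in> U" for p
    using X that unfolding dom.vector_field_iff by (blast intro: push_tangent)
  fix d assume d: "d \<in> N"
  have o: "open (U \<inter> F -` fst d)" using U preimage_open cod.chart_open d by blast
  have "vector_field M (U \<inter> F -` fst d) X"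
    using X dom.smooth_fn_subset unfolding dom.vector_field_iff by (metis Int_iff Int_lower1 inf_mono order_refl)
  with dom.smooth_fn_subset[OF smooth_fn_chart_map[OF d]]
  have "smooth_fn M (U \<inter> F -` fst d) (\<lambda>q. vderiv M q (X q) (\<lambda>q. snd d (F q)))"
    by (intro dom.smooth_fn_vderiv o) auto
  then show "smooth_fn M (U \<inter> F -` fst d) (\<lambda>q. push M N F q (X q) d)"
    by (rule dom.smooth_fn_cong[OF o]) (use d in \<open>auto simp: push_def charts_at_def o_def\<close>)
qed

lemma section_expansion:
  assumes "section_along M N F U V" "d \<in> N" "U \<subseteq> F -` fst d" "q \<in> U"
  shows "V q = (\<Sum>b\<in>Basis. (V q d \<bullet> b) *\<^sub>R cod.coord_field d b (F q))"
  using assms by (intro cod.tangent_vector_expansion cod.charts_atI section_tangent[OF assms(1)]) auto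

end

lemma riemannian_inner_subspace:
  assumes "riemannian_manifold N h" shows "inner_subspace (tangent_space N y) (h y)"
proof -
  interpret manifold N using assms by unfold_locales (simp add: riemannian_manifold_def)
  note R = assms[unfolded riemannian_manifold_def, THEN conjunct2]
  show ?thesis
  proof (rule inner_subspace.intro)
    show "subspace (tangent_space N y)" by (rule subspace_tangent_space)
    show "\<And>u v w a b. u \<in> tangent_space N y \<Longrightarrow> v \<in> tangent_space N y \<Longrightarrow> w \<in> tangent_space N y \<Longrightarrow>
        h y (a *\<^sub>R u + b *\<^sub>R v) w = a * h y u w + b * h y v w"
      by (rule R[THEN conjunct1, rule_format])
    show "\<And>u v. u \<in> tangent_space N y \<Longrightarrow> v \<in> tangent_space N y \<Longrightarrow> h y u v = h y v u"
      by (rule R[THEN conjunct2, THEN conjunct1, rule_format])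
    show "\<And>u. u \<in> tangent_space N y \<Longrightarrow> u \<noteq> 0 \<Longrightarrow> 0 < h y u u"
      by (rule R[THEN conjunct2, THEN conjunct2, THEN conjunct1, rule_format])
  qed
qed

locale metric_mapping = smooth_mapping M N F
  for M :: "('m::{t2_space,second_countable_topology}, 'a::euclidean_space) atlas"
    and N :: "('n::{t2_space,second_countable_topology}, 'b::euclidean_space) atlas" and F +
  fixes h :: "('n, 'b) metric"
  assumes riemannian: "riemannian_manifold N h"
begin

sublocale fibre: inner_subspace "tangent_space N y" "h y" for y
  by (rule riemannian_inner_subspace[OF riemannian])

lemma metric_smooth: "open W \<Longrightarrow> vector_field N W X \<Longrightarrow> vector_field N W Y \<Longrightarrow> smooth_fn N W (\<lambda>q. h q (X q) (Y q))"
  using riemannian[unfolded riemannian_manifold_def smooth_fun_on_iff, THEN conjunct2, THEN conjunct2,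
    THEN conjunct2, THEN conjunct2] by blast

text \<open>Smoothness of a metric speaks of vector fields on the manifold itself, and a section along \<open>F\<close> need not
  be of the form \<open>Y \<circ> F\<close>; but locally it is a combination of coordinate fields composed with \<open>F\<close>.\<close>

lemma smooth_fn_metric:
  assumes U: "open U" "U \<subseteq> F -` fst d" "d \<in> N"
    and V: "section_along M N F U V" and W: "section_along M N F U W"
  shows "smooth_fn M U (\<lambda>q. h (F q) (V q) (W q))"
proof -
  let ?E = "\<lambda>b q. cod.coord_field d b (F q)"
  have E: "smooth_fn M U (\<lambda>q. h (F q) (?E a q) (?E b q))" for a b
  proof -
    have "smooth_fn N (fst d) (\<lambda>y. h y (cod.coord_field d a y) (cod.coord_field d b y))"
      by (intro metric_smooth cod.chart_open cod.vector_field_coord U)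
    from smooth_fn_pullback[OF U(3) cod.chart_open[OF U(3)] order_refl this]
    show ?thesis by (rule dom.smooth_fn_subset[OF _ U(2)])
  qed
  have "smooth_fn M U (\<lambda>q. \<Sum>a\<in>Basis. \<Sum>b\<in>Basis. (V q d \<bullet> a) * ((W q d \<bullet> b) * h (F q) (?E a q) (?E b q)))"
    by (intro dom.smooth_fn_sum dom.smooth_fn_mult U E section_component_inner V W)
  then show ?thesis
  proof (rule dom.smooth_fn_cong[OF U(1)])
    fix q assume q: "q \<in> U"
    have ET: "?E b q \<in> tangent_space N (F q)" for b
      using q U by (intro cod.coord_field_tangent cod.charts_atI) auto
    have WT: "W q \<in> tangent_space N (F q)" using section_tangent[OF W q] .
    have "h (F q) (V q) (W q) = h (F q) (\<Sum>a\<in>Basis. (V q d \<bullet> a) *\<^sub>R ?E a q) (W q)"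
      by (rule arg_cong[where f = "\<lambda>v. h (F q) v (W q)", OF section_expansion[OF V U(3,2) q]])
    also have "\<dots> = (\<Sum>a\<in>Basis. (V q d \<bullet> a) * h (F q) (?E a q) (W q))"
      by (rule fibre.g_sum_scale[OF ET WT])
    also have "\<dots> = (\<Sum>a\<in>Basis. (V q d \<bullet> a) * h (F q) (?E a q) (\<Sum>b\<in>Basis. (W q d \<bullet> b) *\<^sub>R ?E b q))"
      by (rule arg_cong[where f = "\<lambda>w. \<Sum>a\<in>Basis. (V q d \<bullet> a) * h (F q) (?E a q) w", OF section_expansion[OF W U(3,2) q]])
    also have "\<dots> = (\<Sum>a\<in>Basis. \<Sum>b\<in>Basis. (V q d \<bullet> a) * ((W q d \<bullet> b) * h (F q) (?E a q) (?E b q)))"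
    proof (rule sum.cong[OF refl])
      fix a :: 'b
      have "h (F q) (?E a q) (\<Sum>b\<in>Basis. (W q d \<bullet> b) *\<^sub>R ?E b q) =
          (\<Sum>b\<in>Basis. (W q d \<bullet> b) * h (F q) (?E a q) (?E b q))"
        by (rule fibre.g_sum_scale_right[OF ET ET])
      then show "(V q d \<bullet> a) * h (F q) (?E a q) (\<Sum>b\<in>Basis. (W q d \<bullet> b) *\<^sub>R ?E b q) =
          (\<Sum>b\<in>Basis. (V q d \<bullet> a) * ((W q d \<bullet> b) * h (F q) (?E a q) (?E b q)))"
        by (simp add: sum_distrib_left)
    qed
    finally show "(\<Sum>a\<in>Basis. \<Sum>b\<in>Basis. (V q d \<bullet> a) * ((W q d \<bullet> b) * h (F q) (?E a q) (?E b q))) =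
        h (F q) (V q) (W q)" by simp
  qed
qed

end

section \<open>Connections along a map\<close>

text \<open>The case \<open>F = id\<close> serves for the Levi-Civita connections of the two manifolds.\<close>

locale connection = smooth_mapping M N F
  for M :: "('m::{t2_space,second_countable_topology}, 'a::euclidean_space) atlas"
    and N :: "('n::{t2_space,second_countable_topology}, 'b::euclidean_space) atlas" and F +
  fixes nabla :: "('m, 'a, 'n, 'b) conn"
  assumes connection_along: "connection_along M N F nabla"
begin

lemma conn_tangent:
  "open U \<Longrightarrow> section_along M N F U V \<Longrightarrow> p \<in> U \<Longrightarrow> v \<in> tangent_space M p \<Longrightarrow>
    nabla p v V \<in> tangent_space N (F p)"
  using connection_along unfolding connection_along_def by meson

lemma conn_linear:
  "open U \<Longrightarrow> section_along M N F U V \<Longrightarrow> p \<in> U \<Longrightarrow> v \<in> tangent_space M p \<Longrightarrow> w \<in> tangent_space M p \<Longrightarrow>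
    nabla p (a *\<^sub>R v + b *\<^sub>R w) V = a *\<^sub>R nabla p v V + b *\<^sub>R nabla p w V"
  using connection_along unfolding connection_along_def by meson

lemma conn_add:
  "open U \<Longrightarrow> section_along M N F U V \<Longrightarrow> section_along M N F U W \<Longrightarrow> p \<in> U \<Longrightarrow> v \<in> tangent_space M p \<Longrightarrow>
    nabla p v (\<lambda>q. V q + W q) = nabla p v V + nabla p v W"
  using connection_along unfolding connection_along_def by meson

lemma conn_leibniz:
  "open U \<Longrightarrow> smooth_fn M U f \<Longrightarrow> section_along M N F U V \<Longrightarrow> p \<in> U \<Longrightarrow> v \<in> tangent_space M p \<Longrightarrow>
    nabla p v (\<lambda>q. f q *\<^sub>R V q) = vderiv M p v f *\<^sub>R V p + f p *\<^sub>R nabla p v V"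
  using connection_along unfolding connection_along_def smooth_fun_on_iff by meson

text \<open>Multiplying by the indicator function of \<open>U\<close> erases the values off \<open>U\<close> and, by the Leibniz rule,
  does not change the derivative at points of \<open>U\<close>.\<close>

lemma conn_local:
  assumes U: "open U" "p \<in> U" and V: "section_along M N F U V" and eq: "\<And>q. q \<in> U \<Longrightarrow> V q = W q"
    and v: "v \<in> tangent_space M p"
  shows "nabla p v V = nabla p v W"
proof -
  define f :: "'m \<Rightarrow> real" where "f = (\<lambda>q. if q \<in> U then 1 else 0)"
  have f: "smooth_fn M U f"
    by (rule dom.smooth_fn_cong[OF U(1) dom.smooth_fn_const[of U 1]]) (simp add: f_def)
  have "vderiv M p v (\<lambda>q. 1 :: real) = vderiv M p v f"
    by (rule dom.vderiv_local(2)[OF U _ dom.mdiff_const v]) (simp add: f_def)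
  then have f': "vderiv M p v f = 0" by (simp add: dom.vderiv_const[OF v])
  have fp: "f p = 1" using U by (simp add: f_def)
  have "(\<lambda>q. f q *\<^sub>R V q) = (\<lambda>q. f q *\<^sub>R W q)" using eq by (auto simp: f_def)
  moreover have "nabla p v (\<lambda>q. f q *\<^sub>R V q) = nabla p v V"
    using conn_leibniz[OF U(1) f V U(2) v] f' fp by simp
  moreover have "nabla p v (\<lambda>q. f q *\<^sub>R W q) = nabla p v W"
    using conn_leibniz[OF U(1) f section_cong[OF U(1) V eq] U(2) v] f' fp by simp
  ultimately show ?thesis by simp
qed

lemma conn_zero: "v \<in> tangent_space M p \<Longrightarrow> nabla p v (\<lambda>q. 0) = 0"
  using conn_leibniz[OF open_UNIV dom.smooth_fn_const[of UNIV 0] section_zero UNIV_I, of v p]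
  by (simp add: dom.vderiv_const)

lemma conn_combination:
  assumes U: "open U" "p \<in> U" and v: "v \<in> tangent_space M p"
    and f: "\<And>i. i \<in> I \<Longrightarrow> smooth_fn M U (f i)" and V: "\<And>i. i \<in> I \<Longrightarrow> section_along M N F U (V i)"
  shows "nabla p v (\<lambda>q. \<Sum>i\<in>I. f i q *\<^sub>R V i q) =
    (\<Sum>i\<in>I. vderiv M p v (f i) *\<^sub>R V i p + f i p *\<^sub>R nabla p v (V i))"
  using f V
proof (induction I rule: infinite_finite_induct)
  case (insert i I)
  have "nabla p v (\<lambda>q. f i q *\<^sub>R V i q + (\<Sum>i\<in>I. f i q *\<^sub>R V i q)) =
      nabla p v (\<lambda>q. f i q *\<^sub>R V i q) + nabla p v (\<lambda>q. \<Sum>i\<in>I. f i q *\<^sub>R V i q)"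
    using insert by (intro conn_add[OF U(1) _ _ U(2) v] section_scaleR section_combination U) auto
  also have "nabla p v (\<lambda>q. f i q *\<^sub>R V i q) = vderiv M p v (f i) *\<^sub>R V i p + f i p *\<^sub>R nabla p v (V i)"
    using insert by (intro conn_leibniz[OF U(1) _ _ U(2) v]) auto
  finally show ?case using insert by simp
qed (auto simp: conn_zero v)

lemma conn_sum_vector:
  assumes "open U" "section_along M N F U V" "p \<in> U" "\<And>i. i \<in> I \<Longrightarrow> v i \<in> tangent_space M p"
  shows "nabla p (\<Sum>i\<in>I. a i *\<^sub>R v i) V = (\<Sum>i\<in>I. a i *\<^sub>R nabla p (v i) V)"
  using assms(4)
proof (induction I rule: infinite_finite_induct)
  case (insert i I)
  have "(\<Sum>i\<in>I. a i *\<^sub>R v i) \<in> tangent_space M p"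
    using insert.prems dom.subspace_tangent_space by (intro subspace_sum subspace_scale) auto
  then have "nabla p (a i *\<^sub>R v i + 1 *\<^sub>R (\<Sum>i\<in>I. a i *\<^sub>R v i)) V =
      a i *\<^sub>R nabla p (v i) V + 1 *\<^sub>R nabla p (\<Sum>i\<in>I. a i *\<^sub>R v i) V"
    using insert.prems by (intro conn_linear[OF assms(1-3)]) auto
  moreover have "nabla p (\<Sum>i\<in>I. a i *\<^sub>R v i) V = (\<Sum>i\<in>I. a i *\<^sub>R nabla p (v i) V)"
    using insert by auto
  ultimately show ?case by (simp only: sum.insert[OF insert.hyps] scaleR_one)
next
  case empty
  have "0 \<in> tangent_space M p" using subspace_0[OF dom.subspace_tangent_space] .
  from conn_linear[OF assms(1-3) this this, of 0 0]
  show ?case by (simp only: sum.empty scaleR_zero_left add_0_left)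
next
  case (infinite I)
  have "0 \<in> tangent_space M p" using subspace_0[OF dom.subspace_tangent_space] .
  from conn_linear[OF assms(1-3) this this, of 0 0]
  show ?case by (simp only: sum.infinite[OF infinite.hyps] scaleR_zero_left add_0_left)
qed

end

subsection \<open>The pullback of the Levi-Civita connection\<close>

locale levi_civita_pullback = metric_mapping M N F h
  for M :: "('m::{t2_space,second_countable_topology}, 'a::euclidean_space) atlas"
    and N :: "('n::{t2_space,second_countable_topology}, 'b::euclidean_space) atlas" and F h +
  fixes nabla2 :: "('n, 'b, 'n, 'b) conn" and nablaF :: "('m, 'a, 'n, 'b) conn"
  assumes levi_civita: "levi_civita N h nabla2"
    and pullback: "pullback_connection M N F nabla2 nablaF"
begin

sublocale connection M N F nablaF
  by unfold_locales (rule pullback[unfolded pullback_connection_def, THEN conjunct1])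

sublocale cod_conn: connection N N id nabla2
  by unfold_locales (rule cod.smooth_map_id, rule levi_civita[unfolded levi_civita_def, THEN conjunct1])

lemma pullback_compose:
  assumes "open W" "vector_field N W Y" "F p \<in> W" "v \<in> tangent_space M p"
  shows "nablaF p v (\<lambda>q. Y (F q)) = nabla2 (F p) (push M N F p v) Y"
  using pullback[unfolded pullback_connection_def, THEN conjunct2, rule_format, of W Y p v] assms
  by (simp add: o_def)

lemma cod_torsion_free:
  assumes "open W" "vector_field N W X" "vector_field N W Y" "y \<in> W"
  shows "nabla2 y (X y) Y - nabla2 y (Y y) X = lie_bracket N X Y y"
  using levi_civita[unfolded levi_civita_def, THEN conjunct2, rule_format, of W X Y] assms by blast

lemma cod_metric_compat:
  assumes "open W" "vector_field N W X" "vector_field N W Y" "y \<in> W" "v \<in> tangent_space N y"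
  shows "vderiv N y v (\<lambda>q. h q (X q) (Y q)) = h y (nabla2 y v X) (Y y) + h y (X y) (nabla2 y v Y)"
  using levi_civita[unfolded levi_civita_def, THEN conjunct2, rule_format, of W X Y] assms by blast

text \<open>Coordinate fields commute, since their components in their own chart are constant.\<close>

lemma cod_coord_symmetric:
  assumes "d \<in> charts_at N y"
  shows "nabla2 y (cod.coord_field d a y) (cod.coord_field d b) = nabla2 y (cod.coord_field d b y) (cod.coord_field d a)"
proof -
  note D = cod.charts_atD[OF assms]
  note W = cod.chart_open[OF D(1)] and E = cod.vector_field_coord[OF D(1)]
  note ET = cod.coord_field_tangent[OF assms]
  let ?L = "lie_bracket N (cod.coord_field d a) (cod.coord_field d b) y"
  have tor: "nabla2 y (cod.coord_field d a y) (cod.coord_field d b) - nabla2 y (cod.coord_field d b y) (cod.coord_field d a) = ?L"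
    by (rule cod_torsion_free[OF W E E D(2)])
  have T: "nabla2 y (cod.coord_field d a y) (cod.coord_field d b) \<in> tangent_space N y" for a b
    using cod_conn.conn_tangent[OF W _ D(2) ET, of "cod.coord_field d b" a] E by (simp add: vector_field_def)
  have const: "vderiv N y (cod.coord_field d a y) (\<lambda>q. cod.coord_field d b q d) = 0" for a b
  proof -
    have "vderiv N y (cod.coord_field d a y) (\<lambda>q. b) = vderiv N y (cod.coord_field d a y) (\<lambda>q. cod.coord_field d b q d)"
      by (rule cod.vderiv_local(2)[OF W D(2) _ cod.mdiff_const ET])
        (simp add: cod.coord_field_self cod.charts_atI[OF D(1)])
    then show ?thesis by (simp add: cod.vderiv_const[OF ET])
  qed
  have "?L = 0"
  proof (rule cod.tangent_vector_eqI[OF _ _ assms])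
    show "?L \<in> tangent_space N y"
      unfolding tor[symmetric] by (intro subspace_diff cod.subspace_tangent_space T)
    show "0 \<in> tangent_space N y" by (rule subspace_0[OF cod.subspace_tangent_space])
    show "?L d = 0 d" using assms const by (simp add: lie_bracket_def)
  qed
  with tor show ?thesis by simp
qed

lemma conn_expansion:
  assumes U: "open U" "U \<subseteq> F -` fst d" "d \<in> N" "p \<in> U"
    and V: "section_along M N F U V" and v: "v \<in> tangent_space M p"
  shows "nablaF p v V = (\<Sum>b\<in>Basis. vderiv M p v (\<lambda>q. V q d \<bullet> b) *\<^sub>R cod.coord_field d b (F p) +
    (V p d \<bullet> b) *\<^sub>R nablaF p v (\<lambda>q. cod.coord_field d b (F q)))"
proof -
  have E: "section_along M N F U (\<lambda>q. cod.coord_field d b (F q))" for b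
    by (rule section_subset[OF section_coord[OF U(3)] U(2)])
  have "nablaF p v V = nablaF p v (\<lambda>q. \<Sum>b\<in>Basis. (V q d \<bullet> b) *\<^sub>R cod.coord_field d b (F q))"
    by (rule conn_local[OF U(1,4) V section_expansion[OF V U(3,2)] v])
  also have "\<dots> = (\<Sum>b\<in>Basis. vderiv M p v (\<lambda>q. V q d \<bullet> b) *\<^sub>R cod.coord_field d b (F p) +
      (V p d \<bullet> b) *\<^sub>R nablaF p v (\<lambda>q. cod.coord_field d b (F q)))"
    by (rule conn_combination[OF U(1,4) v section_component_inner[OF U(1) V U(3,2)] E])
  finally show ?thesis .
qed

text \<open>\<open>\<nabla>F\<^sub>*\<close> is symmetric: in coordinates, by the symmetry of second derivatives and of the Christoffel
  symbols of the target.\<close>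

lemma pullback_torsion_free:
  assumes U: "open U" "p \<in> U" and X: "vector_field M U X" and Y: "vector_field M U Y"
    and L: "lie_bracket M X Y p \<in> tangent_space M p"
  shows "nablaF p (X p) (\<lambda>q. push M N F q (Y q)) - nablaF p (Y p) (\<lambda>q. push M N F q (X q)) =
    push M N F p (lie_bracket M X Y p)"
proof -
  obtain d where d: "d \<in> charts_at N (F p)" using cod.chart_at_exists by blast
  note D = cod.charts_atD[OF d]
  define U' where "U' = U \<inter> F -` fst d"
  have U': "open U'" "p \<in> U'" "U' \<subseteq> F -` fst d" "U' \<subseteq> U"
    using U D preimage_open[OF cod.chart_open[OF D(1)]] by (auto simp: U'_def)
  have sub: "vector_field M U' Z" if "vector_field M U Z" for Z
    using that U'(4) dom.smooth_fn_subset unfolding dom.vector_field_iff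
    by (meson Int_mono order_refl subsetD)
  note push_U' = push_section[OF U'(1) sub]
  have tangent: "Z p \<in> tangent_space M p" if "vector_field M U Z" for Z
    using that U(2) unfolding dom.vector_field_iff by blast
  \<comment> \<open>the Christoffel symbols at \<open>F p\<close>, as vectors, and the part of the covariant derivative containing them\<close>
  define \<Gamma> where "\<Gamma> = (\<lambda>a b. nabla2 (F p) (cod.coord_field d a (F p)) (cod.coord_field d b))"
  have \<Gamma>: "nablaF p v (\<lambda>q. cod.coord_field d b (F q)) = (\<Sum>a\<in>Basis. (push M N F p v d \<bullet> a) *\<^sub>R \<Gamma> a b)"
    if v: "v \<in> tangent_space M p" for v b
  proof -
    have "nablaF p v (\<lambda>q. cod.coord_field d b (F q)) = nabla2 (F p) (push M N F p v) (cod.coord_field d b)"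
      by (rule pullback_compose[OF cod.chart_open[OF D(1)] cod.vector_field_coord[OF D(1)] D(2) v])
    also have "\<dots> = nabla2 (F p) (\<Sum>a\<in>Basis. (push M N F p v d \<bullet> a) *\<^sub>R cod.coord_field d a (F p)) (cod.coord_field d b)"
      by (rule arg_cong[where f = "\<lambda>w. nabla2 (F p) w (cod.coord_field d b)",
            OF cod.tangent_vector_expansion[OF d push_tangent[OF v]]])
    also have "\<dots> = (\<Sum>a\<in>Basis. (push M N F p v d \<bullet> a) *\<^sub>R \<Gamma> a b)"
      unfolding \<Gamma>_def
      by (rule cod_conn.conn_sum_vector[OF cod.chart_open[OF D(1)] _ D(2) cod.coord_field_tangent[OF d]])
        (use cod.vector_field_coord[OF D(1)] in \<open>simp add: vector_field_def\<close>)
    finally show ?thesis .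
  qed
  have comp: "smooth_fn M U' (\<lambda>q. push M N F q (Z q) d)" if "vector_field M U Z" for Z
  proof -
    have "U' \<inter> F -` fst d = U'" using U'(3) by blast
    with section_component[OF push_U'[OF that] D(1)] show ?thesis by simp
  qed
  define G where "G = (\<lambda>X Y. \<Sum>b\<in>Basis. \<Sum>a\<in>Basis. (push M N F p (Y p) d \<bullet> b) *\<^sub>R (push M N F p (X p) d \<bullet> a) *\<^sub>R \<Gamma> a b)"
  have expand: "nablaF p (X p) (\<lambda>q. push M N F q (Y q)) =
      (\<Sum>b\<in>Basis. (vderiv M p (X p) (\<lambda>q. push M N F q (Y q) d) \<bullet> b) *\<^sub>R cod.coord_field d b (F p)) + G X Y"
    if X: "vector_field M U X" and Y: "vector_field M U Y" for X Y
    using conn_expansion[OF U'(1,3) D(1) U'(2) push_U'[OF Y] tangent[OF X]]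
      dom.vderiv_inner(2)[OF dom.smooth_fn_mdiff[OF comp[OF Y] U'(2)] tangent[OF X]] \<Gamma>[OF tangent[OF X]]
    by (simp add: sum.distrib G_def scaleR_sum_right)
  have "G X Y = (\<Sum>a\<in>Basis. \<Sum>b\<in>Basis. (push M N F p (Y p) d \<bullet> b) *\<^sub>R (push M N F p (X p) d \<bullet> a) *\<^sub>R \<Gamma> a b)"
    unfolding G_def by (rule sum.swap)
  also have "\<dots> = G Y X"
    unfolding G_def \<Gamma>_def using cod_coord_symmetric[OF d] by (intro sum.cong refl) (simp add: mult.commute)
  finally have G: "G X Y = G Y X" .
  have second: "vderiv M p (X p) (\<lambda>q. push M N F q (Y q) d) = vderiv M p (X p) (\<lambda>q. vderiv M q (Y q) (\<lambda>q. snd d (F q)))"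
    if X: "vector_field M U X" and Y: "vector_field M U Y" for X Y
    by (rule dom.vderiv_local(2)[OF U'(1,2) _ dom.smooth_fn_mdiff[OF comp[OF Y] U'(2)] tangent[OF X]])
      (use U'(3) in \<open>auto intro!: push_apply cod.charts_atI D(1)\<close>)
  have "nablaF p (X p) (\<lambda>q. push M N F q (Y q)) - nablaF p (Y p) (\<lambda>q. push M N F q (X q)) =
      (\<Sum>b\<in>Basis. (vderiv M p (X p) (\<lambda>q. push M N F q (Y q) d) \<bullet> b) *\<^sub>R cod.coord_field d b (F p)) -
      (\<Sum>b\<in>Basis. (vderiv M p (Y p) (\<lambda>q. push M N F q (X q) d) \<bullet> b) *\<^sub>R cod.coord_field d b (F p))"
    using expand[OF X Y] expand[OF Y X] G by simp
  also have "\<dots> = (\<Sum>b\<in>Basis. ((vderiv M p (X p) (\<lambda>q. push M N F q (Y q) d) -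
      vderiv M p (Y p) (\<lambda>q. push M N F q (X q) d)) \<bullet> b) *\<^sub>R cod.coord_field d b (F p))"
    by (simp add: inner_diff_left scaleR_diff_left sum_subtractf)
  also have "vderiv M p (X p) (\<lambda>q. push M N F q (Y q) d) - vderiv M p (Y p) (\<lambda>q. push M N F q (X q) d) =
      push M N F p (lie_bracket M X Y p) d"
    unfolding second[OF X Y] second[OF Y X] push_apply[OF d]
    by (rule dom.vderiv_commutator[OF U'(1) dom.smooth_fn_subset[OF smooth_fn_chart_map[OF D(1)] U'(3)]
          sub[OF X] sub[OF Y] U'(2) L])
  also have "(\<Sum>b\<in>Basis. (push M N F p (lie_bracket M X Y p) d \<bullet> b) *\<^sub>R cod.coord_field d b (F p)) =
      push M N F p (lie_bracket M X Y p)"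
    by (rule cod.tangent_vector_expansion[OF d push_tangent[OF L], symmetric])
  finally show ?thesis .
qed

definition metric_compatible :: "'m \<Rightarrow> ('m, 'a) tvec \<Rightarrow> ('m \<Rightarrow> ('n, 'b) tvec) \<Rightarrow> ('m \<Rightarrow> ('n, 'b) tvec) \<Rightarrow> bool" where
  "metric_compatible p v V W \<longleftrightarrow> vderiv M p v (\<lambda>q. h (F q) (V q) (W q)) =
     h (F p) (nablaF p v V) (W p) + h (F p) (V p) (nablaF p v W)"

text \<open>Swapping lets the expansion in coordinate sections be used in each of the two slots.\<close>

lemma metric_compatible_swap:
  assumes U: "open U" "U \<subseteq> F -` fst d" "d \<in> N" "p \<in> U" and V: "section_along M N F U V"
    and W: "section_along M N F U W" and v: "v \<in> tangent_space M p" and comp: "metric_compatible p v V W"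
  shows "metric_compatible p v W V"
proof -
  have "vderiv M p v (\<lambda>q. h (F q) (V q) (W q)) = vderiv M p v (\<lambda>q. h (F q) (W q) (V q))"
    by (rule dom.vderiv_local(2)[OF U(1,4) _ dom.smooth_fn_mdiff[OF smooth_fn_metric[OF U(1-3) V W] U(4)] v])
      (intro fibre.g_sym section_tangent[OF V] section_tangent[OF W])
  moreover have "h (F p) (nablaF p v V) (W p) = h (F p) (W p) (nablaF p v V)"
    "h (F p) (V p) (nablaF p v W) = h (F p) (nablaF p v W) (V p)"
    by (intro fibre.g_sym section_tangent[OF V] section_tangent[OF W] conn_tangent[OF U(1) V]
        conn_tangent[OF U(1) W] U(4) v)+
  ultimately show ?thesis using comp unfolding metric_compatible_def by simp
qed

text \<open>Compatibility with the metric passes from coordinate sections to all sections by linearity and the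
  Leibniz rule.\<close>

lemma metric_compatible_expansion:
  assumes U: "open U" "U \<subseteq> F -` fst d" "d \<in> N" "p \<in> U" and V: "section_along M N F U V"
    and W: "section_along M N F U W" and v: "v \<in> tangent_space M p"
    and comp: "\<And>b. metric_compatible p v (\<lambda>q. cod.coord_field d b (F q)) W"
  shows "metric_compatible p v V W"
proof -
  let ?E = "\<lambda>b q. cod.coord_field d b (F q)"
  let ?f = "\<lambda>b q. V q d \<bullet> b"
  have E: "section_along M N F U (?E b)" for b by (rule section_subset[OF section_coord[OF U(3)] U(2)])
  note ET = section_tangent[OF E] and WT = section_tangent[OF W]
  have f: "smooth_fn M U (?f b)" for b by (rule section_component_inner[OF U(1) V U(3,2)])
  have EW: "smooth_fn M U (\<lambda>q. h (F q) (?E b q) (W q))" for b by (rule smooth_fn_metric[OF U(1-3) E W])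
  have nE: "nablaF p v (?E b) \<in> tangent_space N (F p)" for b by (rule conn_tangent[OF U(1) E U(4) v])
  have nW: "nablaF p v W \<in> tangent_space N (F p)" by (rule conn_tangent[OF U(1) W U(4) v])
  have Vh: "h (F q) (V q) w = (\<Sum>b\<in>Basis. ?f b q * h (F q) (?E b q) w)"
    if q: "q \<in> U" and w: "w \<in> tangent_space N (F q)" for q w
  proof -
    have "h (F q) (V q) w = h (F q) (\<Sum>b\<in>Basis. ?f b q *\<^sub>R ?E b q) w"
      by (rule arg_cong[where f = "\<lambda>x. h (F q) x w", OF section_expansion[OF V U(3,2) q]])
    also have "\<dots> = (\<Sum>b\<in>Basis. ?f b q * h (F q) (?E b q) w)"
      by (rule fibre.g_sum_scale[OF ET[OF q] w])
    finally show ?thesis .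
  qed
  have "vderiv M p v (\<lambda>q. \<Sum>b\<in>Basis. ?f b q * h (F q) (?E b q) (W q)) = vderiv M p v (\<lambda>q. h (F q) (V q) (W q))"
    by (rule dom.vderiv_local(2)[OF U(1,4) _ _ v])
      (use Vh[OF _ WT] in \<open>auto intro!: dom.smooth_fn_mdiff[OF _ U(4)] dom.smooth_fn_sum dom.smooth_fn_mult U(1) f EW\<close>)
  then have "vderiv M p v (\<lambda>q. h (F q) (V q) (W q)) = vderiv M p v (\<lambda>q. \<Sum>b\<in>Basis. ?f b q * h (F q) (?E b q) (W q))" ..
  also have "\<dots> = (\<Sum>b\<in>Basis. vderiv M p v (\<lambda>q. ?f b q * h (F q) (?E b q) (W q)))"
    by (rule dom.vderiv_sum[OF dom.smooth_fn_mdiff[OF dom.smooth_fn_mult[OF U(1) f EW] U(4)] v])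
  also have "\<dots> = (\<Sum>b\<in>Basis. vderiv M p v (?f b) * h (F p) (?E b p) (W p) +
      ?f b p * (h (F p) (nablaF p v (?E b)) (W p) + h (F p) (?E b p) (nablaF p v W)))"
    using comp unfolding metric_compatible_def
    by (intro sum.cong refl) (subst dom.vderiv_mult[OF dom.smooth_fn_mdiff[OF f U(4)] dom.smooth_fn_mdiff[OF EW U(4)] v], simp)
  also have "\<dots> = (\<Sum>b\<in>Basis. vderiv M p v (?f b) * h (F p) (?E b p) (W p) + ?f b p * h (F p) (nablaF p v (?E b)) (W p)) +
      (\<Sum>b\<in>Basis. ?f b p * h (F p) (?E b p) (nablaF p v W))"
    by (simp add: sum.distrib[symmetric] algebra_simps)
  also have "(\<Sum>b\<in>Basis. vderiv M p v (?f b) * h (F p) (?E b p) (W p) + ?f b p * h (F p) (nablaF p v (?E b)) (W p)) =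
      h (F p) (nablaF p v V) (W p)"
    unfolding conn_expansion[OF U(1,2,3,4) V v]
    by (subst fibre.g_sum)
      (auto intro!: sum.cong fibre.add_T fibre.scale_T ET[OF U(4)] nE WT[OF U(4)]
        simp: fibre.g_linear ET[OF U(4)] nE WT[OF U(4)])
  also have "(\<Sum>b\<in>Basis. ?f b p * h (F p) (?E b p) (nablaF p v W)) = h (F p) (V p) (nablaF p v W)"
    by (rule Vh[OF U(4) nW, symmetric])
  finally show ?thesis unfolding metric_compatible_def .
qed

text \<open>For coordinate sections this is the chain rule and the metric property on the target.\<close>

lemma pullback_metric_compat:
  assumes U: "open U" "p \<in> U" and V: "section_along M N F U V" and W: "section_along M N F U W"
    and v: "v \<in> tangent_space M p"
  shows "vderiv M p v (\<lambda>q. h (F q) (V q) (W q)) = h (F p) (nablaF p v V) (W p) + h (F p) (V p) (nablaF p v W)"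
proof -
  obtain d where d: "d \<in> charts_at N (F p)" using cod.chart_at_exists by blast
  note D = cod.charts_atD[OF d]
  define U' where "U' = U \<inter> F -` fst d"
  have U': "open U'" "U' \<subseteq> F -` fst d" "p \<in> U'" "U' \<subseteq> U"
    using U D preimage_open[OF cod.chart_open[OF D(1)]] by (auto simp: U'_def)
  note U'd = U'(1,2) D(1) U'(3)
  note V' = section_subset[OF V U'(4)] and W' = section_subset[OF W U'(4)]
  note Wd = cod.chart_open[OF D(1)] and Ed = cod.vector_field_coord[OF D(1)]
  have E: "section_along M N F U' (\<lambda>q. cod.coord_field d b (F q))" for b
    by (rule section_subset[OF section_coord[OF D(1)] U'(2)])
  have EE: "metric_compatible p v (\<lambda>q. cod.coord_field d a (F q)) (\<lambda>q. cod.coord_field d b (F q))" for a b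
  proof -
    have "cod.mdiff (F p) (\<lambda>y. h y (cod.coord_field d a y) (cod.coord_field d b y))"
      by (rule cod.smooth_fn_mdiff[OF metric_smooth[OF Wd Ed Ed] D(2)])
    from vderiv_pullback(2)[OF this v] show ?thesis
      unfolding metric_compatible_def
      using cod_metric_compat[OF Wd Ed Ed D(2) push_tangent[OF v]] pullback_compose[OF Wd Ed D(2) v] by simp
  qed
  have VE: "metric_compatible p v (\<lambda>q. cod.coord_field d b (F q)) W" for b
    by (rule metric_compatible_swap[OF U'd W' E v metric_compatible_expansion[OF U'd W' E v EE]])
  from metric_compatible_expansion[OF U'd V' W' v VE] show ?thesis unfolding metric_compatible_def .
qed

end

section \<open>Local orthonormal frames\<close>

context metric_mapping
begin

definition orthonormal_sections :: "'m set \<Rightarrow> nat \<Rightarrow> (nat \<Rightarrow> 'm \<Rightarrow> ('n, 'b) tvec) \<Rightarrow> bool" where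
  "orthonormal_sections U k e \<longleftrightarrow> (\<forall>i<k. section_along M N F U (e i)) \<and>
     (\<forall>q\<in>U. fibre.orthonormal (F q) {..<k} (\<lambda>i. e i q))"

lemma orthonormal_frame_iff:
  "orthonormal_frame M N h F D U k e \<longleftrightarrow>
     orthonormal_sections U k e \<and> (\<forall>q\<in>U. span ((\<lambda>i. e i q) ` {..<k}) = D q)"
  unfolding orthonormal_frame_def orthonormal_sections_def fibre.orthonormal_def
  using section_tangent by fastforce

lemma orthonormal_sections_subset:
  "orthonormal_sections U k e \<Longrightarrow> U' \<subseteq> U \<Longrightarrow> orthonormal_sections U' k e"
  unfolding orthonormal_sections_def using section_subset by blast

text \<open>Gram-Schmidt near \<open>p\<close>. A section is skipped if at \<open>p\<close> it depends on the previous ones, so the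
  resulting family spans at \<open>p\<close> what the given sections span; elsewhere it may span less.\<close>

lemma gram_schmidt:
  fixes V :: "nat \<Rightarrow> 'm \<Rightarrow> ('n, 'b) tvec" and n :: nat
  assumes U: "open U" "p \<in> U" "U \<subseteq> F -` fst d" "d \<in> N"
    and V: "\<And>i. i < n \<Longrightarrow> section_along M N F U (V i)"
  obtains U' k e where "open U'" "p \<in> U'" "U' \<subseteq> U" "orthonormal_sections U' k e"
    "\<forall>q\<in>U'. \<forall>a<k. e a q \<in> span ((\<lambda>i. V i q) ` {..<n})"
    "span ((\<lambda>a. e a p) ` {..<k}) = span ((\<lambda>i. V i p) ` {..<n})"
proof -
  have "\<exists>U' k e. open U' \<and> p \<in> U' \<and> U' \<subseteq> U \<and> orthonormal_sections U' k e \<and>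
    (\<forall>q\<in>U'. \<forall>a<k. e a q \<in> span ((\<lambda>i. V i q) ` {..<n})) \<and>
    span ((\<lambda>a. e a p) ` {..<k}) = span ((\<lambda>i. V i p) ` {..<n})"
    using V
  proof (induction n)
    case 0
    show ?case
      by (rule exI[of _ U], rule exI[of _ 0]) (use U in \<open>auto simp: orthonormal_sections_def fibre.orthonormal_def\<close>)
  next
    case (Suc n)
    then obtain U' k e where U': "open U'" "p \<in> U'" "U' \<subseteq> U" and on: "orthonormal_sections U' k e"
      and mem: "\<And>q a. q \<in> U' \<Longrightarrow> a < k \<Longrightarrow> e a q \<in> span ((\<lambda>i. V i q) ` {..<n})"
      and sp: "span ((\<lambda>a. e a p) ` {..<k}) = span ((\<lambda>i. V i p) ` {..<n})"
      by (metis less_Suc_eq)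
    have mono: "span ((\<lambda>i. V i q) ` {..<n}) \<subseteq> span ((\<lambda>i. V i q) ` {..<Suc n})" for q
      by (intro span_mono) auto
    show ?case
    proof (cases "V n p \<in> span ((\<lambda>i. V i p) ` {..<n})")
      case True
      then have "span ((\<lambda>i. V i p) ` {..<Suc n}) = span ((\<lambda>i. V i p) ` {..<n})"
        by (simp add: lessThan_Suc span_redundant)
      with sp have "span ((\<lambda>a. e a p) ` {..<k}) = span ((\<lambda>i. V i p) ` {..<Suc n})" by simp
      moreover have "\<forall>q\<in>U'. \<forall>a<k. e a q \<in> span ((\<lambda>i. V i q) ` {..<Suc n})"
        using subsetD[OF mono mem] by blast
      ultimately show ?thesis using U' on by (intro exI[of _ U'] exI[of _ k] exI[of _ e] conjI)
    next
      case False
      \<comment> \<open>the residual of the new section does not vanish at \<open>p\<close>, hence not near \<open>p\<close>, and can be normalised there\<close>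
    define W where "W = (\<lambda>q. V n q - (\<Sum>a<k. h (F q) (V n q) (e a q) *\<^sub>R e a q))"
      define f where "f = (\<lambda>q. h (F q) (W q) (W q))"
      have U'd: "U' \<subseteq> F -` fst d" using U'(3) U(3) by blast
      have e: "section_along M N F U' (e a)" if "a < k" for a
        using on that by (simp add: orthonormal_sections_def)
      have Vn: "section_along M N F U' (V n)" using Suc.prems U'(3) section_subset by blast
      have W: "section_along M N F U' W"
        unfolding W_def
        by (intro section_diff U'(1) Vn section_combination smooth_fn_metric[OF U'(1) U'd U(4) Vn]) (auto intro: e)
      have f: "smooth_fn M U' f" unfolding f_def by (rule smooth_fn_metric[OF U'(1) U'd U(4) W W])
      define U'' where "U'' = U' \<inter> f -` {0<..}"
      have opn: "open U''"
        unfolding U''_def using continuous_open_preimage[OF dom.smooth_fn_continuous[OF U'(1) f] U'(1)] by simp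
      have sub: "U'' \<subseteq> U'" and pos: "\<And>q. q \<in> U'' \<Longrightarrow> f q > 0" by (auto simp: U''_def)
      have "W p \<noteq> 0"
      proof
        assume "W p = 0"
        then have "V n p = (\<Sum>a<k. h (F p) (V n p) (e a p) *\<^sub>R e a p)" by (simp add: W_def)
        then have "V n p \<in> span ((\<lambda>a. e a p) ` {..<k})"
          using sum_in_span[of "\<lambda>a. h (F p) (V n p) (e a p)" "\<lambda>a. e a p" "{..<k}"] by argo
        with False sp show False by simp
      qed
      then have pU: "p \<in> U''"
        unfolding U''_def f_def using U'(2) fibre.g_pos[OF section_tangent[OF W U'(2)]] by simp
      define e' where "e' = (\<lambda>a. if a < k then e a else (\<lambda>q. inverse (sqrt (f q)) *\<^sub>R W q))"
      have e'k: "e' k q = inverse (sqrt (f q)) *\<^sub>R W q" for q by (simp add: e'_def)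
      have e'lt: "e' a = e a" if "a < k" for a using that by (simp add: e'_def)
      have sec: "section_along M N F U'' (e' a)" if "a < Suc k" for a
      proof (cases "a < k")
        case True
        then show ?thesis using e sub section_subset e'lt by metis
      next
        case False
        with that have "a = k" by simp
        have "section_along M N F U'' (\<lambda>q. inverse (sqrt (f q)) *\<^sub>R W q)"
          by (intro section_scaleR opn dom.smooth_fn_inverse_sqrt dom.smooth_fn_subset[OF f sub] pos
              section_subset[OF W sub])
        then show ?thesis by (simp add: e'_def \<open>a = k\<close>)
      qed
      have orth: "fibre.orthonormal (F q) {..<Suc k} (\<lambda>a. e' a q)" if q: "q \<in> U''" for q
      proof -
        have q': "q \<in> U'" using q sub by blast
        note WT = section_tangent[OF W q']
        have old: "fibre.orthonormal (F q) {..<k} (\<lambda>a. e a q)" using on q' by (simp add: orthonormal_sections_def)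
        have eT: "e a q \<in> tangent_space N (F q)" if "a < k" for a using section_tangent[OF e[OF that] q'] .
        have We: "h (F q) (W q) (e a q) = 0" if "a < k" for a
          unfolding W_def using fibre.orthonormal_residual[OF old section_tangent[OF Vn q']] that by simp
        have ke: "h (F q) (e' k q) (e' a q) = 0" "h (F q) (e' a q) (e' k q) = 0" if "a < k" for a
        proof -
          show "h (F q) (e' k q) (e' a q) = 0"
            unfolding e'k e'lt[OF that] using fibre.g_scale[OF WT eT[OF that]] We[OF that] by simp
          then show "h (F q) (e' a q) (e' k q) = 0"
            unfolding e'k e'lt[OF that] using fibre.g_sym[OF eT[OF that] fibre.scale_T[OF WT]] by simp
        qed
        have "h (F q) (e' k q) (e' k q) = inverse (sqrt (f q)) * (inverse (sqrt (f q)) * f q)"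
          unfolding e'k f_def
          using fibre.g_scale[OF WT fibre.scale_T[OF WT]] fibre.g_sym[OF WT fibre.scale_T[OF WT]] fibre.g_scale[OF WT WT]
          by simp
        also have "\<dots> = 1" using pos[OF q] by (simp add: field_simps)
        finally have kk: "h (F q) (e' k q) (e' k q) = 1" .
        show ?thesis
          unfolding fibre.orthonormal_def
        proof (intro conjI ballI)
          show "e' a q \<in> tangent_space N (F q)" if "a \<in> {..<Suc k}" for a
            using section_tangent[OF sec q] that by simp
          fix a b assume "a \<in> {..<Suc k}" "b \<in> {..<Suc k}"
          then consider "a < k" "b < k" | "a < k" "b = k" | "a = k" "b < k" | "a = k" "b = k" by fastforce
          then show "h (F q) (e' a q) (e' b q) = (if a = b then 1 else 0)"
            using ke kk old e'lt by cases (auto simp: fibre.orthonormal_def)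
        qed simp
      qed
      have Wmem: "W q \<in> span ((\<lambda>i. V i q) ` {..<Suc n})" if "q \<in> U'" for q
        unfolding W_def using mem[OF that] mono[of q]
        by (intro span_diff span_sum span_scale) (auto intro: span_base)
      have mem': "e' a q \<in> span ((\<lambda>i. V i q) ` {..<Suc n})" if q: "q \<in> U''" and a: "a < Suc k" for q a
      proof (cases "a < k")
        case True
        then show ?thesis using mem[of q a] mono[of q] q sub e'lt by auto
      next
        case False
        with a have "a = k" by simp
        then show ?thesis using Wmem[of q] q sub by (simp add: e'k span_scale subset_iff)
      qed
      have "span ((\<lambda>a. e' a p) ` {..<Suc k}) = span ((\<lambda>i. V i p) ` {..<Suc n})"
      proof
        show "span ((\<lambda>a. e' a p) ` {..<Suc k}) \<subseteq> span ((\<lambda>i. V i p) ` {..<Suc n})"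
          using mem'[OF pU] by (intro span_minimal) auto
        have old: "span ((\<lambda>i. V i p) ` {..<n}) \<subseteq> span ((\<lambda>a. e' a p) ` {..<Suc k})"
          unfolding sp[symmetric] by (intro span_mono) (auto simp: e'_def image_iff)
        have "W p = sqrt (f p) *\<^sub>R e' k p" using pos[OF pU] by (simp add: e'k)
        moreover have "e' k p \<in> span ((\<lambda>a. e' a p) ` {..<Suc k})" by (intro span_base) auto
        ultimately have Wp: "W p \<in> span ((\<lambda>a. e' a p) ` {..<Suc k})" by (simp add: span_scale)
        have "(\<Sum>a<k. h (F p) (V n p) (e a p) *\<^sub>R e a p) \<in> span ((\<lambda>a. e' a p) ` {..<Suc k})"
          using sum_in_span[of "\<lambda>a. h (F p) (V n p) (e a p)" "\<lambda>a. e a p" "{..<k}"] sp old by blast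
        from span_add[OF Wp this] have "V n p \<in> span ((\<lambda>a. e' a p) ` {..<Suc k})" by (simp add: W_def)
        moreover have "(\<lambda>i. V i p) ` {..<n} \<subseteq> span ((\<lambda>a. e' a p) ` {..<Suc k})"
          using subset_trans[OF span_superset old] .
        ultimately show "span ((\<lambda>i. V i p) ` {..<Suc n}) \<subseteq> span ((\<lambda>a. e' a p) ` {..<Suc k})"
          by (intro span_minimal subspace_span) (simp add: lessThan_Suc)
      qed
      moreover have "orthonormal_sections U'' (Suc k) e'" unfolding orthonormal_sections_def using sec orth by blast
      moreover have "\<forall>q\<in>U''. \<forall>a<Suc k. e' a q \<in> span ((\<lambda>i. V i q) ` {..<Suc n})" using mem' by blast
      ultimately show ?thesis
        using opn pU subset_trans[OF sub U'(3)] by (intro exI[of _ U''] exI[of _ "Suc k"] exI[of _ e'] conjI)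
    qed
  qed
  then show thesis by (elim exE conjE) (rule that)
qed

text \<open>Since the two families span at \<open>p\<close>, their lengths add up to the dimension; at every other point this
  makes the orthonormal vectors bases.\<close>

lemma complementary_sections_span:
  assumes dec: "\<And>q. q \<in> U \<Longrightarrow> fibre.orthogonal_decomposition (F q) (D q) (D' q)"
    and e: "orthonormal_sections U k e" and f: "orthonormal_sections U l f"
    and eD: "\<And>q a. q \<in> U \<Longrightarrow> a < k \<Longrightarrow> e a q \<in> D q" and fD: "\<And>q a. q \<in> U \<Longrightarrow> a < l \<Longrightarrow> f a q \<in> D' q"
    and p: "p \<in> U" "span ((\<lambda>a. e a p) ` {..<k}) = D p" "span ((\<lambda>a. f a p) ` {..<l}) = D' p"
    and q: "q \<in> U"
  shows "span ((\<lambda>a. e a q) ` {..<k}) = D q" "span ((\<lambda>a. f a q) ` {..<l}) = D' q"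
proof -
  have on: "fibre.orthonormal (F q) {..<k} (\<lambda>a. e a q)" "fibre.orthonormal (F q) {..<l} (\<lambda>a. f a q)" if "q \<in> U" for q
    using e f that by (auto simp: orthonormal_sections_def)
  have sub: "(\<lambda>a. e a q) ` {..<k} \<subseteq> D q" "(\<lambda>a. f a q) ` {..<l} \<subseteq> D' q" if "q \<in> U" for q
    using eD fD that by auto
  \<comment> \<open>spanning at \<open>p\<close> determines the number of sections, which decides spanning at \<open>q\<close>\<close>
  obtain d where d: "d \<in> charts_at N (F p)" using cod.chart_at_exists by blast
  note B = cod.coord_basis[OF d]
  have fB: "finite ((\<lambda>b. cod.coord_field d b (F p)) ` Basis)" by simp
  have "card ({..<k} <+> {..<l}) = DIM('b)"
    using fibre.orthonormal_card_iff[OF fibre.orthonormal_decomposition_Plus[OF dec[OF p(1)] on[OF p(1)] sub[OF p(1)]] fB B(1,2)]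
      fibre.orthonormal_decomposition_spans[OF dec[OF p(1)] on[OF p(1)] p(2,3)] B(3) by simp
  then have kl: "k + l = DIM('b)" by (simp add: card_Plus)
  obtain d where d: "d \<in> charts_at N (F q)" using cod.chart_at_exists by blast
  note B = cod.coord_basis[OF d]
  have fB: "finite ((\<lambda>b. cod.coord_field d b (F q)) ` Basis)" by simp
  show "span ((\<lambda>a. e a q) ` {..<k}) = D q"
    by (rule fibre.orthonormal_decomposition_card[OF dec[OF q] on[OF q] sub[OF q] fB B(1,2)]) (simp add: B(3) kl)
  show "span ((\<lambda>a. f a q) ` {..<l}) = D' q"
    by (rule fibre.orthonormal_decomposition_card[OF fibre.orthogonal_decomposition_swap[OF dec[OF q]] on(2)[OF q] on(1)[OF q]
          sub(2)[OF q] sub(1)[OF q] fB B(1,2)]) (simp add: B(3) kl add.commute)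
qed

lemma orthonormal_frame_subset:
  "orthonormal_frame M N h F D U k e \<Longrightarrow> U' \<subseteq> U \<Longrightarrow> orthonormal_frame M N h F D U' k e"
  unfolding orthonormal_frame_iff using orthonormal_sections_subset by blast

text \<open>The frame is obtained from coordinate sections; it keeps spanning near \<open>p\<close> because its length is the
  dimension.\<close>

lemma orthonormal_frame_exists:
  assumes U: "open U" "p \<in> U"
  shows "\<exists>U' n e. open U' \<and> p \<in> U' \<and> U' \<subseteq> U \<and> orthonormal_frame M N h F (\<lambda>q. tangent_space N (F q)) U' n e"
proof -
  obtain d where d: "d \<in> charts_at N (F p)" using cod.chart_at_exists by blast
  note D = cod.charts_atD[OF d]
  define U0 where "U0 = U \<inter> F -` fst d"
  have U0: "open U0" "p \<in> U0" "U0 \<subseteq> F -` fst d"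
    using U D preimage_open[OF cod.chart_open[OF D(1)]] by (auto simp: U0_def)
  obtain b where b: "bij_betw b {0..<DIM('b)} (Basis :: 'b set)" using ex_bij_betw_nat_finite[OF finite_Basis] by blast
  define V where "V = (\<lambda>i q. cod.coord_field d (b i) (F q))"
  have img: "(\<lambda>i. V i q) ` {..<DIM('b)} = (\<lambda>b. cod.coord_field d b (F q)) ` Basis" for q
  proof -
    have "b ` {..<DIM('b)} = Basis" using b by (simp add: bij_betw_def lessThan_atLeast0)
    from arg_cong[OF this, of "image (\<lambda>b. cod.coord_field d b (F q))"] show ?thesis
      by (simp add: V_def image_image)
  qed
  have V: "section_along M N F U0 (V i)" for i
    unfolding V_def by (rule section_subset[OF section_coord[OF D(1)] U0(3)])
  obtain U' k e where U': "open U'" "p \<in> U'" "U' \<subseteq> U0" and on: "orthonormal_sections U' k e"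
    and sp: "span ((\<lambda>a. e a p) ` {..<k}) = span ((\<lambda>i. V i p) ` {..<DIM('b)})"
    by (rule gram_schmidt[OF U0 D(1), where V = V and n = "DIM('b)"], rule V) (rule that)
  have on': "fibre.orthonormal (F q) {..<k} (\<lambda>a. e a q)" if "q \<in> U'" for q
    using on that by (simp add: orthonormal_sections_def)
  have card: "span ((\<lambda>a. e a q) ` {..<k}) = tangent_space N (F q) \<longleftrightarrow> k = DIM('b)" if q: "q \<in> U'" for q
  proof -
    have dq: "d \<in> charts_at N (F q)" using q U'(3) U0(3) D(1) by (auto intro: cod.charts_atI)
    show ?thesis
      using fibre.orthonormal_card_iff[OF on'[OF q] _ cod.coord_basis(1,2)[OF dq]] cod.coord_basis(3)[OF dq] by simp
  qed
  have "k = DIM('b)" using card[OF U'(2)] sp cod.coord_basis(2)[OF d] by (simp add: img)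
  then have "orthonormal_frame M N h F (\<lambda>q. tangent_space N (F q)) U' k e"
    unfolding orthonormal_frame_iff using on card by blast
  then show ?thesis using U' U0_def by blast
qed

end

section \<open>Holomorphic Riemannian maps from Kaehler manifolds\<close>

lemma diff_eq_diff_exchange:
  fixes a b c d :: "'z::ab_group_add"
  assumes "a - b = c - d" shows "a - c = b - d"
  using assms by (simp add: algebra_simps)

locale holomorphic_map_from_kaehler =
  fixes M1 :: "('m::{t2_space,second_countable_topology}, 'a::euclidean_space) atlas"
    and M2 :: "('n::{t2_space,second_countable_topology}, 'b::euclidean_space) atlas"
    and F :: "'m \<Rightarrow> 'n" and g1 J1 nabla1 g2 J2 nabla2 nablaF
  assumes kaehler: "kaehler_manifold M1 g1 J1 nabla1"
    and hermitian: "almost_hermitian_manifold M2 g2 J2"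
    and levi_civita2: "levi_civita M2 g2 nabla2"
    and pullback: "pullback_connection M1 M2 F nabla2 nablaF"
    and holomorphic: "holomorphic_riemannian_map M1 g1 J1 M2 g2 J2 F"
begin

lemma riemannian1: "riemannian_manifold M1 g1" and levi_civita1: "levi_civita M1 g1 nabla1"
  using kaehler by (auto simp: kaehler_manifold_def almost_hermitian_manifold_def)

lemma riemannian2: "riemannian_manifold M2 g2"
  using hermitian by (auto simp: almost_hermitian_manifold_def)

lemma riemannian_map: "riemannian_map M1 g1 M2 g2 F"
  using holomorphic by (auto simp: holomorphic_riemannian_map_def)

sublocale manifold M1
  by unfold_locales (use riemannian1 in \<open>simp add: riemannian_manifold_def\<close>)

sublocale src: metric_mapping M1 M1 id g1
  by unfold_locales (rule smooth_map_id, rule riemannian1)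

sublocale src: connection M1 M1 id nabla1
  by unfold_locales (rule levi_civita1[unfolded levi_civita_def, THEN conjunct1])

sublocale levi_civita_pullback M1 M2 F g2 nabla2 nablaF
proof -
  interpret m2: manifold M2 by unfold_locales (use riemannian2 in \<open>simp add: riemannian_manifold_def\<close>)
  show "levi_civita_pullback M1 M2 F g2 nabla2 nablaF"
    by unfold_locales (use riemannian_map in \<open>simp add: riemannian_map_def\<close>, rule riemannian2, rule levi_civita2, rule pullback)
qed

abbreviation "ver p \<equiv> ker_push M1 M2 F p"
abbreviation "hor p \<equiv> ker_push_perp M1 g1 M2 F p"
abbreviation "rge p \<equiv> range_push M1 M2 F p"
abbreviation "rge_perp p \<equiv> range_push_perp M1 M2 g2 F p"

lemma isometry: "u \<in> hor p \<Longrightarrow> w \<in> hor p \<Longrightarrow> g2 (F p) (push M1 M2 F p u) (push M1 M2 F p w) = g1 p u w"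
  using riemannian_map unfolding riemannian_map_def by blast

lemma range_eq: "rge p = push M1 M2 F p ` hor p"
  using riemannian_map unfolding riemannian_map_def by blast

lemma verD: "v \<in> ver p \<Longrightarrow> v \<in> tangent_space M1 p" "v \<in> ver p \<Longrightarrow> push M1 M2 F p v = 0"
  by (auto simp: ker_push_def)

lemma horD: "v \<in> hor p \<Longrightarrow> v \<in> tangent_space M1 p" "v \<in> hor p \<Longrightarrow> w \<in> ver p \<Longrightarrow> g1 p v w = 0"
  by (auto simp: ker_push_perp_def)

text \<open>A vector and some horizontal vector have the same image; their difference is vertical.\<close>

lemma hor_ver_decomposition: "src.fibre.orthogonal_decomposition p (hor p) (ver p)"
  unfolding src.fibre.orthogonal_decomposition_def
proof (intro conjI ballI)
  show "subspace (hor p)"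
    unfolding ker_push_perp_def
    by (rule subspaceI)
      (auto simp: verD src.fibre.zero_T src.fibre.add_T src.fibre.scale_T src.fibre.g_zero src.fibre.g_add src.fibre.g_scale)
  show "subspace (ver p)" by (rule subspace_ker_push)
  show "hor p \<subseteq> tangent_space M1 p" "ver p \<subseteq> tangent_space M1 p" using horD(1) verD(1) by blast+
  show "g1 p u v = 0" if "u \<in> hor p" "v \<in> ver p" for u v using horD(2) that .
  fix u assume u: "u \<in> tangent_space M1 p"
  then have "push M1 M2 F p u \<in> push M1 M2 F p ` hor p"
    unfolding range_eq[symmetric] by (simp add: range_push_def)
  then obtain x where x: "x \<in> hor p" "push M1 M2 F p u = push M1 M2 F p x" by blast
  have "u - x \<in> ver p"
    unfolding ker_push_def using x u horD(1)[OF x(1)] by (auto simp: push_diff src.fibre.diff_T)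
  then show "\<exists>x\<in>hor p. \<exists>y\<in>ver p. u = x + y" using x(1) by (intro bexI[of _ x] bexI[of _ "u - x"]) auto
qed

lemma hor_ver_split:
  assumes "u \<in> tangent_space M1 p"
  obtains x y where "x \<in> hor p" "y \<in> ver p" "u = x + y"
  using hor_ver_decomposition assms unfolding src.fibre.orthogonal_decomposition_def by blast

lemma subspace_hor: "subspace (hor p)"
  using hor_ver_decomposition unfolding src.fibre.orthogonal_decomposition_def by blast

lemma subspace_rge_perp: "subspace (rge_perp p)"
  unfolding range_push_perp_def range_push_def
  by (rule subspaceI) (auto simp: fibre.zero_T fibre.add_T fibre.scale_T fibre.g_zero fibre.g_add fibre.g_scale push_tangent)

text \<open>The vertical part of \<open>u\<close> is killed by \<open>F\<^sub>*\<close> and orthogonal to \<open>w\<close>.\<close>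

lemma push_horizontal_inner:
  assumes u: "u \<in> tangent_space M1 p" and w: "w \<in> hor p"
  shows "g2 (F p) (push M1 M2 F p u) (push M1 M2 F p w) = g1 p u w"
proof -
  obtain x y where xy: "x \<in> hor p" "y \<in> ver p" "u = x + y" by (rule hor_ver_split[OF u])
  note T = horD(1)[OF xy(1)] verD(1)[OF xy(2)] horD(1)[OF w]
  have "push M1 M2 F p u = push M1 M2 F p x" unfolding xy(3) by (simp add: push_add T verD(2)[OF xy(2)])
  moreover have "g1 p y w = 0" using horD(2)[OF w xy(2)] src.fibre.g_sym[of y p w] T by simp
  ultimately show ?thesis using isometry[OF xy(1) w] src.fibre.g_add[of x p y w] T xy(3) by simp
qed

subsection \<open>The second fundamental form\<close>

text \<open>The second fundamental form with only the value \<open>u\<close> at \<open>p\<close> in the first slot, where \<open>\<nabla>F\<^sub>*\<close> is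
  tensorial by definition.\<close>

definition sff :: "'m \<Rightarrow> ('m, 'a) tvec \<Rightarrow> ('m \<Rightarrow> ('m, 'a) tvec) \<Rightarrow> ('n, 'b) tvec" where
  "sff p u Y = nablaF p u (\<lambda>q. push M1 M2 F q (Y q)) - push M1 M2 F p (nabla1 p u Y)"

lemma second_fundamental_form_eq: "second_fundamental_form M1 M2 F nabla1 nablaF X Y p = sff p (X p) Y"
  by (simp add: second_fundamental_form_def sff_def)

lemma nabla1_tangent:
  assumes "open U" "vector_field M1 U Y" "p \<in> U" "u \<in> tangent_space M1 p"
  shows "nabla1 p u Y \<in> tangent_space M1 p"
  using src.conn_tangent[of U Y p u] assms by (simp add: vector_field_def)

lemma vector_field_tangent: "vector_field M1 U Y \<Longrightarrow> q \<in> U \<Longrightarrow> Y q \<in> tangent_space M1 q"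
  by (simp add: vector_field_iff)

lemma sff_tangent:
  assumes "open U" "vector_field M1 U Y" "p \<in> U" "u \<in> tangent_space M1 p"
  shows "sff p u Y \<in> tangent_space M2 (F p)"
  unfolding sff_def
  by (intro fibre.diff_T conn_tangent[OF assms(1) push_section[OF assms(1,2)] assms(3,4)] push_tangent nabla1_tangent[OF assms])

lemma sff_sum:
  assumes U: "open U" "vector_field M1 U Y" "p \<in> U" and v: "\<And>i. i \<in> I \<Longrightarrow> v i \<in> tangent_space M1 p"
  shows "sff p (\<Sum>i\<in>I. a i *\<^sub>R v i) Y = (\<Sum>i\<in>I. a i *\<^sub>R sff p (v i) Y)"
proof -
  have "nablaF p (\<Sum>i\<in>I. a i *\<^sub>R v i) (\<lambda>q. push M1 M2 F q (Y q)) =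
      (\<Sum>i\<in>I. a i *\<^sub>R nablaF p (v i) (\<lambda>q. push M1 M2 F q (Y q)))"
    by (rule conn_sum_vector[OF U(1) push_section[OF U(1,2)] U(3) v])
  moreover have "nabla1 p (\<Sum>i\<in>I. a i *\<^sub>R v i) Y = (\<Sum>i\<in>I. a i *\<^sub>R nabla1 p (v i) Y)"
    by (rule src.conn_sum_vector[OF U(1) U(2)[unfolded vector_field_def] U(3) v])
  moreover have "push M1 M2 F p (\<Sum>i\<in>I. a i *\<^sub>R nabla1 p (v i) Y) = (\<Sum>i\<in>I. a i *\<^sub>R push M1 M2 F p (nabla1 p (v i) Y))"
    by (rule push_sum[OF nabla1_tangent[OF U v]])
  ultimately show ?thesis unfolding sff_def by (simp only: scaleR_diff_right sum_subtractf)
qed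

lemma sff_symmetric:
  assumes U: "open U" "p \<in> U" and X: "vector_field M1 U X" and Y: "vector_field M1 U Y"
  shows "sff p (X p) Y = sff p (Y p) X"
proof -
  note T = nabla1_tangent[OF U(1) Y U(2) vector_field_tangent[OF X U(2)]]
    nabla1_tangent[OF U(1) X U(2) vector_field_tangent[OF Y U(2)]]
  have L: "nabla1 p (X p) Y - nabla1 p (Y p) X = lie_bracket M1 X Y p"
    using levi_civita1[unfolded levi_civita_def, THEN conjunct2, rule_format, of U X Y] U X Y by blast
  then have "lie_bracket M1 X Y p \<in> tangent_space M1 p" using src.fibre.diff_T[of _ p] T by metis
  from pullback_torsion_free[OF U X Y this]
  have "nablaF p (X p) (\<lambda>q. push M1 M2 F q (Y q)) - nablaF p (Y p) (\<lambda>q. push M1 M2 F q (X q)) =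
      push M1 M2 F p (nabla1 p (X p) Y) - push M1 M2 F p (nabla1 p (Y p) X)"
    unfolding L[symmetric] push_diff[OF T] .
  then show ?thesis unfolding sff_def by (rule diff_eq_diff_exchange)
qed

text \<open>The fields are expanded at the point only, first in one slot, then, after using the symmetry, in the
  other; the coefficients of the change of basis are never differentiated.\<close>

lemma sff_trace_unique:
  assumes U: "open U" "p \<in> U"
    and X: "\<And>i. i \<in> I \<Longrightarrow> vector_field M1 U (X i)" and Y: "\<And>j. j \<in> J \<Longrightarrow> vector_field M1 U (Y j)"
    and onX: "src.fibre.orthonormal p I (\<lambda>i. X i p)" and onY: "src.fibre.orthonormal p J (\<lambda>j. Y j p)"
    and span: "span ((\<lambda>i. X i p) ` I) = span ((\<lambda>j. Y j p) ` J)"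
  shows "(\<Sum>i\<in>I. sff p (X i p) (X i)) = (\<Sum>j\<in>J. sff p (Y j p) (Y j))"
proof -
  define a where "a = (\<lambda>i j. g1 p (X i p) (Y j p))"
  have XT: "X i p \<in> tangent_space M1 p" if "i \<in> I" for i using vector_field_tangent[OF X[OF that] U(2)] .
  have YT: "Y j p \<in> tangent_space M1 p" if "j \<in> J" for j using vector_field_tangent[OF Y[OF that] U(2)] .
  have Xe: "(\<Sum>j\<in>J. a i j *\<^sub>R Y j p) = X i p" if "i \<in> I" for i
    unfolding a_def using that span span_base[of "X i p" "(\<lambda>i. X i p) ` I"]
    by (intro src.fibre.orthonormal_expansion[OF onY, symmetric]) auto
  have Ye: "(\<Sum>i\<in>I. a i j *\<^sub>R X i p) = Y j p" if j: "j \<in> J" for j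
  proof -
    have "Y j p = (\<Sum>i\<in>I. g1 p (Y j p) (X i p) *\<^sub>R X i p)"
      using j span span_base[of "Y j p" "(\<lambda>j. Y j p) ` J"] by (intro src.fibre.orthonormal_expansion[OF onX]) auto
    also have "\<dots> = (\<Sum>i\<in>I. a i j *\<^sub>R X i p)"
      unfolding a_def by (intro sum.cong refl) (simp add: src.fibre.g_sym[OF YT[OF j] XT])
    finally show ?thesis ..
  qed
  have "(\<Sum>i\<in>I. sff p (X i p) (X i)) = (\<Sum>i\<in>I. \<Sum>j\<in>J. a i j *\<^sub>R sff p (Y j p) (X i))"
  proof (rule sum.cong[OF refl])
    fix i assume i: "i \<in> I"
    have "sff p (\<Sum>j\<in>J. a i j *\<^sub>R Y j p) (X i) = (\<Sum>j\<in>J. a i j *\<^sub>R sff p (Y j p) (X i))"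
      by (rule sff_sum[OF U(1) X[OF i] U(2) YT])
    then show "sff p (X i p) (X i) = (\<Sum>j\<in>J. a i j *\<^sub>R sff p (Y j p) (X i))" unfolding Xe[OF i] .
  qed
  also have "\<dots> = (\<Sum>j\<in>J. \<Sum>i\<in>I. a i j *\<^sub>R sff p (Y j p) (X i))" by (rule sum.swap)
  also have "\<dots> = (\<Sum>j\<in>J. \<Sum>i\<in>I. a i j *\<^sub>R sff p (X i p) (Y j))"
    by (intro sum.cong refl arg_cong2[where f = scaleR] sff_symmetric[OF U] X Y)
  also have "\<dots> = (\<Sum>j\<in>J. sff p (Y j p) (Y j))"
  proof (rule sum.cong[OF refl])
    fix j assume j: "j \<in> J"
    have "sff p (\<Sum>i\<in>I. a i j *\<^sub>R X i p) (Y j) = (\<Sum>i\<in>I. a i j *\<^sub>R sff p (X i p) (Y j))"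
      by (rule sff_sum[OF U(1) Y[OF j] U(2) XT])
    then show "(\<Sum>i\<in>I. a i j *\<^sub>R sff p (X i p) (Y j)) = sff p (Y j p) (Y j)" unfolding Ye[OF j] ..
  qed
  finally show ?thesis .
qed

text \<open>On horizontal fields \<open>F\<^sub>*\<close> preserves the inner product; the two sides are compared after differentiating
  \<open>g\<^sub>2(F\<^sub>*Y, F\<^sub>*Z) = g\<^sub>1(Y, Z)\<close> with the two metric connections.\<close>

lemma sff_skew:
  assumes U: "open U" "p \<in> U" and Y: "vector_field M1 U Y" "\<And>q. q \<in> U \<Longrightarrow> Y q \<in> hor q"
    and Z: "vector_field M1 U Z" "\<And>q. q \<in> U \<Longrightarrow> Z q \<in> hor q" and u: "u \<in> tangent_space M1 p"
  shows "g2 (F p) (sff p u Y) (push M1 M2 F p (Z p)) = - g2 (F p) (sff p u Z) (push M1 M2 F p (Y p))"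
proof -
  let ?P = "\<lambda>X q. push M1 M2 F q (X q)"
  note PY = push_section[OF U(1) Y(1)] and PZ = push_section[OF U(1) Z(1)]
  have PT: "push M1 M2 F p v \<in> tangent_space M2 (F p)" if "v \<in> tangent_space M1 p" for v using push_tangent that .
  note YT = vector_field_tangent[OF Y(1) U(2)] and ZT = vector_field_tangent[OF Z(1) U(2)]
  note nY = nabla1_tangent[OF U(1) Y(1) U(2) u] and nZ = nabla1_tangent[OF U(1) Z(1) U(2) u]
  note nPY = conn_tangent[OF U(1) PY U(2) u] and nPZ = conn_tangent[OF U(1) PZ U(2) u]
  have "vderiv M1 p u (\<lambda>q. g1 q (Y q) (Z q)) = vderiv M1 p u (\<lambda>q. g2 (F q) (?P Y q) (?P Z q))"
    by (rule vderiv_local(2)[OF U _ smooth_fn_mdiff[OF src.metric_smooth[OF U(1) Y(1) Z(1)] U(2)] u])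
      (simp add: isometry Y(2) Z(2))
  moreover have "vderiv M1 p u (\<lambda>q. g1 q (Y q) (Z q)) = g1 p (nabla1 p u Y) (Z p) + g1 p (Y p) (nabla1 p u Z)"
    using levi_civita1[unfolded levi_civita_def, THEN conjunct2, rule_format, of U Y Z] U Y(1) Z(1) u by blast
  moreover have "vderiv M1 p u (\<lambda>q. g2 (F q) (?P Y q) (?P Z q)) =
      g2 (F p) (nablaF p u (?P Y)) (?P Z p) + g2 (F p) (?P Y p) (nablaF p u (?P Z))"
    by (rule pullback_metric_compat[OF U PY PZ u])
  moreover have "g2 (F p) (sff p u Y) (?P Z p) = g2 (F p) (nablaF p u (?P Y)) (?P Z p) - g1 p (nabla1 p u Y) (Z p)"
    unfolding sff_def using fibre.g_diff[OF nPY PT[OF nY] PT[OF ZT]] push_horizontal_inner[OF nY Z(2)[OF U(2)]] by simp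
  moreover have "g2 (F p) (sff p u Z) (?P Y p) = g2 (F p) (?P Y p) (nablaF p u (?P Z)) - g1 p (Y p) (nabla1 p u Z)"
    unfolding sff_def using fibre.g_diff[OF nPZ PT[OF nZ] PT[OF YT]] push_horizontal_inner[OF nZ Y(2)[OF U(2)]]
      fibre.g_sym[OF nPZ PT[OF YT]] src.fibre.g_sym[of "nabla1 p u Z" p "Y p"] nZ YT by simp
  ultimately show ?thesis by linarith
qed

text \<open>Koszul's argument for \<open>S(X, Y, Z) = g\<^sub>2(\<nabla>F\<^sub>*(X, Y), F\<^sub>*Z)\<close>, symmetric in the first two slots and skew in the
  last two: \<open>S(X, X, Z) = - S(X, Z, X) = - S(Z, X, X)\<close>, and the last term vanishes by skewness.\<close>

lemma sff_horizontal_orthogonal: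
  assumes U: "open U" "p \<in> U" and X: "vector_field M1 U X" "\<And>q. q \<in> U \<Longrightarrow> X q \<in> hor q"
    and Z: "vector_field M1 U Z" "\<And>q. q \<in> U \<Longrightarrow> Z q \<in> hor q"
  shows "g2 (F p) (sff p (X p) X) (push M1 M2 F p (Z p)) = 0"
proof -
  note XT = vector_field_tangent[OF X(1) U(2)] and ZT = vector_field_tangent[OF Z(1) U(2)]
  have "g2 (F p) (sff p (X p) X) (push M1 M2 F p (Z p)) = - g2 (F p) (sff p (X p) Z) (push M1 M2 F p (X p))"
    by (rule sff_skew[OF U X Z XT])
  also have "sff p (X p) Z = sff p (Z p) X" by (rule sff_symmetric[OF U X(1) Z(1)])
  also have "g2 (F p) (sff p (Z p) X) (push M1 M2 F p (X p)) = 0"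
    using sff_skew[OF U X X ZT] by simp
  finally show ?thesis by simp
qed

subsection \<open>The fibres are minimal\<close>

lemma J1_tensor: "tensor_1_1 M1 J1" and J1_square: "v \<in> tangent_space M1 p \<Longrightarrow> J1 p (J1 p v) = - v"
  and J1_isometry: "v \<in> tangent_space M1 p \<Longrightarrow> w \<in> tangent_space M1 p \<Longrightarrow> g1 p (J1 p v) (J1 p w) = g1 p v w"
  using kaehler by (auto simp: kaehler_manifold_def almost_hermitian_manifold_def)

lemma J2_square: "v \<in> tangent_space M2 y \<Longrightarrow> J2 y (J2 y v) = - v"
  using hermitian by (auto simp: almost_hermitian_manifold_def)

lemma J1_parallel:
  assumes "open U" "vector_field M1 U Y" "p \<in> U" "v \<in> tangent_space M1 p"
  shows "nabla1 p v (\<lambda>q. J1 q (Y q)) = J1 p (nabla1 p v Y)"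
  using kaehler[unfolded kaehler_manifold_def, THEN conjunct2, THEN conjunct2, rule_format, of U Y p v] assms by simp

lemmas J1_tangent = J1_tensor[unfolded tensor_1_1_def, THEN conjunct1, rule_format]
  and J1_linear = J1_tensor[unfolded tensor_1_1_def, THEN conjunct2, THEN conjunct1, rule_format]

lemma J1_vector_field: "open U \<Longrightarrow> vector_field M1 U X \<Longrightarrow> vector_field M1 U (\<lambda>q. J1 q (X q))"
  using J1_tensor[unfolded tensor_1_1_def, THEN conjunct2, THEN conjunct2, rule_format, of U X] by simp

lemma J1_zero: "J1 p 0 = 0"
proof -
  have "0 \<in> tangent_space M1 p" by (rule subspace_0[OF subspace_tangent_space])
  from J1_linear[OF this this, of 0 0] show ?thesis by (simp only: scaleR_zero_left add_0_left)
qed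

lemma J1_sum:
  assumes "\<And>i. i \<in> I \<Longrightarrow> v i \<in> tangent_space M1 p"
  shows "J1 p (\<Sum>i\<in>I. a i *\<^sub>R v i) = (\<Sum>i\<in>I. a i *\<^sub>R J1 p (v i))"
  using assms
proof (induction I rule: infinite_finite_induct)
  case (insert i I)
  have "(\<Sum>i\<in>I. a i *\<^sub>R v i) \<in> tangent_space M1 p"
    using insert.prems subspace_tangent_space by (intro subspace_sum subspace_scale) auto
  then have "J1 p (a i *\<^sub>R v i + 1 *\<^sub>R (\<Sum>i\<in>I. a i *\<^sub>R v i)) = a i *\<^sub>R J1 p (v i) + 1 *\<^sub>R J1 p (\<Sum>i\<in>I. a i *\<^sub>R v i)"
    using insert.prems by (intro J1_linear) auto
  moreover have "J1 p (\<Sum>i\<in>I. a i *\<^sub>R v i) = (\<Sum>i\<in>I. a i *\<^sub>R J1 p (v i))" using insert by auto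
  ultimately show ?case by (simp only: sum.insert[OF insert.hyps] scaleR_one)
next
  case empty
  show ?case by (simp only: sum.empty J1_zero)
next
  case (infinite I)
  show ?case by (simp only: sum.infinite[OF infinite.hyps] J1_zero)
qed

lemma push_J: "v \<in> tangent_space M1 p \<Longrightarrow> push M1 M2 F p (J1 p v) = J2 (F p) (push M1 M2 F p v)"
  using holomorphic unfolding holomorphic_riemannian_map_def by metis

lemma J1_ver: assumes "v \<in> ver p" shows "J1 p v \<in> ver p"
proof -
  note T = verD(1)[OF assms]
  have "push M1 M2 F p (J1 p 0) = J2 (F p) (push M1 M2 F p 0)"
    by (rule push_J[OF subspace_0[OF subspace_tangent_space]])
  then have "J2 (F p) 0 = 0" by (simp only: J1_zero push_zero)
  then show ?thesis unfolding ker_push_def using T verD(2)[OF assms] by (simp add: push_J J1_tangent)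
qed

text \<open>For a vertical field, \<open>\<nabla>F\<^sub>*(V, V) = - F\<^sub>*(\<nabla>\<^sub>V V)\<close>; since \<open>J\<close> is parallel and \<open>F\<^sub>*\<close> intertwines the almost
  complex structures, replacing \<open>V\<close> by \<open>J V\<close> gives \<open>J\<^sub>2\<^sup>2\<close> of the same vector.\<close>

lemma sff_vertical_J:
  assumes U: "open U" "p \<in> U" and V: "vector_field M1 U V" "\<And>q. q \<in> U \<Longrightarrow> V q \<in> ver q"
  shows "sff p (J1 p (V p)) (\<lambda>q. J1 q (V q)) = - sff p (V p) V"
proof -
  let ?JV = "\<lambda>q. J1 q (V q)"
  note JV = J1_vector_field[OF U(1) V(1)]
  note VT = vector_field_tangent[OF V(1) U(2)] and JVT = J1_tangent[OF vector_field_tangent[OF V(1) U(2)]]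
  have vertical: "sff p u W = - push M1 M2 F p (nabla1 p u W)"
    if W: "vector_field M1 U W" "\<And>q. q \<in> U \<Longrightarrow> W q \<in> ver q" and u: "u \<in> tangent_space M1 p" for u W
  proof -
    have "nablaF p u (\<lambda>q. push M1 M2 F q (W q)) = nablaF p u (\<lambda>q. 0)"
      by (rule conn_local[OF U push_section[OF U(1) W(1)] verD(2)[OF W(2)] u])
    then show ?thesis by (simp only: sff_def conn_zero[OF u] diff_0)
  qed
  note nVV = nabla1_tangent[OF U(1) V(1) U(2) VT] and nJV = nabla1_tangent[OF U(1) V(1) U(2) JVT]
  have "push M1 M2 F p (nabla1 p (J1 p (V p)) V) = push M1 M2 F p (nabla1 p (V p) ?JV)"
    using sff_symmetric[OF U JV V(1)] vertical[OF V JVT] vertical[OF JV J1_ver[OF V(2)] VT]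
    by (simp only: neg_equal_iff_equal)
  also have "\<dots> = J2 (F p) (push M1 M2 F p (nabla1 p (V p) V))"
    by (simp only: J1_parallel[OF U(1) V(1) U(2) VT] push_J[OF nVV])
  finally have "push M1 M2 F p (nabla1 p (J1 p (V p)) ?JV) = J2 (F p) (J2 (F p) (push M1 M2 F p (nabla1 p (V p) V)))"
    by (simp only: J1_parallel[OF U(1) V(1) U(2) JVT] push_J[OF nJV])
  also have "\<dots> = - push M1 M2 F p (nabla1 p (V p) V)" by (rule J2_square[OF push_tangent[OF nVV]])
  finally show ?thesis by (simp only: vertical[OF JV J1_ver[OF V(2)] JVT] vertical[OF V VT])
qed

text \<open>The frames \<open>v\<^sub>b\<close> and \<open>J\<^sub>1 v\<^sub>b\<close> of the kernel give the same trace and opposite traces.\<close>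

lemma sff_vertical_trace:
  assumes U: "open U" "p \<in> U" and v: "orthonormal_frame M1 M1 g1 id ver U l v"
  shows "(\<Sum>b<l. sff p (v b p) (v b)) = 0"
proof -
  have vf: "vector_field M1 U (v b)" if "b < l" for b
    using v that by (simp add: orthonormal_frame_def vector_field_def)
  have on: "src.fibre.orthonormal p {..<l} (\<lambda>b. v b p)"
    using v U by (simp add: src.orthonormal_frame_iff src.orthonormal_sections_def)
  have span: "span ((\<lambda>b. v b q) ` {..<l}) = ver q" if "q \<in> U" for q
    using v that by (simp add: orthonormal_frame_def)
  have ver: "v b q \<in> ver q" if "b < l" "q \<in> U" for b q
    unfolding span[OF that(2), symmetric] using that by (intro span_base) auto
  have JT: "J1 p (v b p) \<in> tangent_space M1 p" if "b < l" for b
    using J1_tangent[OF verD(1)[OF ver[OF that U(2)]]] .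
  have onJ: "src.fibre.orthonormal p {..<l} (\<lambda>b. J1 p (v b p))"
    using on JT unfolding src.fibre.orthonormal_def by (auto simp: J1_isometry)
  have "span ((\<lambda>b. J1 p (v b p)) ` {..<l}) = ver p"
  proof
    show "span ((\<lambda>b. J1 p (v b p)) ` {..<l}) \<subseteq> ver p"
      using J1_ver[OF ver[OF _ U(2)]] by (intro span_minimal subspace_ker_push) auto
    show "ver p \<subseteq> span ((\<lambda>b. J1 p (v b p)) ` {..<l})"
    proof
      fix u assume u: "u \<in> ver p"
      have uT: "u \<in> tangent_space M1 p" by (rule verD(1)[OF u])
      have "J1 p u \<in> span ((\<lambda>b. v b p) ` {..<l})" unfolding span[OF U(2)] by (rule J1_ver[OF u])
      then obtain a where a: "J1 p u = (\<Sum>b<l. a b *\<^sub>R v b p)" by (rule span_image_coefficients) simp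
      have "- u = J1 p (J1 p u)" by (rule J1_square[OF uT, symmetric])
      also have "\<dots> = (\<Sum>b<l. a b *\<^sub>R J1 p (v b p))"
        unfolding a by (rule J1_sum) (use verD(1)[OF ver[OF _ U(2)]] in simp)
      also have "\<dots> \<in> span ((\<lambda>b. J1 p (v b p)) ` {..<l})" by (rule sum_in_span)
      finally have "- (- u) \<in> span ((\<lambda>b. J1 p (v b p)) ` {..<l})" by (rule span_neg)
      then show "u \<in> span ((\<lambda>b. J1 p (v b p)) ` {..<l})" by (simp only: minus_minus)
    qed
  qed
  then have "(\<Sum>b<l. sff p (v b p) (v b)) = (\<Sum>b<l. sff p (J1 p (v b p)) (\<lambda>q. J1 q (v b q)))"
    using span[OF U(2)] vf J1_vector_field[OF U(1) vf] on onJ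
    by (intro sff_trace_unique[OF U, where X = v and Y = "\<lambda>b q. J1 q (v b q)"]) auto
  also have "\<dots> = - (\<Sum>b<l. sff p (v b p) (v b))"
    using sff_vertical_J[OF U vf ver] by (simp add: sum_negf)
  finally have "(\<Sum>b<l. sff p (v b p) (v b)) + (\<Sum>b<l. sff p (v b p) (v b)) = 0" by (simp only: eq_neg_iff_add_eq_0)
  then have "2 *\<^sub>R (\<Sum>b<l. sff p (v b p) (v b)) = 0" by (simp only: scaleR_2)
  then show ?thesis by simp
qed

subsection \<open>The tension field and the mean curvature\<close>

text \<open>The tension splits into the traces over \<open>(ker F\<^sub>*)\<^sup>\<bottom>\<close> and \<open>ker F\<^sub>*\<close>. The second one vanishes; the first one
  lies in \<open>(range F\<^sub>*)\<^sup>\<bottom>\<close>, and there the terms \<open>F\<^sub>*(\<nabla>\<^sub>e e)\<close> do not contribute to the components.\<close>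

lemma tension_eq_mean_curvature:
  assumes U: "open U" "p \<in> U"
    and E: "orthonormal_frame M1 M1 g1 id (tangent_space M1) U n E"
    and e: "orthonormal_frame M1 M1 g1 id hor U k e"
    and v: "orthonormal_frame M1 M1 g1 id ver U l v"
    and mu: "orthonormal_frame M1 M2 g2 F rge_perp U m mu"
  shows "tension M1 M2 F nabla1 nablaF n E p = mean_curvature M1 M2 g2 F nablaF k e m mu p"
proof -
  have vf: "vector_field M1 U (X i)" if "orthonormal_frame M1 M1 g1 id D U n X" "i < n" for D n X i
    using that by (simp add: orthonormal_frame_def vector_field_def)
  have on: "src.fibre.orthonormal q {..<n} (\<lambda>i. X i q)" if "orthonormal_frame M1 M1 g1 id D U n X" "q \<in> U" for D n X q
    using that by (simp add: src.orthonormal_frame_iff src.orthonormal_sections_def)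
  have span: "span ((\<lambda>i. X i q) ` {..<n}) = D q" if "orthonormal_frame M1 M1 g1 id D U n X" "q \<in> U" for D n X q
    using that by (simp add: orthonormal_frame_def)
  have mem: "X i q \<in> D q" if "orthonormal_frame M1 M1 g1 id D U n X" "q \<in> U" "i < n" for D n X q i
    unfolding span[OF that(1,2), symmetric] using that by (intro span_base) auto
  let ?w = "case_sum (\<lambda>i. e i p) (\<lambda>j. v j p)"
  define w where "w = case_sum e v" \<comment> \<open>the two frames joined to one of the tangent bundle\<close>
  have w: "(\<lambda>s. w s p) = ?w" by (auto simp: w_def fun_eq_iff split: sum.split)
  have sub: "(\<lambda>i. e i p) ` {..<k} \<subseteq> hor p" "(\<lambda>j. v j p) ` {..<l} \<subseteq> ver p"
    using mem[OF e U(2)] mem[OF v U(2)] by auto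
  have "tension M1 M2 F nabla1 nablaF n E p = (\<Sum>i<n. sff p (E i p) (E i))"
    by (simp add: tension_def second_fundamental_form_eq)
  also have "\<dots> = (\<Sum>s\<in>{..<k} <+> {..<l}. sff p (w s p) (w s))"
  proof (rule sff_trace_unique[OF U, where X = E and Y = w])
    show "vector_field M1 U (E i)" if "i \<in> {..<n}" for i using vf[OF E] that by simp
    show "vector_field M1 U (w s)" if "s \<in> {..<k} <+> {..<l}" for s
      using that vf[OF e] vf[OF v] by (auto simp: w_def)
    show "src.fibre.orthonormal p {..<n} (\<lambda>i. E i p)" by (rule on[OF E U(2)])
    show "src.fibre.orthonormal p ({..<k} <+> {..<l}) (\<lambda>s. w s p)"
      \<comment> \<open>simplification turns the base point \<open>id p\<close> into \<open>p\<close>\<close>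
      unfolding w by (rule src.fibre.orthonormal_decomposition_Plus[of p, simplified, OF hor_ver_decomposition on[OF e U(2)] on[OF v U(2)] sub])
    have "span (?w ` ({..<k} <+> {..<l})) = tangent_space M1 p"
      by (rule src.fibre.orthonormal_decomposition_spans[of p, simplified, OF hor_ver_decomposition on[OF e U(2)] on[OF v U(2)]
            span[OF e U(2)] span[OF v U(2)]])
    then show "span ((\<lambda>i. E i p) ` {..<n}) = span ((\<lambda>s. w s p) ` ({..<k} <+> {..<l}))"
      unfolding w span[OF E U(2)] ..
  qed
  also have "\<dots> = (\<Sum>a<k. sff p (e a p) (e a)) + (\<Sum>b<l. sff p (v b p) (v b))"
    by (simp only: sum.Plus[OF finite_lessThan finite_lessThan] o_def w_def sum.case)
  also have "(\<Sum>b<l. sff p (v b p) (v b)) = 0" by (rule sff_vertical_trace[OF U v])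
  finally have tension: "tension M1 M2 F nabla1 nablaF n E p = (\<Sum>a<k. sff p (e a p) (e a))"
    by (simp only: add_0_right)
  have eT: "e a p \<in> tangent_space M1 p" if "a < k" for a using horD(1)[OF mem[OF e U(2) that]] .
  have sT: "sff p (e a p) (e a) \<in> tangent_space M2 (F p)" if "a < k" for a
    by (rule sff_tangent[OF U(1) vf[OF e that] U(2) eT[OF that]])
  have onmu: "fibre.orthonormal (F p) {..<m} (\<lambda>s. mu s p)" and spanmu: "span ((\<lambda>s. mu s p) ` {..<m}) = rge_perp p"
    using mu U(2) by (auto simp: orthonormal_frame_iff orthonormal_sections_def)
  have muR: "mu s p \<in> rge_perp p" if "s < m" for s
    unfolding spanmu[symmetric] using that by (intro span_base) auto
  have muT: "mu s p \<in> tangent_space M2 (F p)" and mu0: "\<And>u. u \<in> tangent_space M1 p \<Longrightarrow> g2 (F p) (push M1 M2 F p u) (mu s p) = 0"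
    if "s < m" for s
  proof -
    show T: "mu s p \<in> tangent_space M2 (F p)" using muR[OF that] by (simp add: range_push_perp_def)
    fix u assume u: "u \<in> tangent_space M1 p"
    have "g2 (F p) (mu s p) (push M1 M2 F p u) = 0"
      using muR[OF that] u by (auto simp: range_push_perp_def range_push_def)
    then show "g2 (F p) (push M1 M2 F p u) (mu s p) = 0" using fibre.g_sym[OF T push_tangent[OF u]] by simp
  qed
  have perp: "sff p (e a p) (e a) \<in> rge_perp p" if a: "a < k" for a
    unfolding range_push_perp_def
  proof (intro CollectI conjI ballI)
    show "sff p (e a p) (e a) \<in> tangent_space M2 (F p)" by (rule sT[OF a])
    fix y assume "y \<in> rge p"
    then obtain z where z: "z \<in> hor p" "y = push M1 M2 F p z" unfolding range_eq by blast
    then have "z \<in> span ((\<lambda>i. e i p) ` {..<k})" using span[OF e U(2)] by simp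
    then obtain c where c: "z = (\<Sum>b<k. c b *\<^sub>R e b p)" by (rule span_image_coefficients) simp
    have "y = (\<Sum>b<k. c b *\<^sub>R push M1 M2 F p (e b p))" unfolding z(2) c by (rule push_sum) (use eT in simp)
    moreover have "g2 (F p) (sff p (e a p) (e a)) (\<Sum>b<k. c b *\<^sub>R push M1 M2 F p (e b p)) =
        (\<Sum>b<k. c b * g2 (F p) (sff p (e a p) (e a)) (push M1 M2 F p (e b p)))"
      by (rule fibre.g_sum_scale_right[OF push_tangent sT[OF a]]) (use eT in simp)
    moreover have "\<dots> = 0"
      using sff_horizontal_orthogonal[OF U vf[OF e a] mem[OF e _ a] vf[OF e] mem[OF e]] by (intro sum.neutral) simp
    ultimately show "g2 (F p) (sff p (e a p) (e a)) y = 0" by simp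
  qed
  have comp: "g2 (F p) (nablaF p (e a p) (\<lambda>q. push M1 M2 F q (e a q))) (mu s p) = g2 (F p) (sff p (e a p) (e a)) (mu s p)"
    if a: "a < k" and s: "s < m" for a s
  proof -
    note nT = nabla1_tangent[OF U(1) vf[OF e a] U(2) eT[OF a]]
    note cT = conn_tangent[OF U(1) push_section[OF U(1) vf[OF e a]] U(2) eT[OF a]]
    show ?thesis
      unfolding sff_def using fibre.g_diff[OF cT push_tangent[OF nT] muT[OF s]] mu0[OF s nT] by simp
  qed
  let ?H = "\<Sum>a<k. sff p (e a p) (e a)"
  have "?H \<in> span ((\<lambda>s. mu s p) ` {..<m})"
    unfolding spanmu using perp by (intro subspace_sum subspace_rge_perp) simp
  from fibre.orthonormal_expansion[OF onmu this]
  have "?H = (\<Sum>s<m. g2 (F p) ?H (mu s p) *\<^sub>R mu s p)" .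
  also have "\<dots> = (\<Sum>s<m. (\<Sum>a<k. g2 (F p) (nablaF p (e a p) (\<lambda>q. push M1 M2 F q (e a q))) (mu s p)) *\<^sub>R mu s p)"
  proof (rule sum.cong[OF refl])
    fix s assume "s \<in> {..<m}"
    then have s: "s < m" by simp
    have "g2 (F p) ?H (mu s p) = (\<Sum>a<k. g2 (F p) (sff p (e a p) (e a)) (mu s p))"
      using sT by (intro fibre.g_sum muT[OF s]) simp
    also have "\<dots> = (\<Sum>a<k. g2 (F p) (nablaF p (e a p) (\<lambda>q. push M1 M2 F q (e a q))) (mu s p))"
      using comp[OF _ s] by (intro sum.cong refl) simp
    finally show "g2 (F p) ?H (mu s p) *\<^sub>R mu s p =
        (\<Sum>a<k. g2 (F p) (nablaF p (e a p) (\<lambda>q. push M1 M2 F q (e a q))) (mu s p)) *\<^sub>R mu s p"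
      by (rule arg_cong[where f = "\<lambda>x. x *\<^sub>R mu s p"])
  qed
  finally show ?thesis unfolding tension mean_curvature_def .
qed

subsection \<open>Existence of adapted frames\<close>

text \<open>Gram-Schmidt is applied to the horizontal and to the vertical parts of an orthonormal frame \<open>E\<close>.\<close>

lemma hor_ver_frames_exist:
  assumes U: "open U" "p \<in> U"
  shows "\<exists>U' k e l v. open U' \<and> p \<in> U' \<and> U' \<subseteq> U \<and> orthonormal_frame M1 M1 g1 id hor U' k e \<and>
    orthonormal_frame M1 M1 g1 id ver U' l v"
proof -
  obtain c where c: "c \<in> charts_at M1 p" using chart_at_exists by blast
  obtain d where d: "d \<in> charts_at M2 (F p)" using cod.chart_at_exists by blast
  note C = charts_atD[OF c] and D = cod.charts_atD[OF d]
  define U0 where "U0 = U \<inter> fst c \<inter> F -` fst d"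
  have U0: "open U0" "p \<in> U0"
    using U C D preimage_open[OF cod.chart_open[OF D(1)]] chart_open[OF C(1)] by (auto simp: U0_def)
  obtain U1 n E where U1: "open U1" "p \<in> U1" "U1 \<subseteq> U0"
    and E: "orthonormal_frame M1 M1 g1 id (\<lambda>q. tangent_space M1 (id q)) U1 n E"
    using src.orthonormal_frame_exists[OF U0] by (elim exE conjE) (rule that)
  have U1s: "U1 \<subseteq> U" "U1 \<subseteq> id -` fst c" "U1 \<subseteq> F -` fst d" using U1(3) by (auto simp: U0_def)
  have Evf: "vector_field M1 U1 (E i)" if "i < n" for i
    using E that by (simp add: orthonormal_frame_def vector_field_def)
  have Eon: "src.fibre.orthonormal q {..<n} (\<lambda>i. E i q)" if "q \<in> U1" for q
    using E that by (simp add: src.orthonormal_frame_iff src.orthonormal_sections_def)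
  have Espan: "span ((\<lambda>i. E i q) ` {..<n}) = tangent_space M1 q" if "q \<in> U1" for q
    using E that by (simp add: orthonormal_frame_def)
  have ET: "E i q \<in> tangent_space M1 q" if "i < n" "q \<in> U1" for i q
    using vector_field_tangent[OF Evf[OF that(1)] that(2)] .
  \<comment> \<open>the horizontal part of \<open>E i\<close>: its coefficient along \<open>E j\<close> equals the inner product of the images\<close>
  define P where "P = (\<lambda>i q. \<Sum>j<n. g2 (F q) (push M1 M2 F q (E i q)) (push M1 M2 F q (E j q)) *\<^sub>R E j q)"
  have Psec: "section_along M1 M1 id U1 (P i)" if "i < n" for i
    unfolding P_def
    by (intro src.section_combination U1(1) smooth_fn_metric[OF U1(1) U1s(3) D(1)] push_section[OF U1(1)] Evf)
      (use that Evf in \<open>auto simp: vector_field_def\<close>)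
  have Esec: "section_along M1 M1 id U1 (E i)" if "i < n" for i using Evf[OF that] by (simp add: vector_field_def)
  have P: "P i q \<in> hor q" "E i q - P i q \<in> ver q" if i: "i < n" and q: "q \<in> U1" for i q
  proof -
    obtain x y where xy: "x \<in> hor q" "y \<in> ver q" "E i q = x + y" by (rule hor_ver_split[OF ET[OF i q]])
    note xT = horD(1)[OF xy(1)] and yT = verD(1)[OF xy(2)]
    have px: "push M1 M2 F q (E i q) = push M1 M2 F q x"
      unfolding xy(3) by (simp add: push_add xT yT verD(2)[OF xy(2)])
    have "g2 (F q) (push M1 M2 F q (E i q)) (push M1 M2 F q (E j q)) = g1 q x (E j q)" if j: "j < n" for j
      unfolding px
      using push_horizontal_inner[OF ET[OF j q] xy(1)] fibre.g_sym[OF push_tangent[OF xT] push_tangent[OF ET[OF j q]]]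
        src.fibre.g_sym[of x q "E j q"] xT ET[OF j q] by simp
    then have "P i q = (\<Sum>j<n. g1 q x (E j q) *\<^sub>R E j q)" unfolding P_def by (intro sum.cong refl) simp
    also have "\<dots> = x"
      by (rule src.fibre.orthonormal_expansion[of q, simplified, OF Eon[OF q], symmetric]) (simp add: Espan[OF q] xT)
    finally show "P i q \<in> hor q" "E i q - P i q \<in> ver q" using xy by simp_all
  qed
  have Qsec: "section_along M1 M1 id U1 (\<lambda>q. E i q - P i q)" if "i < n" for i
    by (rule src.section_diff[OF U1(1) Esec[OF that] Psec[OF that]])
  obtain U2 k e where U2: "open U2" "p \<in> U2" "U2 \<subseteq> U1" and e: "src.orthonormal_sections U2 k e"
    and emem: "\<forall>q\<in>U2. \<forall>a<k. e a q \<in> span ((\<lambda>i. P i q) ` {..<n})"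
    and espan: "span ((\<lambda>a. e a p) ` {..<k}) = span ((\<lambda>i. P i p) ` {..<n})"
    by (rule src.gram_schmidt[OF U1(1,2) U1s(2) C(1), where V = P and n = n], erule Psec) (rule that)
  have U2c: "U2 \<subseteq> id -` fst c" using U2(3) U1s(2) by blast
  obtain U3 l v where U3: "open U3" "p \<in> U3" "U3 \<subseteq> U2" and v: "src.orthonormal_sections U3 l v"
    and vmem: "\<forall>q\<in>U3. \<forall>a<l. v a q \<in> span ((\<lambda>i. E i q - P i q) ` {..<n})"
    and vspan: "span ((\<lambda>a. v a p) ` {..<l}) = span ((\<lambda>i. E i p - P i p) ` {..<n})"
    by (rule src.gram_schmidt[OF U2(1,2) U2c C(1), where V = "\<lambda>i q. E i q - P i q" and n = n],
        erule src.section_subset[OF Qsec U2(3)]) (rule that)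
  have e3: "src.orthonormal_sections U3 k e" by (rule src.orthonormal_sections_subset[OF e U3(3)])
  have sub: "U3 \<subseteq> U1" "U3 \<subseteq> U" using U3(3) U2(3) U1s(1) by auto
  have ehor: "e a q \<in> hor q" if "q \<in> U3" "a < k" for q a
  proof -
    have "span ((\<lambda>i. P i q) ` {..<n}) \<subseteq> hor q"
      using P(1) that(1) sub(1) by (intro span_minimal subspace_hor) auto
    then show ?thesis using emem that U3(3) by blast
  qed
  have vver: "v a q \<in> ver q" if "q \<in> U3" "a < l" for q a
  proof -
    have "span ((\<lambda>i. E i q - P i q) ` {..<n}) \<subseteq> ver q"
      using P(2) that(1) sub(1) by (intro span_minimal subspace_ker_push) auto
    then show ?thesis using vmem that by blast
  qed
  have sp: "span ((\<lambda>i. P i p) ` {..<n}) = hor p" "span ((\<lambda>i. E i p - P i p) ` {..<n}) = ver p"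
    using src.fibre.orthogonal_decomposition_components_span[of p, simplified, OF hor_ver_decomposition,
        of "{..<n}" "\<lambda>i. P i p" "\<lambda>i. E i p - P i p" "\<lambda>i. E i p"]
      src.fibre.orthogonal_decomposition_components_span[of p, simplified, OF
        src.fibre.orthogonal_decomposition_swap[of p, simplified, OF hor_ver_decomposition],
        of "{..<n}" "\<lambda>i. E i p - P i p" "\<lambda>i. P i p" "\<lambda>i. E i p"]
      P[OF _ U1(2)] Espan[OF U1(2)] by auto
  have dec: "src.fibre.orthogonal_decomposition (id q) (hor q) (ver q)" for q
    using hor_ver_decomposition by simp
  have "span ((\<lambda>a. e a q) ` {..<k}) = hor q" "span ((\<lambda>a. v a q) ` {..<l}) = ver q" if q: "q \<in> U3" for q
    using src.complementary_sections_span[where D = hor and D' = ver, OF dec e3 v ehor vver U3(2) _ _ q] espan vspan sp by auto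
  then have "orthonormal_frame M1 M1 g1 id hor U3 k e" "orthonormal_frame M1 M1 g1 id ver U3 l v"
    using e3 v by (auto simp: src.orthonormal_frame_iff)
  then show ?thesis using U3(1,2) sub(2) by (intro exI conjI)
qed

text \<open>The images of a horizontal orthonormal frame are an orthonormal frame of \<open>range F\<^sub>*\<close>; removing from the
  coordinate sections their components along it leaves sections that span \<open>(range F\<^sub>*)\<^sup>\<bottom>\<close>.\<close>

lemma rge_perp_frame_exists:
  assumes U: "open U" "p \<in> U" and e: "orthonormal_frame M1 M1 g1 id hor U k e"
  shows "\<exists>U' m mu. open U' \<and> p \<in> U' \<and> U' \<subseteq> U \<and> orthonormal_frame M1 M2 g2 F rge_perp U' m mu"
proof -
  obtain d where d: "d \<in> charts_at M2 (F p)" using cod.chart_at_exists by blast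
  note D = cod.charts_atD[OF d]
  define U0 where "U0 = U \<inter> F -` fst d"
  have U0: "open U0" "p \<in> U0" "U0 \<subseteq> F -` fst d" "U0 \<subseteq> U"
    using U D preimage_open[OF cod.chart_open[OF D(1)]] by (auto simp: U0_def)
  have evf: "vector_field M1 U0 (e a)" if "a < k" for a
    using e that src.section_subset[OF _ U0(4)] by (simp add: orthonormal_frame_def vector_field_def)
  have espan: "span ((\<lambda>a. e a q) ` {..<k}) = hor q" if "q \<in> U" for q
    using e that by (simp add: orthonormal_frame_def)
  have ehor: "e a q \<in> hor q" if "a < k" "q \<in> U" for a q
    unfolding espan[OF that(2), symmetric] using that by (intro span_base) auto
  define f where "f = (\<lambda>a q. push M1 M2 F q (e a q))"
  have fsec: "section_along M1 M2 F U0 (f a)" if "a < k" for a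
    unfolding f_def by (rule push_section[OF U0(1) evf[OF that]])
  have fon: "orthonormal_sections U0 k f"
    unfolding orthonormal_sections_def fibre.orthonormal_def
  proof (intro conjI ballI allI impI)
    show "section_along M1 M2 F U0 (f a)" if "a < k" for a by (rule fsec[OF that])
    fix q assume q: "q \<in> U0"
    show "f a q \<in> tangent_space M2 (F q)" if "a \<in> {..<k}" for a using section_tangent[OF fsec q] that by simp
    show "g2 (F q) (f a q) (f b q) = (if a = b then 1 else 0)" if "a \<in> {..<k}" "b \<in> {..<k}" for a b
    proof -
      have "g2 (F q) (f a q) (f b q) = g1 q (e a q) (e b q)"
        unfolding f_def using that q U0(4) by (intro isometry ehor) auto
      then show ?thesis using e that q U0(4) by (auto simp: orthonormal_frame_def)
    qed
  qed simp
  have fspan: "span ((\<lambda>a. f a q) ` {..<k}) = rge q" if q: "q \<in> U0" for q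
  proof
    have qU: "q \<in> U" using q U0(4) by blast
    have "rge q \<subseteq> span ((\<lambda>a. f a q) ` {..<k})"
    proof
      fix y assume "y \<in> rge q"
      then obtain z where z: "z \<in> hor q" "y = push M1 M2 F q z" unfolding range_eq by blast
      then have "z \<in> span ((\<lambda>i. e i q) ` {..<k})" using espan[OF qU] by simp
      then obtain c where c: "z = (\<Sum>b<k. c b *\<^sub>R e b q)" by (rule span_image_coefficients) simp
      have "y = (\<Sum>b<k. c b *\<^sub>R f b q)"
        unfolding z(2) c f_def by (rule push_sum) (use horD(1)[OF ehor[OF _ qU]] in simp)
      then show "y \<in> span ((\<lambda>a. f a q) ` {..<k})" by (simp only: sum_in_span)
    qed
    then show "rge q \<subseteq> span ((\<lambda>a. f a q) ` {..<k})" .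
    show "span ((\<lambda>a. f a q) ` {..<k}) \<subseteq> rge q"
    proof
      fix y assume "y \<in> span ((\<lambda>a. f a q) ` {..<k})"
      then obtain c where "y = (\<Sum>b<k. c b *\<^sub>R f b q)" by (rule span_image_coefficients) simp
      also have "\<dots> = push M1 M2 F q (\<Sum>b<k. c b *\<^sub>R e b q)"
        unfolding f_def by (rule push_sum[symmetric]) (use horD(1)[OF ehor[OF _ qU]] in simp)
      finally show "y \<in> rge q"
        unfolding range_push_def using horD(1)[OF ehor[OF _ qU]]
        by (auto intro!: imageI subspace_sum subspace_scale subspace_tangent_space)
    qed
  qed
  have fonq: "fibre.orthonormal (F q) {..<k} (\<lambda>a. f a q)" if "q \<in> U0" for q
    using fon that by (simp add: orthonormal_sections_def)
  have dec: "fibre.orthogonal_decomposition (F q) (rge q) (rge_perp q)" if q: "q \<in> U0" for q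
    using fibre.orthogonal_decomposition_complement[OF fonq[OF q] fspan[OF q]] by (simp add: range_push_perp_def)
  obtain b where b: "bij_betw b {0..<DIM('b)} (Basis :: 'b set)" using ex_bij_betw_nat_finite[OF finite_Basis] by blast
  define V where "V = (\<lambda>i q. cod.coord_field d (b i) (F q))"
  have "b ` {..<DIM('b)} = Basis" using b by (simp add: bij_betw_def lessThan_atLeast0)
  from arg_cong[OF this, of "image (\<lambda>b. cod.coord_field d b (F p))"]
  have img: "(\<lambda>i. V i p) ` {..<DIM('b)} = (\<lambda>b. cod.coord_field d b (F p)) ` Basis"
    by (simp add: V_def image_image)
  have Vsec: "section_along M1 M2 F U0 (V i)" for i
    unfolding V_def by (rule section_subset[OF section_coord[OF D(1)] U0(3)])
  define R where "R = (\<lambda>i q. \<Sum>a<k. g2 (F q) (V i q) (f a q) *\<^sub>R f a q)"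
  have Rsec: "section_along M1 M2 F U0 (\<lambda>q. V i q - R i q)" for i
    unfolding R_def
    by (intro section_diff U0(1) Vsec section_combination smooth_fn_metric[OF U0(1,3) D(1) Vsec] fsec) auto
  have R: "R i q \<in> rge q" "V i q - R i q \<in> rge_perp q" if q: "q \<in> U0" for i q
  proof -
    show "R i q \<in> rge q" unfolding R_def fspan[OF q, symmetric] by (rule sum_in_span)
    obtain x y where xy: "x \<in> rge q" "y \<in> rge_perp q" "V i q = x + y"
      using dec[OF q] section_tangent[OF Vsec q] unfolding fibre.orthogonal_decomposition_def by blast
    have x: "x \<in> span ((\<lambda>a. f a q) ` {..<k})" using xy(1) fspan[OF q] by simp
    have fT: "f a q \<in> tangent_space M2 (F q)" if "a < k" for a using section_tangent[OF fsec[OF that] q] .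
    have xT: "x \<in> tangent_space M2 (F q)" and yT: "y \<in> tangent_space M2 (F q)"
      using xy dec[OF q] unfolding fibre.orthogonal_decomposition_def by blast+
    have "g2 (F q) (V i q) (f a q) = g2 (F q) x (f a q)" if a: "a < k" for a
    proof -
      have "f a q \<in> rge q" unfolding fspan[OF q, symmetric] using a by (intro span_base) auto
      then have "g2 (F q) y (f a q) = 0" using xy(2) by (simp add: range_push_perp_def)
      then show ?thesis unfolding xy(3) using fibre.g_add[OF xT yT fT[OF a]] by simp
    qed
    then have "R i q = (\<Sum>a<k. g2 (F q) x (f a q) *\<^sub>R f a q)" unfolding R_def by (intro sum.cong refl) simp
    also have "\<dots> = x" by (rule fibre.orthonormal_expansion[OF fonq[OF q] x, symmetric])
    finally show "V i q - R i q \<in> rge_perp q" using xy by simp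
  qed
  obtain U' m mu where U': "open U'" "p \<in> U'" "U' \<subseteq> U0" and mu: "orthonormal_sections U' m mu"
    and mumem: "\<forall>q\<in>U'. \<forall>s<m. mu s q \<in> span ((\<lambda>i. V i q - R i q) ` {..<DIM('b)})"
    and muspan: "span ((\<lambda>s. mu s p) ` {..<m}) = span ((\<lambda>i. V i p - R i p) ` {..<DIM('b)})"
    by (rule gram_schmidt[OF U0(1-3) D(1), where V = "\<lambda>i q. V i q - R i q" and n = "DIM('b)"], rule Rsec) (rule that)
  have "span ((\<lambda>i. V i p - R i p) ` {..<DIM('b)}) = rge_perp p"
    by (rule fibre.orthogonal_decomposition_components_span[OF fibre.orthogonal_decomposition_swap[OF dec[OF U0(2)]],
          where z = "\<lambda>i. R i p" and x = "\<lambda>i. V i p"])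
      (use R[OF U0(2)] cod.coord_basis(2)[OF d] in \<open>auto simp: img\<close>)
  with muspan have muspan': "span ((\<lambda>s. mu s p) ` {..<m}) = rge_perp p" by simp
  have mumem': "mu s q \<in> rge_perp q" if "q \<in> U'" "s < m" for q s
  proof -
    have "span ((\<lambda>i. V i q - R i q) ` {..<DIM('b)}) \<subseteq> rge_perp q"
      using R(2) that(1) U'(3) by (intro span_minimal subspace_rge_perp) auto
    then show ?thesis using mumem that by blast
  qed
  have fmem: "f a q \<in> rge q" if "q \<in> U'" "a < k" for q a
  proof -
    have "q \<in> U0" using that U'(3) by blast
    show ?thesis unfolding fspan[OF \<open>q \<in> U0\<close>, symmetric] using that by (intro span_base) auto
  qed
  have "span ((\<lambda>s. mu s q) ` {..<m}) = rge_perp q" if q: "q \<in> U'" for q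
    by (rule complementary_sections_span(2)[OF dec orthonormal_sections_subset[OF fon U'(3)] mu fmem mumem' U'(2)
          fspan[OF U0(2)] muspan' q]) (use U'(3) in auto)
  then have "orthonormal_frame M1 M2 g2 F rge_perp U' m mu" using mu by (simp add: orthonormal_frame_iff)
  then show ?thesis using U'(1,2) subset_trans[OF U'(3) U0(4)] by (intro exI conjI)
qed

text \<open>In either direction the missing frames are constructed near the given point and the given ones are
  restricted to the smaller neighbourhood.\<close>

theorem harmonic_iff_minimal:
  "harmonic_map M1 g1 M2 F nabla1 nablaF \<longleftrightarrow> minimal_range M1 g1 M2 g2 F nablaF"
proof
  assume harmonic: "harmonic_map M1 g1 M2 F nabla1 nablaF"
  show "minimal_range M1 g1 M2 g2 F nablaF"
    unfolding minimal_range_def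
  proof (intro allI impI ballI, elim conjE)
    fix U k e m mu p
    assume U: "open U" and e: "orthonormal_frame M1 M1 g1 id hor U k e"
      and mu: "orthonormal_frame M1 M2 g2 F rge_perp U m mu" and p: "p \<in> U"
    obtain U1 n E where U1: "open U1" "p \<in> U1" "U1 \<subseteq> U"
      and E: "orthonormal_frame M1 M1 g1 id (\<lambda>q. tangent_space M1 (id q)) U1 n E"
      using src.orthonormal_frame_exists[OF U p] by (elim exE conjE) (rule that)
    obtain U2 k' e' l v where U2: "open U2" "p \<in> U2" "U2 \<subseteq> U1" and v: "orthonormal_frame M1 M1 g1 id ver U2 l v"
      using hor_ver_frames_exist[OF U1(1,2)] by (elim exE conjE) (rule that)
    have sub: "U2 \<subseteq> U" using U2(3) U1(3) by blast
    have E': "orthonormal_frame M1 M1 g1 id (tangent_space M1) U2 n E"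
      using src.orthonormal_frame_subset[OF E U2(3)] by simp
    have "tension M1 M2 F nabla1 nablaF n E p = 0"
      using harmonic U2(1,2) E' unfolding harmonic_map_def by blast
    then show "mean_curvature M1 M2 g2 F nablaF k e m mu p = 0"
      using tension_eq_mean_curvature[OF U2(1,2) E' src.orthonormal_frame_subset[OF e sub] v orthonormal_frame_subset[OF mu sub]]
      by simp
  qed
next
  assume minimal: "minimal_range M1 g1 M2 g2 F nablaF"
  show "harmonic_map M1 g1 M2 F nabla1 nablaF"
    unfolding harmonic_map_def
  proof (intro allI impI ballI, elim conjE)
    fix U n E p
    assume U: "open U" and E: "orthonormal_frame M1 M1 g1 id (tangent_space M1) U n E" and p: "p \<in> U"
    obtain U1 k e l v where U1: "open U1" "p \<in> U1" "U1 \<subseteq> U"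
      and e: "orthonormal_frame M1 M1 g1 id hor U1 k e" and v: "orthonormal_frame M1 M1 g1 id ver U1 l v"
      using hor_ver_frames_exist[OF U p] by (elim exE conjE) (rule that)
    obtain U2 m mu where U2: "open U2" "p \<in> U2" "U2 \<subseteq> U1" and mu: "orthonormal_frame M1 M2 g2 F rge_perp U2 m mu"
      using rge_perp_frame_exists[OF U1(1,2) e] by (elim exE conjE) (rule that)
    note e' = src.orthonormal_frame_subset[OF e U2(3)] and v' = src.orthonormal_frame_subset[OF v U2(3)]
      and E' = src.orthonormal_frame_subset[OF E subset_trans[OF U2(3) U1(3)]]
    have "mean_curvature M1 M2 g2 F nablaF k e m mu p = 0"
      using minimal U2(1,2) e' mu unfolding minimal_range_def by blast
    then show "tension M1 M2 F nabla1 nablaF n E p = 0"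
      using tension_eq_mean_curvature[OF U2(1,2) E' e' v' mu] by simp
  qed
qed

end

theorem theorem3p1:
  fixes M1 :: "('m::{t2_space,second_countable_topology}, 'a::euclidean_space) atlas"
    and M2 :: "('n::{t2_space,second_countable_topology}, 'b::euclidean_space) atlas"
    and F :: "'m \<Rightarrow> 'n"
  assumes "kaehler_manifold M1 g1 J1 nabla1"
    and "almost_hermitian_manifold M2 g2 J2"
    and "levi_civita M2 g2 nabla2"
    and "pullback_connection M1 M2 F nabla2 nablaF"
    and "holomorphic_riemannian_map M1 g1 J1 M2 g2 J2 F"
  shows "harmonic_map M1 g1 M2 F nabla1 nablaF \<longleftrightarrow> minimal_range M1 g1 M2 g2 F nablaF"
proof -
  interpret holomorphic_map_from_kaehler M1 M2 F g1 J1 nabla1 g2 J2 nabla2 nablaF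
    using assms by (rule holomorphic_map_from_kaehler.intro)
  show ?thesis by (rule harmonic_iff_minimal)
qed

end
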